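(* The decision variant of the Instance Feature Selection Problem for Explainable Optimization (FSP-EO) is NP-hard, both in its optimistic version and in its pessimistic version. That is, each of the following two decision problems is NP-hard. Given $N$ historic data points (with $p$ instance features and $q$ solution features each), an instance metric $d_{\mathcal I}$, a solution metric $d_{\mathcal X}$, a neighborhood size $k\in\mathbb N$, a feature bound $L\in\mathbb N$, and a number $B$, decide whether there is a nonempty set $S\subseteq\{1,\dots,p\}$ with $|S|\le L$ such that (optimistic version) $\displaystyle\sum_{i=1}^N\ \sum_{j\in \mathcal N_k^{\mathrm{opt}}(i,S)} d_{\mathcal X}(i,j)\le B$; (pessimistic version) $\displaystyle\sum_{i=1}^N\ \sum_{j\in \mathcal N_k^{\mathrm{pess}}(i,S)} d_{\mathcal X}(i,j)\le B$.
   Context: Notation: $[n]=\{1,\dots,n\}$. There are $N$ data points $(I^i,x^i)$, $i\in[N]$, each consisting of an instance $I^i$ and a solution $x^i$. Data point $i$ enters the problem through its instance feature vector $\phi_{\mathcal I}(I^i)\in\mathbb R^p$ and its solution feature vector $\phi_{\mathcal X}(I^i,x^i)\in\mathbb R^q$ (rational vectors in the encoding of the input). $d_{\mathcal I}$ is a metric on the instance feature space (contained in $\mathbb R^p$) and $d_{\mathcal X}$ is a metric on the solution feature space (contained in $\mathbb R^q$). No particular metric is prescribed; the admissible metrics include those induced by the 1-norm. Write $d_{\mathcal X}(i,j)=d_{\mathcal X}(\phi_{\mathcal X}(I^i,x^i),\phi_{\mathcal X}(I^j,x^j))$. For a set $S\subseteq[p]$ of selected instance features, $d_{\mathcal I}^{S}(i,j)$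 denotes the distance between the instance feature vectors of data points $i$ and $j$ when $d_{\mathcal I}$ is projected onto the coordinates in $S$; e.g. for the 1-norm, $d_{\mathcal I}^{S}(i,j)=\sum_{f\in S}|\phi_{\mathcal I}(I^i)_f-\phi_{\mathcal I}(I^j)_f|$. For $\varepsilon\ge 0$ define the strict neighbors $\mathcal N^{<}_\varepsilon(i,S)=\{j\in[N]\setminus\{i\}: d_{\mathcal I}^S(i,j)<\varepsilon\}$, the borderline neighbors $\mathcal N^{=}_\varepsilon(i,S)=\{j\in[N]\setminus\{i\}: d_{\mathcal I}^S(i,j)=\varepsilon\}$, and the neighbors $\mathcal N^{\le}_\varepsilon(i,S)=\mathcal N^{<}_\varepsilon(i,S)\cup\mathcal N^{=}_\varepsilon(i,S)$. Let $1\le k\le N-1$. For given $i$ and $S$, let $\varepsilon$ be the threshold with $|\mathcal N^{<}_\varepsilon(i,S)|<k\le|\mathcal N^{\le}_\varepsilon(i,S)|$ (i.e. the $k$-th smallest instance distance from $i$), and let $\bar k=k-|\mathcal N^{<}_\varepsilon(i,S)|$. Then $$\mathcal N_k^{\mathrm{opt}}(i,S)=\mathcal N^{<}_\varepsilon(i,S)\cup\operatorname*{arg\,min}_{J\subseteq\mathcal N^{=}_\varepsilon(i,S),\,|J|=\bar k}\ \sum_{j\in J}d_{\mathcal X}(i,j),$$ $$\mathcal N_k^{\mathrm{pess}}(i,S)=\mathcal N^{<}_\varepsilon(i,S)\cup\operatorname*{arg\,max}_{J\subseteq\mathcal N^{=}_\varepsilon(i,S),\,|J|=\bar k}\ \sum_{j\in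 J}d_{\mathcal X}(i,j),$$ where an arbitrary optimal $J$ is taken if it is not unique (this does not affect the sums). The optimization problem FSP-EO (optimistic/pessimistic) is to minimize the respective double sum over all nonempty $S\subseteq[p]$ with $|S|\le L$; the decision variant asks whether value at most $B$ is attainable. NP-hardness is with respect to polynomial-time many-one reductions. *)

theory Defs
  imports "HOL-Analysis.Abstract_Metric_Spaces" "HOL-Computational_Algebra.Polynomial"
begin

section \<open>Deterministic multi-tape Turing machines\<close>

text \<open>
  Tapes are infinite to the right only; cells are numbered from 0, and a left move in cell 0
  leaves the head where it is. States and tape symbols are natural numbers. Symbol 0 is the
  blank, 1 the left-end marker, and 2, 3 represent the bits False, True; a machine may use
  finitely many further symbols.
\<close>

datatype move = MoveLeft | Stay | MoveRight

record turing_machine =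
  tapes :: nat
  symbols :: nat
  states :: "nat set"
  start :: nat
  halt :: nat
  delta :: "nat \<Rightarrow> nat list \<Rightarrow> nat \<times> (nat \<times> move) list"

definition wf_tm :: "turing_machine \<Rightarrow> bool" where
  "wf_tm M \<longleftrightarrow>
     tapes M \<ge> 2 \<and> symbols M \<ge> 4 \<and>
     finite (states M) \<and> start M \<in> states M \<and> halt M \<in> states M \<and>
     (\<forall>q \<in> states M - {halt M}. \<forall>ss. length ss = tapes M \<and> set ss \<subseteq> {..<symbols M} \<longrightarrow>
        fst (delta M q ss) \<in> states M \<and>
        length (snd (delta M q ss)) = tapes M \<and>
        fst ` set (snd (delta M q ss)) \<subseteq> {..<symbols M})"

text \<open>A tape is given by its contents and the position of its head.\<close>

type_synonym tape = "(nat \<Rightarrow> nat) \<times> nat"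
type_synonym config = "nat \<times> tape list"

fun move_head :: "move \<Rightarrow> nat \<Rightarrow> nat" where
  "move_head MoveLeft h = h - 1"
| "move_head Stay h = h"
| "move_head MoveRight h = h + 1"

definition act :: "nat \<times> move \<Rightarrow> tape \<Rightarrow> tape" where
  "act a tp = ((fst tp)(snd tp := fst a), move_head (snd a) (snd tp))"

definition step :: "turing_machine \<Rightarrow> config \<Rightarrow> config" where
  "step M c =
     (if fst c = halt M then c
      else (let r = delta M (fst c) (map (\<lambda>tp. fst tp (snd tp)) (snd c))
            in (fst r, map2 act (snd r) (snd c))))"

definition bit_symbol :: "bool \<Rightarrow> nat" where
  "bit_symbol b = (if b then 3 else 2)"

definition tape_contents :: "bool list \<Rightarrow> nat \<Rightarrow> nat" where
  "tape_contents x n =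
     (if n = 0 then 1 else if n \<le> length x then bit_symbol (x ! (n - 1)) else 0)"

text \<open>The first tape holds the input, the second one the output.\<close>

definition init_config :: "turing_machine \<Rightarrow> bool list \<Rightarrow> config" where
  "init_config M x =
     (start M, (tape_contents x, 0) # replicate (tapes M - 1) (tape_contents [], 0))"

definition computes_in :: "turing_machine \<Rightarrow> bool list \<Rightarrow> bool list \<Rightarrow> nat \<Rightarrow> bool" where
  "computes_in M x y t \<longleftrightarrow>
     (let c = (step M ^^ t) (init_config M x)
      in fst c = halt M \<and> fst (snd c ! 1) = tape_contents y)"

section \<open>Polynomial time, NP, and NP-hardness\<close>

definition polytime :: "(bool list \<Rightarrow> bool list) \<Rightarrow> bool" where
  "polytime f \<longleftrightarrow>
     (\<exists>M (p :: nat poly). wf_tm M \<and>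
        (\<forall>x. \<exists>t \<le> poly p (length x). computes_in M x (f x) t))"

text \<open>Self-delimiting code: every bit is preceded by True, and the end is marked by False.\<close>

definition encode_bits :: "bool list \<Rightarrow> bool list" where
  "encode_bits bs = concat (map (\<lambda>b. [True, b]) bs) @ [False]"

definition string_pair :: "bool list \<Rightarrow> bool list \<Rightarrow> bool list" where
  "string_pair x u = encode_bits x @ u"

definition NP :: "bool list set set" where
  "NP = {A. \<exists>V (p :: nat poly). polytime V \<and>
              (\<forall>x. x \<in> A \<longleftrightarrow> (\<exists>u. length u \<le> poly p (length x) \<and> V (string_pair x u) = [True]))}"

definition polytime_reducible :: "bool list set \<Rightarrow> bool list set \<Rightarrow> bool" (infix "\<le>\<^sub>p" 50) where
  "A \<le>\<^sub>p B \<longleftrightarrow> (\<exists>f. polytime f \<and> (\<forall>x. x \<in> A \<longleftrightarrow> f x \<in> B))"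

definition NP_hard :: "bool list set \<Rightarrow> bool" where
  "NP_hard B \<longleftrightarrow> (\<forall>A \<in> NP. A \<le>\<^sub>p B)"

section \<open>Admissible metrics\<close>

text \<open>
  The metrics that may be chosen in an instance are given by a family d: the name c (a natural
  number) denotes, for every dimension n, the metric d c n on the n-dimensional real vectors,
  which are represented by lists of length n.
\<close>

type_synonym metric_family = "nat \<Rightarrow> nat \<Rightarrow> real list \<Rightarrow> real list \<Rightarrow> real"

definition l1_dist :: "nat \<Rightarrow> real list \<Rightarrow> real list \<Rightarrow> real" where
  "l1_dist n x y = (\<Sum>f<n. \<bar>x ! f - y ! f\<bar>)"

definition admissible_metrics :: "metric_family \<Rightarrow> bool" where
  "admissible_metrics d \<longleftrightarrow>
     (\<forall>c n. Metric_space {v. length v = n} (d c n)) \<and>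
     (\<exists>c. \<forall>n x y. length x = n \<and> length y = n \<longrightarrow> d c n x y = l1_dist n x y)"

lemma admissible_metrics_l1: "admissible_metrics (\<lambda>c. l1_dist)"
proof -
  have "Metric_space {v. length v = n} (l1_dist n)" for n
  proof
    fix x y z :: "real list"
    show "0 \<le> l1_dist n x y" by (simp add: l1_dist_def sum_nonneg)
    show "l1_dist n x y = l1_dist n y x" by (simp add: l1_dist_def abs_minus_commute)
    assume "x \<in> {v. length v = n}" "y \<in> {v. length v = n}"
    then show "(l1_dist n x y = 0) = (x = y)"
      by (auto simp: l1_dist_def sum_nonneg_eq_0_iff list_eq_iff_nth_eq)
    show "l1_dist n x z \<le> l1_dist n x y + l1_dist n y z"
      unfolding l1_dist_def sum.distrib [symmetric] by (rule sum_mono) linarith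
  qed
  then show ?thesis by (simp add: admissible_metrics_def)
qed

section \<open>The feature selection problem\<close>

text \<open>
  A data point is the pair of its instance feature vector and its solution feature vector.
  Data points and features are numbered from 0.
\<close>

record fsp =
  points :: "(rat list \<times> rat list) list"
  inst_metric :: nat
  sol_metric :: nat
  nbh_size :: nat
  feature_bound :: nat
  budget :: rat

definition num_points :: "fsp \<Rightarrow> nat" where
  "num_points I = length (points I)"

definition inst_dim :: "fsp \<Rightarrow> nat" where
  "inst_dim I = length (fst (hd (points I)))"

definition sol_dim :: "fsp \<Rightarrow> nat" where
  "sol_dim I = length (snd (hd (points I)))"

definition valid_fsp :: "fsp \<Rightarrow> bool" where
  "valid_fsp I \<longleftrightarrow>
     (\<forall>(v, w) \<in> set (points I). length v = inst_dim I \<and> length w = sol_dim I) \<and>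
     1 \<le> nbh_size I \<and> nbh_size I + 1 \<le> num_points I"

definition inst_vec :: "fsp \<Rightarrow> nat \<Rightarrow> real list" where
  "inst_vec I i = map of_rat (fst (points I ! i))"

definition sol_vec :: "fsp \<Rightarrow> nat \<Rightarrow> real list" where
  "sol_vec I i = map of_rat (snd (points I ! i))"

text \<open>Orthogonal projection onto the coordinates in S.\<close>

definition project :: "nat set \<Rightarrow> real list \<Rightarrow> real list" where
  "project S v = map (\<lambda>f. if f \<in> S then v ! f else 0) [0..<length v]"

lemma l1_dist_project:
  assumes "length x = n" "length y = n" "S \<subseteq> {..<n}"
  shows "l1_dist n (project S x) (project S y) = (\<Sum>f\<in>S. \<bar>x ! f - y ! f\<bar>)"
proof -
  have "l1_dist n (project S x) (project S y) = (\<Sum>f<n. if f \<in> S then \<bar>x ! f - y ! f\<bar> else 0)"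
    unfolding l1_dist_def by (rule sum.cong) (use assms in \<open>auto simp: project_def\<close>)
  also have "\<dots> = (\<Sum>f\<in>S. \<bar>x ! f - y ! f\<bar>)"
    using assms(3) by (simp add: sum.If_cases Int_absorb1)
  finally show ?thesis .
qed

definition inst_dist :: "metric_family \<Rightarrow> fsp \<Rightarrow> nat set \<Rightarrow> nat \<Rightarrow> nat \<Rightarrow> real" where
  "inst_dist dI I S i j =
     dI (inst_metric I) (inst_dim I) (project S (inst_vec I i)) (project S (inst_vec I j))"

definition sol_dist :: "metric_family \<Rightarrow> fsp \<Rightarrow> nat \<Rightarrow> nat \<Rightarrow> real" where
  "sol_dist dX I i j = dX (sol_metric I) (sol_dim I) (sol_vec I i) (sol_vec I j)"

definition strict_nbrs :: "metric_family \<Rightarrow> fsp \<Rightarrow> real \<Rightarrow> nat \<Rightarrow> nat set \<Rightarrow> nat set" where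
  "strict_nbrs dI I e i S = {j \<in> {..<num_points I} - {i}. inst_dist dI I S i j < e}"

definition border_nbrs :: "metric_family \<Rightarrow> fsp \<Rightarrow> real \<Rightarrow> nat \<Rightarrow> nat set \<Rightarrow> nat set" where
  "border_nbrs dI I e i S = {j \<in> {..<num_points I} - {i}. inst_dist dI I S i j = e}"

definition nbrs :: "metric_family \<Rightarrow> fsp \<Rightarrow> real \<Rightarrow> nat \<Rightarrow> nat set \<Rightarrow> nat set" where
  "nbrs dI I e i S = strict_nbrs dI I e i S \<union> border_nbrs dI I e i S"

definition is_threshold :: "metric_family \<Rightarrow> fsp \<Rightarrow> nat \<Rightarrow> nat set \<Rightarrow> real \<Rightarrow> bool" where
  "is_threshold dI I i S e \<longleftrightarrow>
     0 \<le> e \<and> card (strict_nbrs dI I e i S) < nbh_size I \<and> nbh_size I \<le> card (nbrs dI I e i S)"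

definition threshold :: "metric_family \<Rightarrow> fsp \<Rightarrow> nat \<Rightarrow> nat set \<Rightarrow> real" where
  "threshold dI I i S = (THE e. is_threshold dI I i S e)"

text \<open>The candidates for the set J of selected borderline neighbors.\<close>

definition tie_breaks :: "metric_family \<Rightarrow> fsp \<Rightarrow> nat \<Rightarrow> nat set \<Rightarrow> nat set set" where
  "tie_breaks dI I i S =
     (let e = threshold dI I i S
      in {J. J \<subseteq> border_nbrs dI I e i S \<and> card J = nbh_size I - card (strict_nbrs dI I e i S)})"

definition nbhd_opt :: "metric_family \<Rightarrow> metric_family \<Rightarrow> fsp \<Rightarrow> nat \<Rightarrow> nat set \<Rightarrow> nat set" where
  "nbhd_opt dI dX I i S =
     strict_nbrs dI I (threshold dI I i S) i S \<union>
     (ARG_MIN (\<lambda>J. \<Sum>j\<in>J. sol_dist dX I i j) J. J \<in> tie_breaks dI I i S)"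

definition nbhd_pess :: "metric_family \<Rightarrow> metric_family \<Rightarrow> fsp \<Rightarrow> nat \<Rightarrow> nat set \<Rightarrow> nat set" where
  "nbhd_pess dI dX I i S =
     strict_nbrs dI I (threshold dI I i S) i S \<union>
     (ARG_MAX (\<lambda>J. \<Sum>j\<in>J. sol_dist dX I i j) J. J \<in> tie_breaks dI I i S)"

definition value_opt :: "metric_family \<Rightarrow> metric_family \<Rightarrow> fsp \<Rightarrow> nat set \<Rightarrow> real" where
  "value_opt dI dX I S =
     (\<Sum>i<num_points I. \<Sum>j\<in>nbhd_opt dI dX I i S. sol_dist dX I i j)"

definition value_pess :: "metric_family \<Rightarrow> metric_family \<Rightarrow> fsp \<Rightarrow> nat set \<Rightarrow> real" where
  "value_pess dI dX I S =
     (\<Sum>i<num_points I. \<Sum>j\<in>nbhd_pess dI dX I i S. sol_dist dX I i j)"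

definition feasible :: "fsp \<Rightarrow> nat set \<Rightarrow> bool" where
  "feasible I S \<longleftrightarrow> S \<subseteq> {..<inst_dim I} \<and> S \<noteq> {} \<and> card S \<le> feature_bound I"

section \<open>Well-definedness of the threshold\<close>

lemma threshold_ex1:
  assumes "admissible_metrics dI" "valid_fsp I" "i < num_points I"
  shows "\<exists>!e. is_threshold dI I i S e"
proof -
  define D where "D = inst_dist dI I S i"
  define A where "A = {..<num_points I} - {i}"
  define k where "k = nbh_size I"
  have fA: "finite A" by (simp add: A_def)
  have kA: "1 \<le> k" "k \<le> card A"
    using assms(2,3) by (auto simp: A_def k_def valid_fsp_def)
  have D0: "0 \<le> D j" for j
    using assms(1) unfolding admissible_metrics_def D_def inst_dist_def
    by (meson Metric_space.nonneg)
  have strict: "strict_nbrs dI I e i S = {j \<in> A. D j < e}" for e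
    by (auto simp: strict_nbrs_def A_def D_def)
  have nonstrict: "nbrs dI I e i S = {j \<in> A. D j \<le> e}" for e
    by (auto simp: nbrs_def border_nbrs_def strict_nbrs_def A_def D_def)
  define V where "V = {e \<in> D ` A. k \<le> card {j \<in> A. D j \<le> e}}"
  have ne: "A \<noteq> {}" using kA by auto
  have "{j \<in> A. D j \<le> Max (D ` A)} = A" using fA by auto
  then have "Max (D ` A) \<in> V" using kA fA ne by (simp add: V_def)
  moreover have fV: "finite V" using fA by (simp add: V_def)
  ultimately have m: "Min V \<in> V" by (metis Min_in empty_iff)
  define e where "e = Min V"
  have e: "k \<le> card {j \<in> A. D j \<le> e}" "0 \<le> e"
    using m D0 by (auto simp: V_def e_def)
  have lt: "card {j \<in> A. D j < e} < k"
  proof (rule ccontr)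
    define B where "B = {j \<in> A. D j < e}"
    assume "\<not> card {j \<in> A. D j < e} < k"
    then have cB: "k \<le> card B" by (simp add: B_def)
    then have neB: "B \<noteq> {}" using kA by auto
    have fB: "finite B" using fA by (simp add: B_def)
    define e' where "e' = Max (D ` B)"
    have e'B: "e' \<in> D ` B" using fB neB by (simp add: e'_def)
    have "B \<subseteq> {j \<in> A. D j \<le> e'}" using fB by (auto simp: e'_def B_def)
    then have "k \<le> card {j \<in> A. D j \<le> e'}"
      using cB fA card_mono [of "{j \<in> A. D j \<le> e'}" B] by simp
    then have "e' \<in> V" using e'B by (auto simp: V_def B_def)
    then have "e \<le> e'" using fV by (simp add: e_def)
    then show False using e'B by (auto simp: B_def)
  qed
  have ex: "is_threshold dI I i S e"
    using e lt by (simp add: is_threshold_def strict nonstrict k_def)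
  have less: False if "is_threshold dI I i S a" "is_threshold dI I i S b" "a < b" for a b
  proof -
    have "card {j \<in> A. D j \<le> a} \<le> card {j \<in> A. D j < b}"
      using fA that(3) by (intro card_mono) auto
    then show False using that by (simp add: is_threshold_def strict nonstrict)
  qed
  show ?thesis using ex less by (metis linorder_less_linear)
qed

section \<open>Encoding of the input and the decision problems\<close>

text \<open>
  Numbers are written in binary, least significant bit first, and rationals as numerator and
  denominator in lowest terms.
\<close>

fun binary :: "nat \<Rightarrow> bool list" where
  "binary n = (if n = 0 then [] else odd n # binary (n div 2))"

declare binary.simps [simp del]

definition encode_nat :: "nat \<Rightarrow> bool list" where
  "encode_nat n = encode_bits (binary n)"

definition encode_int :: "int \<Rightarrow> bool list" where
  "encode_int z = (z < 0) # encode_nat (nat \<bar>z\<bar>)"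

definition encode_rat :: "rat \<Rightarrow> bool list" where
  "encode_rat r = encode_int (fst (quotient_of r)) @ encode_int (snd (quotient_of r))"

definition encode_list :: "('a \<Rightarrow> bool list) \<Rightarrow> 'a list \<Rightarrow> bool list" where
  "encode_list enc xs = concat (map (\<lambda>x. True # enc x) xs) @ [False]"

definition encode_point :: "rat list \<times> rat list \<Rightarrow> bool list" where
  "encode_point P = encode_list encode_rat (fst P) @ encode_list encode_rat (snd P)"

definition encode_fsp :: "fsp \<Rightarrow> bool list" where
  "encode_fsp I =
     encode_list encode_point (points I) @
     encode_nat (inst_metric I) @ encode_nat (sol_metric I) @
     encode_nat (nbh_size I) @ encode_nat (feature_bound I) @ encode_rat (budget I)"

definition FSP_EO_opt :: "metric_family \<Rightarrow> metric_family \<Rightarrow> bool list set" where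
  "FSP_EO_opt dI dX =
     {encode_fsp I | I. valid_fsp I \<and> (\<exists>S. feasible I S \<and> value_opt dI dX I S \<le> of_rat (budget I))}"

definition FSP_EO_pess :: "metric_family \<Rightarrow> metric_family \<Rightarrow> bool list set" where
  "FSP_EO_pess dI dX =
     {encode_fsp I | I. valid_fsp I \<and> (\<exists>S. feasible I S \<and> value_pess dI dX I S \<le> of_rat (budget I))}"

text \<open>The encoding is injective, hence these languages represent the decision problems.\<close>

lemma encode_bits_prefix_free: "encode_bits x @ u = encode_bits y @ v \<Longrightarrow> x = y \<and> u = v"
proof (induction x arbitrary: y)
  case Nil
  then show ?case by (cases y) (auto simp: encode_bits_def)
next
  case (Cons a x)
  then show ?case by (cases y) (auto simp: encode_bits_def)
qed

lemma binary_eq_Nil_iff: "binary n = [] \<longleftrightarrow> n = 0"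
  by (subst binary.simps) simp

lemma binary_inj: "binary m = binary n \<Longrightarrow> m = n"
proof (induction m arbitrary: n rule: less_induct)
  case (less m)
  show ?case
  proof (cases "m = 0 \<or> n = 0")
    case True
    then show ?thesis using less.prems binary_eq_Nil_iff by metis
  next
    case False
    have unfold: "binary k = odd k # binary (k div 2)" if "k \<noteq> 0" for k
      using that by (subst binary.simps) simp
    have "odd m = odd n" and eq: "binary (m div 2) = binary (n div 2)"
      using less.prems unfold [of m] unfold [of n] False by auto
    from eq have "m div 2 = n div 2" using False by (intro less.IH) auto
    then show ?thesis using \<open>odd m = odd n\<close>
      by (metis even_two_times_div_two odd_two_times_div_two_succ)
  qed
qed

lemma encode_nat_prefix_free: "encode_nat m @ u = encode_nat n @ v \<Longrightarrow> m = n \<and> u = v"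
  unfolding encode_nat_def using encode_bits_prefix_free binary_inj by blast

lemma encode_int_prefix_free: "encode_int a @ u = encode_int b @ v \<Longrightarrow> a = b \<and> u = v"
  unfolding encode_int_def by (auto dest!: encode_nat_prefix_free)

lemma encode_rat_prefix_free:
  assumes "encode_rat r @ u = encode_rat s @ v"
  shows "r = s \<and> u = v"
proof -
  have eq: "encode_int (fst (quotient_of r)) @ encode_int (snd (quotient_of r)) @ u =
        encode_int (fst (quotient_of s)) @ encode_int (snd (quotient_of s)) @ v"
    using assms by (simp add: encode_rat_def)
  from encode_int_prefix_free [OF eq] have "fst (quotient_of r) = fst (quotient_of s)"
    and rest: "encode_int (snd (quotient_of r)) @ u = encode_int (snd (quotient_of s)) @ v"
    by blast+
  with encode_int_prefix_free [OF rest] show ?thesis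
    by (simp add: quotient_of_inject prod_eq_iff)
qed

lemma encode_list_prefix_free:
  assumes "\<And>a b u v. enc a @ u = enc b @ v \<Longrightarrow> a = b \<and> u = v"
  shows "encode_list enc x @ u = encode_list enc y @ v \<Longrightarrow> x = y \<and> u = v"
proof (induction x arbitrary: y)
  case Nil
  then show ?case by (cases y) (auto simp: encode_list_def)
next
  case (Cons a x)
  then obtain b y' where y: "y = b # y'" by (cases y) (auto simp: encode_list_def)
  have "enc a @ encode_list enc x @ u = enc b @ encode_list enc y' @ v"
    using Cons.prems by (simp add: y encode_list_def)
  then have "a = b" "encode_list enc x @ u = encode_list enc y' @ v"
    using assms by blast+
  then show ?case using Cons.IH y by blast
qed

lemma encode_point_prefix_free:
  assumes "encode_point P @ u = encode_point Q @ v"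
  shows "P = Q \<and> u = v"
proof -
  have "encode_list encode_rat (fst P) @ encode_list encode_rat (snd P) @ u =
        encode_list encode_rat (fst Q) @ encode_list encode_rat (snd Q) @ v"
    using assms by (simp add: encode_point_def)
  from encode_list_prefix_free [OF encode_rat_prefix_free this]
  have "fst P = fst Q"
    and rest: "encode_list encode_rat (snd P) @ u = encode_list encode_rat (snd Q) @ v"
    by blast+
  with encode_list_prefix_free [OF encode_rat_prefix_free rest] show ?thesis
    by (simp add: prod_eq_iff)
qed

lemma encode_fsp_inj:
  assumes "encode_fsp I = encode_fsp J"
  shows "I = J"
proof -
  let ?rest = "\<lambda>I. encode_nat (inst_metric I) @ encode_nat (sol_metric I) @
     encode_nat (nbh_size I) @ encode_nat (feature_bound I) @ encode_rat (budget I) @ []"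
  have "encode_list encode_point (points I) @ ?rest I =
        encode_list encode_point (points J) @ ?rest J"
    using assms by (simp add: encode_fsp_def)
  from encode_list_prefix_free [OF encode_point_prefix_free this]
  have "points I = points J" and rest: "?rest I = ?rest J" by blast+
  note eq1 = encode_nat_prefix_free [OF rest]
  note eq2 = encode_nat_prefix_free [OF conjunct2 [OF eq1]]
  note eq3 = encode_nat_prefix_free [OF conjunct2 [OF eq2]]
  note eq4 = encode_nat_prefix_free [OF conjunct2 [OF eq3]]
  note eq5 = encode_rat_prefix_free [OF conjunct2 [OF eq4]]
  show ?thesis
    using \<open>points I = points J\<close> eq1 eq2 eq3 eq4 eq5 by (intro fsp.equality) simp_all
qed

end

theory Submission
  imports Defs "HOL-Library.Countable"
begin

text \<open>
  Let a problem in NP be given by a verifier with a polynomial certificate bound. As in the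
  Cook-Levin theorem, the inputs with a certificate are those for which the space-time diagram of the
  verifier can be completed. The diagram is a square of tiles, where each tile repeats the state and
  the scanned symbols of all tapes and the head positions next to it, so that all constraints concern
  single tiles or two adjacent tiles.

  The placements of tiles are the features. There is one neighbour per point and the budget is 0, so a
  selection is accepted iff each point and its nearest neighbour have the same solution. The solutions
  are 0 and 1. The anchor is the zero vector, the reference points are constantly 4, and each constraint
  is a pair of equal points whose weights deviate from 4 on the few features concerned. Only these have
  solution 1. The anchor is close to a reference point, and not to a constraint point, iff the
  deviations of each constraint have a positive sum over the selected features; an additional feature
  in the role of the constant 1 makes all these sums nonzero. Since strict inequalities decide, ties
  are irrelevant, and the same instance serves for both versions.

  The instance is printed by nested loops over the positions of a word of polynomial length, and what
  is printed depends only on the letters at the loop positions and on whether two loop positions are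
  equal or adjacent. Such a program is a composition of two kinds of simple machines: one copies a word
  once for each of its positions, with this position marked, and the other one is a finite-state
  transducer.
\<close>

section \<open>Functions computed in polynomial time\<close>

text \<open>The 1-norm distance from the anchor is the sum of the weights over \<open>S\<close>. A
  reference point contributes 4 per selected feature, so whatever the size of \<open>S\<close> only
  deviations from 4 are compared; the baseline 4 also keeps the weights of constraint points
  positive. The deviations are 2 or -2 on tile features and odd on the additional feature. If
  \<open>N\<close> selected tile features are concerned, the sums become 2N - 1 (some tile), 1 - 2N
  (not this tile) and 3 - 2N (not both tiles of a pair), hence never 0. Nothing limits the number of
  tiles selected for a cell; any choice among them is a tiling, because forbidden pairs are excluded
  for all selected tiles. Only the anchor carries information: every other point has a twin at
  distance 0, and the weight of the additional feature is 0 or 4 exactly for solution 0, so points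
  with different solutions are never at distance 0 once it is selected. Printing needs no arithmetic
  on tapes: all weights come from a fixed finite set, and the comparisons of loop positions are read
  off from marks.\<close>

definition tape_of :: "nat list \<Rightarrow> nat \<Rightarrow> nat" where
  "tape_of w n = (if n = 0 then 1 else if n \<le> length w then w ! (n - 1) else 0)"

lemma tape_contents_eq: "tape_contents x = tape_of (map bit_symbol x)"
  by (auto simp: tape_contents_def tape_of_def fun_eq_iff)

lemma tape_of_snoc: "(tape_of w)(Suc (length w) := a) = tape_of (w @ [a])"
  by (auto simp: tape_of_def fun_eq_iff nth_append)

text \<open>
  Unlike in \<^const>\<open>wf_tm\<close>, the transition function is constrained for arbitrary scanned
  symbols, so that runs need no invariant on the tape symbols.
\<close>

definition good_tm :: "turing_machine \<Rightarrow> bool" where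
  "good_tm M \<longleftrightarrow>
     tapes M \<ge> 2 \<and> symbols M \<ge> 4 \<and>
     finite (states M) \<and> start M \<in> states M \<and> halt M \<in> states M \<and>
     (\<forall>q \<in> states M - {halt M}. \<forall>ss. length ss = tapes M \<longrightarrow>
        fst (delta M q ss) \<in> states M \<and>
        length (snd (delta M q ss)) = tapes M \<and>
        (\<forall>i<tapes M. fst (snd (delta M q ss) ! i) < symbols M \<or>
                      fst (snd (delta M q ss) ! i) = ss ! i))"

lemma good_imp_wf_tm:
  assumes "good_tm M"
  shows "wf_tm M"
proof -
  have "fst ` set (snd (delta M q ss)) \<subseteq> {..<symbols M}"
    if q: "q \<in> states M - {halt M}" and ss: "length ss = tapes M" "set ss \<subseteq> {..<symbols M}" for q ss
  proof
    fix a assume "a \<in> fst ` set (snd (delta M q ss))"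
    then obtain i where i: "i < length (snd (delta M q ss))" "a = fst (snd (delta M q ss) ! i)"
      by (auto simp: in_set_conv_nth)
    have "ss ! i < symbols M"
      using i ss assms q unfolding good_tm_def by (metis lessThan_iff nth_mem subsetD)
    then show "a \<in> {..<symbols M}"
      using assms q ss(1) i unfolding good_tm_def by (metis lessThan_iff)
  qed
  then show ?thesis using assms unfolding good_tm_def wf_tm_def by blast
qed

definition start_config :: "turing_machine \<Rightarrow> nat list \<Rightarrow> config" where
  "start_config M v = (start M, (tape_of v, 0) # replicate (tapes M - 1) (tape_of [], 0))"

definition computes :: "turing_machine \<Rightarrow> nat list \<Rightarrow> nat list \<Rightarrow> nat \<Rightarrow> bool" where
  "computes M v w t \<longleftrightarrow>
     (let c = (step M ^^ t) (start_config M v)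
      in fst c = halt M \<and> fst (snd c ! 1) = tape_of w)"

text \<open>The domain \<open>D\<close> is a promise: nothing is required outside it. The length of
  the output is bounded together with the time because composition evaluates the second time bound
  at that length.\<close>

definition ptime :: "'a set \<Rightarrow> ('a \<Rightarrow> nat list) \<Rightarrow> ('b \<Rightarrow> nat list) \<Rightarrow> ('a \<Rightarrow> 'b) \<Rightarrow> bool" where
  "ptime D eI eO F \<longleftrightarrow>
     (\<exists>M (p :: nat poly). good_tm M \<and>
        (\<forall>x\<in>D. length (eO (F x)) \<le> poly p (length (eI x)) \<and>
               (\<exists>t \<le> poly p (length (eI x)). computes M (eI x) (eO (F x)) t)))"

lemma ptime_imp_polytime:
  assumes "ptime UNIV (map bit_symbol) (map bit_symbol) f"
  shows "polytime f"
proof -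
  have "computes_in M x y t \<longleftrightarrow> computes M (map bit_symbol x) (map bit_symbol y) t" for M x y t
    by (simp add: computes_in_def computes_def init_config_def start_config_def tape_contents_eq)
  then show ?thesis
    using assms good_imp_wf_tm unfolding ptime_def polytime_def by (metis UNIV_I length_map)
qed

lemma poly_nat_mono: "m \<le> n \<Longrightarrow> poly p m \<le> poly p n" for p :: "nat poly"
  by (induction p) (auto intro: add_mono mult_mono)

section \<open>Composition\<close>

lemma act_stay [simp]: "act (fst tp (snd tp), Stay) tp = tp"
  by (simp add: act_def)

lemma map2_act_stay: "map2 act (map (\<lambda>tp. (fst tp (snd tp), Stay)) ts) ts = ts"
  by (induction ts) auto

lemma step_pow_add: "(step M ^^ (a + b)) c = (step M ^^ b) ((step M ^^ a) c)"
  by (metis add.commute comp_apply funpow_add)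

lemma step_halt_pow: "fst c = halt M \<Longrightarrow> (step M ^^ t) c = c"
  by (induction t) (auto simp: step_def)

text \<open>Halting configurations are fixed points, so a run can be cut at its first halt.
  Composition needs this: the halting state of the first machine gets a new meaning there, so the
  simulation must not run past it.\<close>

lemma first_halting_time:
  assumes "fst ((step M ^^ t) c) = halt M"
  shows "\<exists>s\<le>t. (step M ^^ s) c = (step M ^^ t) c \<and> (\<forall>r<s. fst ((step M ^^ r) c) \<noteq> halt M)"
proof -
  define s where "s = (LEAST s. fst ((step M ^^ s) c) = halt M)"
  have s: "fst ((step M ^^ s) c) = halt M" unfolding s_def by (rule LeastI) (rule assms)
  have "s \<le> t" unfolding s_def by (rule Least_le) (rule assms)
  moreover from this have "(step M ^^ t) c = (step M ^^ s) c"
    using step_pow_add [of s "t - s" M c] step_halt_pow [OF s] by simp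
  moreover have "fst ((step M ^^ r) c) \<noteq> halt M" if "r < s" for r
    using that not_less_Least unfolding s_def by blast
  ultimately show ?thesis by metis
qed

lemma length_tapes_step:
  assumes "good_tm M" "fst c \<in> states M" "length (snd c) = tapes M"
  shows "fst (step M c) \<in> states M \<and> length (snd (step M c)) = tapes M"
  using assms unfolding good_tm_def step_def Let_def by auto

lemma length_tapes_steps:
  assumes "good_tm M" "fst c \<in> states M" "length (snd c) = tapes M"
  shows "fst ((step M ^^ t) c) \<in> states M \<and> length (snd ((step M ^^ t) c)) = tapes M"
  by (induction t) (use assms length_tapes_step in auto)

lemma move_head_le: "move_head mv h \<le> Suc h"
  by (cases mv) auto

lemma head_step_le:
  assumes "\<forall>tp\<in>set (snd c). snd tp \<le> n"
  shows "\<forall>tp\<in>set (snd (step M c)). snd tp \<le> Suc n"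
proof
  fix tp assume tp: "tp \<in> set (snd (step M c))"
  show "snd tp \<le> Suc n"
  proof (cases "fst c = halt M")
    case True
    then show ?thesis using tp assms by (auto simp: step_def le_SucI)
  next
    case False
    then have "tp \<in> (\<lambda>(a, tp). act a tp) `
        set (zip (snd (delta M (fst c) (map (\<lambda>tp. fst tp (snd tp)) (snd c)))) (snd c))"
      using tp by (simp add: step_def Let_def)
    then obtain a tp' where "tp' \<in> set (snd c)" "tp = act a tp'"
      by (auto dest: set_zip_rightD)
    then show ?thesis
      using assms move_head_le [of "snd a" "snd tp'"] by (fastforce simp: act_def)
  qed
qed

text \<open>Heads move by at most one cell per step. This bounds the time for rewinding the link
  tape, and later keeps all heads inside the square of tiles.\<close>

lemma head_steps_le:
  assumes "\<forall>tp\<in>set (snd c). snd tp = 0"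
  shows "\<forall>tp\<in>set (snd ((step M ^^ t) c)). snd tp \<le> t"
  by (induction t) (use assms head_step_le in auto)

text \<open>
  Tape layout of the composed machine: input of \<open>M1\<close>, output of \<open>M2\<close>, the link tape (output of
  \<open>M1\<close> and input of \<open>M2\<close>), work tapes of \<open>M1\<close>, work tapes of \<open>M2\<close>. The halting state of \<open>M1\<close>
  is used to rewind the link tape.
\<close>

definition compose_tm :: "turing_machine \<Rightarrow> turing_machine \<Rightarrow> turing_machine" where
  "compose_tm M1 M2 =
     \<lparr>tapes = tapes M1 + tapes M2 - 1,
      symbols = max (symbols M1) (symbols M2),
      states = (\<lambda>q. 2 * q) ` states M1 \<union> (\<lambda>q. 2 * q + 1) ` states M2,
      start = 2 * start M1,
      halt = 2 * halt M2 + 1,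
      delta = (\<lambda>q ss.
        let st = map (\<lambda>s. (s, Stay)) ss in
        if even q then
          (if q div 2 = halt M1 then
             (if ss ! 2 = 1 then (2 * start M2 + 1, st)
              else (q, st[2 := (ss ! 2, MoveLeft)]))
           else
             (let r = delta M1 (q div 2) (ss ! 0 # ss ! 2 # take (tapes M1 - 2) (drop 3 ss))
              in (2 * fst r, snd r ! 0 # st ! 1 # snd r ! 1 # drop 2 (snd r) @ drop (tapes M1 + 1) st)))
        else
          (let r = delta M2 (q div 2) (ss ! 2 # ss ! 1 # drop (tapes M1 + 1) ss)
           in (2 * fst r + 1,
               st ! 0 # snd r ! 1 # snd r ! 0 # take (tapes M1 - 2) (drop 3 st) @ drop 2 (snd r))))\<rparr>"

lemma list_ge2: "length xs = k \<Longrightarrow> 2 \<le> k \<Longrightarrow> \<exists>a b us. xs = a # b # us \<and> length us = k - 2"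
  by (cases xs; cases "tl xs") auto

lemma good_compose_tm:
  assumes g1: "good_tm M1" and g2: "good_tm M2"
  shows "good_tm (compose_tm M1 M2)"
proof -
  let ?M = "compose_tm M1 M2"
  have K: "2 \<le> tapes M1" "2 \<le> tapes M2" using g1 g2 by (auto simp: good_tm_def)
  have "fst (delta ?M q ss) \<in> states ?M \<and> length (snd (delta ?M q ss)) = tapes ?M \<and>
        (\<forall>i<tapes ?M. fst (snd (delta ?M q ss) ! i) < symbols ?M \<or>
                      fst (snd (delta ?M q ss) ! i) = ss ! i)"
    if q: "q \<in> states ?M - {halt ?M}" and ss: "length ss = tapes ?M" for q ss
  proof -
    have "length ss = tapes M1 + tapes M2 - 1" using ss by (simp add: compose_tm_def)
    then have l3: "length (drop 3 ss) = (tapes M1 - 2) + (tapes M2 - 2)" "3 \<le> length ss" using K by auto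
    obtain a b c vs where "ss = a # b # c # vs"
      using l3(2) by (auto simp: numeral_3_eq_3 Suc_le_length_iff)
    \<comment> \<open>\<open>us\<close> and \<open>ws\<close> are the symbols on the work tapes of
      \<open>M1\<close> and \<open>M2\<close>, as in the tape layout.\<close>
    then obtain us ws where sp: "ss = a # b # c # us @ ws"
      and lu: "length us = tapes M1 - 2" "length ws = tapes M2 - 2"
      using l3 by (metis (no_types, lifting) append_take_drop_id length_drop length_take drop_Suc_Cons
        drop0 numeral_3_eq_3 diff_add_inverse le_add1 min.absorb2)
    have T1: "tapes M1 = length us + 2" and T2: "tapes M2 = length ws + 2" using lu K by simp_all
    have nth_M: "fst ((a' # b' # c' # us' @ ws') ! i) < n \<or> fst ((a' # b' # c' # us' @ ws') ! i) = ss ! i"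
      if "fst a' < n \<or> fst a' = a" "fst b' < n \<or> fst b' = b" "fst c' < n \<or> fst c' = c"
         "length us' = length us" "\<And>i. i < length us \<Longrightarrow> fst (us' ! i) < n \<or> fst (us' ! i) = us ! i"
         "length ws' = length ws" "\<And>i. i < length ws \<Longrightarrow> fst (ws' ! i) < n \<or> fst (ws' ! i) = ws ! i"
         "i < length ss"
       for i n and a' b' c' :: "nat \<times> move" and us' ws'
      using that unfolding sp by (auto simp: nth_Cons nth_append split: nat.splits)
    consider q1 where "q = 2 * q1" "q1 \<in> states M1" "q1 \<noteq> halt M1"
      | "q = 2 * halt M1" | q2 where "q = 2 * q2 + 1" "q2 \<in> states M2" "q2 \<noteq> halt M2"
      using q by (auto simp: compose_tm_def)
    then show ?thesis
    proof cases
      case 1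
      define r where "r = delta M1 q1 (a # c # us)"
      have r: "fst r \<in> states M1" "length (snd r) = tapes M1"
        "\<And>i. i < tapes M1 \<Longrightarrow> fst (snd r ! i) < symbols M1 \<or> fst (snd r ! i) = (a # c # us) ! i"
        using g1 1 lu K unfolding r_def good_tm_def by auto
      obtain x y zs where xyz: "snd r = x # y # zs" "length zs = length us"
        using list_ge2 [OF r(2) K(1)] lu by auto
      have del: "delta ?M q ss = (2 * fst r, x # (b, Stay) # y # zs @ map (\<lambda>s. (s, Stay)) ws)"
        using 1(1,3) xyz unfolding compose_tm_def
        by (simp add: Let_def sp r_def [symmetric] drop_map T1 numeral_3_eq_3)
      have z: "fst (zs ! i) < symbols ?M \<or> fst (zs ! i) = us ! i" if "i < length us" for i
        using r(3) [of "Suc (Suc i)"] that xyz T1 by (auto simp: compose_tm_def)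
      have "fst x < symbols ?M \<or> fst x = a" "fst y < symbols ?M \<or> fst y = c"
        using r(3) [of 0] r(3) [of 1] xyz K by (auto simp: compose_tm_def)
      then have "\<forall>i<tapes ?M. fst (snd (delta ?M q ss) ! i) < symbols ?M \<or> fst (snd (delta ?M q ss) ! i) = ss ! i"
        unfolding del snd_conv ss [symmetric] using xyz(2) z by (intro allI impI nth_M) auto
      moreover have "fst (delta ?M q ss) \<in> states ?M" using r(1) unfolding del by (simp add: compose_tm_def)
      moreover have "length (snd (delta ?M q ss)) = tapes ?M"
        unfolding del ss [symmetric] using xyz(2) by (simp add: sp)
      ultimately show ?thesis by blast
    next
      case 2
      have "start M2 \<in> states M2" "halt M1 \<in> states M1" using g1 g2 by (auto simp: good_tm_def)
      moreover have "fst ((map (\<lambda>s. (s, Stay)) ss)[2 := (ss ! 2, MoveLeft)] ! i) = ss ! i"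
        if "i < length ss" for i using that by (cases "i = 2") auto
      ultimately show ?thesis using 2 ss
        by (auto simp: compose_tm_def Let_def)
    next
      case 3
      define r where "r = delta M2 q2 (c # b # ws)"
      have r: "fst r \<in> states M2" "length (snd r) = tapes M2"
        "\<And>i. i < tapes M2 \<Longrightarrow> fst (snd r ! i) < symbols M2 \<or> fst (snd r ! i) = (c # b # ws) ! i"
        using g2 3 lu K unfolding r_def good_tm_def by auto
      obtain x y zs where xyz: "snd r = x # y # zs" "length zs = length ws"
        using list_ge2 [OF r(2) K(2)] lu by auto
      have del: "delta ?M q ss = (2 * fst r + 1, (a, Stay) # y # x # map (\<lambda>s. (s, Stay)) us @ zs)"
        using 3(1,3) xyz unfolding compose_tm_def
        by (simp add: Let_def sp r_def [symmetric] drop_map take_map T1 numeral_3_eq_3)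
      have z: "fst (zs ! i) < symbols ?M \<or> fst (zs ! i) = ws ! i" if "i < length ws" for i
        using r(3) [of "Suc (Suc i)"] that xyz T2 by (auto simp: compose_tm_def)
      have "fst x < symbols ?M \<or> fst x = c" "fst y < symbols ?M \<or> fst y = b"
        using r(3) [of 0] r(3) [of 1] xyz K by (auto simp: compose_tm_def)
      then have "\<forall>i<tapes ?M. fst (snd (delta ?M q ss) ! i) < symbols ?M \<or> fst (snd (delta ?M q ss) ! i) = ss ! i"
        unfolding del snd_conv ss [symmetric] using xyz(2) z by (intro allI impI nth_M) auto
      moreover have "fst (delta ?M q ss) \<in> states ?M" using r(1) unfolding del by (simp add: compose_tm_def)
      moreover have "length (snd (delta ?M q ss)) = tapes ?M"
        unfolding del ss [symmetric] using xyz(2) by (simp add: sp)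
      ultimately show ?thesis by blast
    qed
  qed
  moreover have "tapes ?M \<ge> 2" "symbols ?M \<ge> 4" "finite (states ?M)" "start ?M \<in> states ?M"
    "halt ?M \<in> states ?M"
    using g1 g2 by (auto simp: good_tm_def compose_tm_def)
  ultimately show ?thesis unfolding good_tm_def by blast
qed

text \<open>The tapes \<open>b\<close> and \<open>ws\<close> belong to \<open>M2\<close> alone and
  pass through unchanged. An even state never equals the odd halting state of the composed
  machine.\<close>

lemma compose_step1:
  assumes g1: "good_tm M1" and q: "q \<in> states M1" "q \<noteq> halt M1"
    and l: "length us + 2 = tapes M1"
    and st: "step M1 (q, a # c # us) = (q', a' # c' # us')"
  shows "step (compose_tm M1 M2) (2 * q, a # b # c # us @ ws) = (2 * q', a' # b # c' # us' @ ws)"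
    and "length us' + 2 = tapes M1"
proof -
  let ?sc = "\<lambda>tp. fst tp (snd tp)"
  define r where "r = delta M1 q (map ?sc (a # c # us))"
  have K: "2 \<le> tapes M1" using g1 by (simp add: good_tm_def)
  have rf: "delta M1 q (?sc a # ?sc c # map ?sc us) = r" by (simp add: r_def)
  have "length (snd r) = tapes M1" using g1 q l unfolding r_def good_tm_def by auto
  then obtain x y zs where xyz: "snd r = x # y # zs" "length zs = length us"
    using list_ge2 [OF _ K] l by (metis add_diff_cancel_right')
  have e: "q' = fst r" "a' = act x a" "c' = act y c" "us' = map2 act zs us"
    using st q xyz unfolding step_def r_def by (auto simp: Let_def)
  then show "length us' + 2 = tapes M1" using xyz l by simp
  have d: "drop (tapes M1) (?sc b # ?sc c # map ?sc us @ map ?sc ws) = map ?sc ws"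
    "take (tapes M1 - 2) (map ?sc us @ map ?sc ws) = map ?sc us"
    using l by (auto simp: l [symmetric])
  have del: "delta (compose_tm M1 M2) (2 * q) (map ?sc (a # b # c # us @ ws)) =
      (2 * fst r, x # (?sc b, Stay) # y # zs @ map (\<lambda>tp. (?sc tp, Stay)) ws)"
    using q(2) d xyz unfolding compose_tm_def
    by (simp add: Let_def numeral_3_eq_3 rf drop_map comp_def l [symmetric])
  have "2 * q \<noteq> halt (compose_tm M1 M2)" by (simp add: compose_tm_def) presburger
  then show "step (compose_tm M1 M2) (2 * q, a # b # c # us @ ws) = (2 * q', a' # b # c' # us' @ ws)"
    unfolding step_def fst_conv snd_conv del Let_def using e xyz(2) by (simp add: map2_act_stay)
qed

lemma compose_step2:
  assumes g2: "good_tm M2" and q: "q \<in> states M2" "q \<noteq> halt M2"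
    and l: "length us + 2 = tapes M1" "length ws + 2 = tapes M2"
    and st: "step M2 (q, c # b # ws) = (q', c' # b' # ws')"
  shows "step (compose_tm M1 M2) (2 * q + 1, a # b # c # us @ ws) = (2 * q' + 1, a # b' # c' # us @ ws')"
    and "length ws' + 2 = tapes M2"
proof -
  let ?sc = "\<lambda>tp. fst tp (snd tp)"
  define r where "r = delta M2 q (map ?sc (c # b # ws))"
  have K: "2 \<le> tapes M2" using g2 by (simp add: good_tm_def)
  have rf: "delta M2 q (?sc c # ?sc b # map ?sc ws) = r" by (simp add: r_def)
  have "length (snd r) = tapes M2" using g2 q l unfolding r_def good_tm_def by auto
  then obtain x y zs where xyz: "snd r = x # y # zs" "length zs = length ws"
    using list_ge2 [OF _ K] l by (metis add_diff_cancel_right')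
  have e: "q' = fst r" "c' = act x c" "b' = act y b" "ws' = map2 act zs ws"
    using st q xyz unfolding step_def r_def by (auto simp: Let_def)
  then show "length ws' + 2 = tapes M2" using xyz l by simp
  have d: "drop (tapes M1) (?sc b # ?sc c # map ?sc us @ map ?sc ws) = map ?sc ws"
    using l by (auto simp: l(1) [symmetric])
  have del: "delta (compose_tm M1 M2) (2 * q + 1) (map ?sc (a # b # c # us @ ws)) =
      (2 * fst r + 1, (?sc a, Stay) # y # x # map (\<lambda>tp. (?sc tp, Stay)) us @ zs)"
    using q(2) d xyz unfolding compose_tm_def
    by (simp add: Let_def numeral_3_eq_3 rf drop_map take_map comp_def l(1) [symmetric])
  have "2 * q + 1 \<noteq> halt (compose_tm M1 M2)" using q by (simp add: compose_tm_def)
  then show "step (compose_tm M1 M2) (2 * q + 1, a # b # c # us @ ws) = (2 * q' + 1, a # b' # c' # us @ ws')"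
    unfolding step_def fst_conv snd_conv del Let_def using e xyz(2) by (simp add: map2_act_stay)
qed

text \<open>Since all letters of \<open>v\<close> are at least 2, the symbol 1 occurs in cell 0 only
  and stops the head there. The extra step is the change of state.\<close>

lemma compose_rewind:
  fixes M1 M2 :: turing_machine
  assumes "2 \<le> tapes M1" "set v \<subseteq> {2..}"
  shows "(step (compose_tm M1 M2) ^^ Suc h) (2 * halt M1, a # b # (tape_of v, h) # ts) =
         (2 * start M2 + 1, a # b # (tape_of v, 0) # ts)"
proof (induction h)
  case 0
  have "2 * halt M1 \<noteq> 2 * halt M2 + 1" by presburger
  moreover have "(tape_of v)(0 := 1) = tape_of v" "tape_of v 0 = 1"
    by (auto simp: tape_of_def)
  ultimately show ?case
    by (simp add: step_def compose_tm_def Let_def act_def map2_act_stay comp_def del: One_nat_def)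
next
  case (Suc h)
  have 1: "tape_of v (Suc h) \<noteq> 1"
  proof (cases "h < length v")
    case True
    then have "v ! h \<in> {2..}" using assms nth_mem by blast
    then show ?thesis using True by (simp add: tape_of_def)
  qed (simp add: tape_of_def)
  have "2 * halt M1 \<noteq> 2 * halt M2 + 1" by presburger
  then have "step (compose_tm M1 M2) (2 * halt M1, a # b # (tape_of v, Suc h) # ts) =
    (2 * halt M1, a # b # (tape_of v, h) # ts)"
    using 1 by (simp add: step_def compose_tm_def Let_def act_def map2_act_stay comp_def)
  then show ?case using Suc by (simp add: funpow_swap1)
qed

text \<open>Once rewound, the output tape of \<open>M1\<close> is literally an initial input tape of
  \<open>M2\<close>, as both carry the end marker in cell 0. The link head is at most
  \<open>t1\<close> cells away from it, which accounts for the factor 2.\<close>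

lemma computes_compose:
  assumes g1: "good_tm M1" and g2: "good_tm M2"
    and c1: "computes M1 u v t1" and c2: "computes M2 v w t2" and v: "set v \<subseteq> {2..}"
  shows "\<exists>t \<le> 2 * t1 + t2 + 1. computes (compose_tm M1 M2) u w t"
proof -
  let ?M = "compose_tm M1 M2"
  let ?e = "(tape_of [], 0) :: tape"
  have K: "2 \<le> tapes M1" "2 \<le> tapes M2" using g1 g2 by (auto simp: good_tm_def)
  define ws0 where "ws0 = replicate (tapes M2 - 2) ?e"
  have rep: "replicate (tapes M - 1) ?e = ?e # replicate (tapes M - 2) ?e" if "2 \<le> tapes M"
    for M :: turing_machine
  proof -
    have "tapes M - 1 = Suc (tapes M - 2)" using that by simp
    then show ?thesis by (metis replicate_Suc)
  qed
  have h1: "fst ((step M1 ^^ t1) (start_config M1 u)) = halt M1"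
    using c1 unfolding computes_def Let_def by blast
  obtain s1 where s1: "s1 \<le> t1" "(step M1 ^^ s1) (start_config M1 u) = (step M1 ^^ t1) (start_config M1 u)"
    "\<forall>r<s1. fst ((step M1 ^^ r) (start_config M1 u)) \<noteq> halt M1"
    using first_halting_time [OF h1] by blast
  have st1: "fst (start_config M1 u) \<in> states M1" "length (snd (start_config M1 u)) = tapes M1"
    using g1 K by (auto simp: start_config_def good_tm_def)
  have "start_config ?M u = (2 * start M1, (tape_of u, 0) # ?e # ?e # replicate (tapes M1 - 2) ?e @ ws0)"
  proof -
    have "tapes ?M - 1 = Suc (Suc (tapes M1 - 2 + (tapes M2 - 2)))"
      using K by (simp add: compose_tm_def)
    then have "replicate (tapes ?M - 1) ?e = ?e # ?e # replicate (tapes M1 - 2) ?e @ ws0"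
      by (simp only: replicate_Suc replicate_add ws0_def)
    then show ?thesis
      unfolding start_config_def by (simp only:) (simp add: compose_tm_def)
  qed
  then have run1: "\<exists>q a c us. (step M1 ^^ r) (start_config M1 u) = (q, a # c # us) \<and> length us + 2 = tapes M1 \<and>
     (step ?M ^^ r) (start_config ?M u) = (2 * q, a # ?e # c # us @ ws0)" if "r \<le> s1" for r
    using that
  proof (induction r)
    case 0
    then show ?case using K rep by (auto simp: start_config_def)
  next
    case (Suc r)
    then obtain q a c us where IH: "(step M1 ^^ r) (start_config M1 u) = (q, a # c # us)"
      "length us + 2 = tapes M1" "(step ?M ^^ r) (start_config ?M u) = (2 * q, a # ?e # c # us @ ws0)"
      by auto
    have q: "q \<in> states M1" "q \<noteq> halt M1"
      using IH(1) length_tapes_steps [OF g1 st1, of r] s1(3) [rule_format, of r] Suc.prems by auto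
    obtain q' ts where "step M1 (q, a # c # us) = (q', ts)" by fastforce
    moreover have "length ts = tapes M1"
      using length_tapes_steps [OF g1 st1, of "Suc r"] IH(1) calculation by simp
    ultimately obtain a' c' us' where st: "step M1 (q, a # c # us) = (q', a' # c' # us')"
      using list_ge2 [OF _ K(1)] by metis
    show ?case
      using compose_step1 [OF g1 q IH(2) st] IH st by auto
  qed
  then obtain q a c us where e1: "(step M1 ^^ s1) (start_config M1 u) = (q, a # c # us)" "length us + 2 = tapes M1"
    "(step ?M ^^ s1) (start_config ?M u) = (2 * q, a # ?e # c # us @ ws0)" by blast
  have q: "q = halt M1" "fst c = tape_of v"
    using c1 e1 s1(2) unfolding computes_def Let_def by auto
  define h where "h = snd c"
  have hs: "h \<le> s1"
    using head_steps_le [of "start_config M1 u" s1 M1] e1(1) by (auto simp: h_def start_config_def)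
  have c: "c = (tape_of v, h)" using q by (simp add: h_def prod_eq_iff)
  have e2: "(step ?M ^^ (s1 + Suc h)) (start_config ?M u) =
      (2 * start M2 + 1, a # ?e # (tape_of v, 0) # us @ ws0)"
    unfolding step_pow_add e1(3) q(1) c using compose_rewind [OF K(1) v] by blast
  have h2: "fst ((step M2 ^^ t2) (start_config M2 v)) = halt M2"
    using c2 unfolding computes_def Let_def by blast
  obtain s2 where s2: "s2 \<le> t2" "(step M2 ^^ s2) (start_config M2 v) = (step M2 ^^ t2) (start_config M2 v)"
    "\<forall>r<s2. fst ((step M2 ^^ r) (start_config M2 v)) \<noteq> halt M2"
    using first_halting_time [OF h2] by blast
  have st2: "fst (start_config M2 v) \<in> states M2" "length (snd (start_config M2 v)) = tapes M2"
    using g2 K by (auto simp: start_config_def good_tm_def)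
  have run2: "\<exists>q b c ws. (step M2 ^^ r) (start_config M2 v) = (q, c # b # ws) \<and> length ws + 2 = tapes M2 \<and>
     (step ?M ^^ r) (2 * start M2 + 1, a # ?e # (tape_of v, 0) # us @ ws0) =
       (2 * q + 1, a # b # c # us @ ws)" if "r \<le> s2" for r
    using that
  proof (induction r)
    case 0
    then show ?case using K rep by (auto simp: start_config_def ws0_def)
  next
    case (Suc r)
    then obtain q b c ws where IH: "(step M2 ^^ r) (start_config M2 v) = (q, c # b # ws)"
      "length ws + 2 = tapes M2"
      "(step ?M ^^ r) (2 * start M2 + 1, a # ?e # (tape_of v, 0) # us @ ws0) =
       (2 * q + 1, a # b # c # us @ ws)"
      by auto
    have q: "q \<in> states M2" "q \<noteq> halt M2"
      using IH(1) length_tapes_steps [OF g2 st2, of r] s2(3) [rule_format, of r] Suc.prems by auto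
    obtain q' ts where "step M2 (q, c # b # ws) = (q', ts)" by fastforce
    moreover have "length ts = tapes M2"
      using length_tapes_steps [OF g2 st2, of "Suc r"] IH(1) calculation by simp
    ultimately obtain c' b' ws' where st: "step M2 (q, c # b # ws) = (q', c' # b' # ws')"
      using list_ge2 [OF _ K(2)] by metis
    show ?case
      using compose_step2 [OF g2 q e1(2) IH(2) st] IH st by auto
  qed
  then obtain q2 b c2' ws where e3: "(step M2 ^^ s2) (start_config M2 v) = (q2, c2' # b # ws)"
    "(step ?M ^^ s2) (2 * start M2 + 1, a # ?e # (tape_of v, 0) # us @ ws0) = (2 * q2 + 1, a # b # c2' # us @ ws)"
    by blast
  have "q2 = halt M2" "fst b = tape_of w"
    using c2 e3 s2(2) unfolding computes_def Let_def by auto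
  then have "computes ?M u w ((s1 + Suc h) + s2)"
    unfolding computes_def Let_def step_pow_add [of "s1 + Suc h" _ ?M] e2 e3(2)
    by (simp add: compose_tm_def)
  moreover have "(s1 + Suc h) + s2 \<le> 2 * t1 + t2 + 1" using s1 s2 hs by simp
  ultimately show ?thesis by blast
qed

text \<open>\<open>p1\<close> also bounds the length of the intermediate word, so by monotonicity
  \<open>pcompose p2 p1\<close> bounds the second run.\<close>

lemma ptime_compose:
  assumes F: "ptime D eI eM F" and G: "ptime E eM eO G"
    and FD: "F ` D \<subseteq> E" and eM: "\<And>y. y \<in> E \<Longrightarrow> set (eM y) \<subseteq> {2..}"
  shows "ptime D eI eO (\<lambda>x. G (F x))"
proof -
  obtain M1 p1 where 1: "good_tm M1" "\<forall>x\<in>D. length (eM (F x)) \<le> poly p1 (length (eI x)) \<and>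
      (\<exists>t \<le> poly p1 (length (eI x)). computes M1 (eI x) (eM (F x)) t)"
    using F unfolding ptime_def by blast
  obtain M2 p2 where 2: "good_tm M2" "\<forall>x\<in>E. length (eO (G x)) \<le> poly p2 (length (eM x)) \<and>
      (\<exists>t \<le> poly p2 (length (eM x)). computes M2 (eM x) (eO (G x)) t)"
    using G unfolding ptime_def by blast
  define p where "p = smult 2 p1 + pcompose p2 p1 + 1"
  have "length (eO (G (F x))) \<le> poly p (length (eI x)) \<and>
      (\<exists>t \<le> poly p (length (eI x)). computes (compose_tm M1 M2) (eI x) (eO (G (F x))) t)"
    if x: "x \<in> D" for x
  proof -
    obtain t1 where t1: "t1 \<le> poly p1 (length (eI x))" "computes M1 (eI x) (eM (F x)) t1"
      "length (eM (F x)) \<le> poly p1 (length (eI x))"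
      using 1 x by blast
    have FE: "F x \<in> E" using FD x by blast
    then obtain t2 where t2: "t2 \<le> poly p2 (length (eM (F x)))" "computes M2 (eM (F x)) (eO (G (F x))) t2"
      "length (eO (G (F x))) \<le> poly p2 (length (eM (F x)))"
      using 2 by blast
    have m: "poly p2 (length (eM (F x))) \<le> poly p2 (poly p1 (length (eI x)))"
      by (rule poly_nat_mono) (rule t1)
    obtain t where t: "t \<le> 2 * t1 + t2 + 1" "computes (compose_tm M1 M2) (eI x) (eO (G (F x))) t"
      using computes_compose [OF 1(1) 2(1) t1(2) t2(2) eM [OF FE]] by blast
    show ?thesis using t t1 t2 m
      by (intro conjI exI [of _ t]) (auto simp: p_def poly_pcompose)
  qed
  then show ?thesis unfolding ptime_def using good_compose_tm [OF 1(1) 2(1)] by blast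
qed

section \<open>One-tape machines with an append-only output\<close>

text \<open>
  A configuration consists of the state, the tape to the left of the head (reversed), the tape from
  the head on (up to the first blank), and the output. On a blank the machine moves to the left.
\<close>

type_synonym 's lconfig = "'s \<times> nat list \<times> nat list \<times> nat list"
type_synonym 's ltrans = "'s \<Rightarrow> nat \<Rightarrow> 's \<times> nat \<times> bool \<times> nat list"

fun lstep :: "'s ltrans \<Rightarrow> 's lconfig \<Rightarrow> 's lconfig" where
  "lstep \<tau> (s, L, [], out) =
     (case \<tau> s 0 of (s', c, right, w) \<Rightarrow> (s', tl L, take 1 L, out @ w))"
| "lstep \<tau> (s, L, a # R, out) =
     (case \<tau> s a of (s', c, right, w) \<Rightarrow>
        if right then (s', c # L, R, out @ w)
        else (s', tl L, take 1 L @ c # R, out @ w))"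

inductive lreach :: "'s ltrans \<Rightarrow> 's \<Rightarrow> nat \<Rightarrow> 's lconfig \<Rightarrow> 's lconfig \<Rightarrow> bool" for \<tau> sf where
  lreach_refl: "lreach \<tau> sf 0 c c"
| lreach_step: "fst c \<noteq> sf \<Longrightarrow> lreach \<tau> sf n (lstep \<tau> c) c' \<Longrightarrow> lreach \<tau> sf (Suc n) c c'"

lemma lreach_trans:
  "lreach \<tau> sf m c c' \<Longrightarrow> lreach \<tau> sf n c' c'' \<Longrightarrow> lreach \<tau> sf (m + n) c c''"
proof (induction rule: lreach.induct)
  case (lreach_step c n c')
  then show ?case by (metis add_Suc lreach.lreach_step)
qed simp

text \<open>A nonblank symbol is never replaced by a blank, so the nonblank part of the tape stays
  contiguous and the two lists of a configuration describe the tape completely. In particular a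
  blank is scanned iff the right list is empty.\<close>

definition ltrans_ok :: "'s set \<Rightarrow> 's \<Rightarrow> nat \<Rightarrow> nat \<Rightarrow> 's ltrans \<Rightarrow> bool" where
  "ltrans_ok Q sf G B \<tau> \<longleftrightarrow>
     (\<forall>s\<in>Q - {sf}. \<forall>a<G. case \<tau> s a of (s', c, right, w) \<Rightarrow>
        s' \<in> Q \<and> (a \<noteq> 0 \<longrightarrow> 0 < c \<and> c < G) \<and> set w \<subseteq> {..<G} \<and> length w \<le> B)"

lemma ltrans_okD:
  assumes "ltrans_ok Q sf G B \<tau>" "s \<in> Q" "s \<noteq> sf" "a < G" "\<tau> s a = (s', c, right, w)"
  shows "s' \<in> Q" "a \<noteq> 0 \<Longrightarrow> 0 < c \<and> c < G" "set w \<subseteq> {..<G}" "length w \<le> B"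
proof -
  have "case \<tau> s a of (s', c, right, w) \<Rightarrow>
        s' \<in> Q \<and> (a \<noteq> 0 \<longrightarrow> 0 < c \<and> c < G) \<and> set w \<subseteq> {..<G} \<and> length w \<le> B"
    using assms(1) [unfolded ltrans_ok_def, rule_format, of s a] assms(2-4) by simp
  then show "s' \<in> Q" "a \<noteq> 0 \<Longrightarrow> 0 < c \<and> c < G" "set w \<subseteq> {..<G}" "length w \<le> B"
    using assms(5) by simp_all
qed

definition ltm_states :: "'s set \<Rightarrow> nat \<Rightarrow> nat \<Rightarrow> ('s \<times> nat list) option set" where
  "ltm_states Q G B = insert None (Some ` (Q \<times> {w. set w \<subseteq> {..<G} \<and> length w \<le> B}))"

lemma finite_ltm_states: "finite Q \<Longrightarrow> finite (ltm_states Q G B)"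
  unfolding ltm_states_def by (intro finite.insertI finite_imageI finite_cartesian_product
    finite_lists_length_le) auto

text \<open>
  The simulating Turing machine stores the part of the output word that still has to be written in
  its state; \<open>None\<close> stands for the initial state, which moves the output head to cell 1.
\<close>

definition ltm :: "(('s \<times> nat list) option \<Rightarrow> nat) \<Rightarrow> 's set \<Rightarrow> 's \<Rightarrow> 's \<Rightarrow> nat \<Rightarrow> nat \<Rightarrow> 's ltrans
    \<Rightarrow> turing_machine" where
  "ltm e Q s0 sf G B \<tau> =
     \<lparr>tapes = 2, symbols = max G 4, states = e ` ltm_states Q G B,
      start = e None, halt = e (Some (sf, [])),
      delta = (\<lambda>q ss.
        case inv_into (ltm_states Q G B) e q of
          None \<Rightarrow> (e (Some (s0, [])), [(ss ! 0, Stay), (ss ! 1, MoveRight)])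
        | Some (s, b # w) \<Rightarrow> (e (Some (s, w)), [(ss ! 0, Stay), (b, MoveRight)])
        | Some (s, []) \<Rightarrow>
            (if ss ! 0 < G then
               (case \<tau> s (ss ! 0) of (s', c, right, w) \<Rightarrow>
                 (e (Some (s', w)),
                  [if ss ! 0 = 0 then (0, MoveLeft) else (c, if right then MoveRight else MoveLeft),
                   (ss ! 1, Stay)]))
             else (q, [(ss ! 0, Stay), (ss ! 1, Stay)])))\<rparr>"

definition nth_blank :: "nat list \<Rightarrow> nat \<Rightarrow> nat" where
  "nth_blank xs n = (if n < length xs then xs ! n else 0)"

lemma nth_blank_update: "i < length xs \<Longrightarrow> (nth_blank xs)(i := a) = nth_blank (xs[i := a])"
  by (auto simp: nth_blank_def fun_eq_iff)

lemma nth_blank_update_blank: "(nth_blank xs)(length xs := 0) = nth_blank xs"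
  by (auto simp: nth_blank_def fun_eq_iff)

definition ltape :: "nat list \<Rightarrow> nat list \<Rightarrow> tape" where
  "ltape L R = (nth_blank (rev L @ R), length L)"

definition otape :: "nat list \<Rightarrow> tape" where
  "otape w = (tape_of w, Suc (length w))"

definition lconf_ok :: "nat \<Rightarrow> 's lconfig \<Rightarrow> bool" where
  "lconf_ok G c = (case c of (s, L, R, out) \<Rightarrow> \<forall>a\<in>set L \<union> set R. 0 < a \<and> a < G)"

context
  fixes e :: "('s \<times> nat list) option \<Rightarrow> nat" and Q :: "'s set" and s0 sf :: 's
    and G B :: nat and \<tau> :: "'s ltrans"
  assumes e: "inj_on e (ltm_states Q G B)" and Q: "finite Q" "s0 \<in> Q" "sf \<in> Q"
    and \<tau>: "ltrans_ok Q sf G B \<tau>"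
begin

lemma ltm_states_mem:
  "None \<in> ltm_states Q G B"
  "Some (s, w) \<in> ltm_states Q G B \<longleftrightarrow> s \<in> Q \<and> set w \<subseteq> {..<G} \<and> length w \<le> B"
  by (auto simp: ltm_states_def)

lemma decode [simp]: "x \<in> ltm_states Q G B \<Longrightarrow> inv_into (ltm_states Q G B) e (e x) = x"
  using e by simp

lemma good_ltm: "good_tm (ltm e Q s0 sf G B \<tau>)"
proof -
  let ?M = "ltm e Q s0 sf G B \<tau>"
  have "fst (delta ?M q ss) \<in> states ?M \<and> length (snd (delta ?M q ss)) = tapes ?M \<and>
        (\<forall>i<tapes ?M. fst (snd (delta ?M q ss) ! i) < symbols ?M \<or>
                      fst (snd (delta ?M q ss) ! i) = ss ! i)"
    if q: "q \<in> states ?M - {halt ?M}" and ss: "length ss = tapes ?M" for q ss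
  proof -
    obtain x where x: "x \<in> ltm_states Q G B" "q = e x" using q by (auto simp: ltm_def)
    have i2: "\<forall>i<tapes ?M. P i" if "P 0" "P 1" for P
      using that by (auto simp: ltm_def less_2_cases_iff)
    show ?thesis
    proof (cases x)
      case None
      then show ?thesis using x Q
        by (intro conjI i2) (auto simp: ltm_def ltm_states_mem)
    next
      case (Some p)
      obtain s w where p: "p = (s, w)" by fastforce
      have s: "s \<in> Q" "set w \<subseteq> {..<G}" "length w \<le> B" using x by (simp_all add: Some p ltm_states_mem)
      show ?thesis
      proof (cases w)
        case (Cons b w')
        have dx: "inv_into (ltm_states Q G B) e q = Some (s, b # w')" using x Some p Cons by simp
        have "Some (s, w') \<in> ltm_states Q G B" using s Cons by (simp add: ltm_states_mem)
        then show ?thesis using s Cons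
          by (intro conjI i2) (auto simp: ltm_def dx)
      next
        case Nil
        have dx: "inv_into (ltm_states Q G B) e q = Some (s, [])" using x Some p Nil by simp
        have sf: "s \<noteq> sf" using q x Some p Nil by (auto simp: ltm_def)
        show ?thesis
        proof (cases "ss ! 0 < G")
          case True
          obtain s' c d w' where t: "\<tau> s (ss ! 0) = (s', c, d, w')" by (metis prod_cases4)
          have o: "s' \<in> Q" "ss ! 0 \<noteq> 0 \<longrightarrow> c < G" "set w' \<subseteq> {..<G}" "length w' \<le> B"
            using ltrans_okD [OF \<tau> s(1) sf True t] by blast+
          then have "Some (s', w') \<in> ltm_states Q G B" by (simp add: ltm_states_mem)
          then show ?thesis using True t o
            by (intro conjI i2) (auto simp: ltm_def dx)
        next
          case False
          then show ?thesis using q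
            by (intro conjI i2) (auto simp: ltm_def dx)
        qed
      qed
    qed
  qed
  moreover have "tapes ?M \<ge> 2" "symbols ?M \<ge> 4" "finite (states ?M)" "start ?M \<in> states ?M"
    "halt ?M \<in> states ?M"
    using Q finite_ltm_states by (auto simp: ltm_def ltm_states_mem)
  ultimately show ?thesis unfolding good_tm_def by blast
qed

lemma e_eq: "x \<in> ltm_states Q G B \<Longrightarrow> y \<in> ltm_states Q G B \<Longrightarrow> e x = e y \<longleftrightarrow> x = y"
  using e by (auto simp: inj_on_eq_iff)

lemma ltm_flush:
  assumes "s \<in> Q" "set w \<subseteq> {..<G}" "length w \<le> B"
  shows "(step (ltm e Q s0 sf G B \<tau>) ^^ length w) (e (Some (s, w)), [T, otape out]) =
         (e (Some (s, [])), [T, otape (out @ w)])"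
  using assms
proof (induction w arbitrary: out)
  case (Cons b w)
  let ?M = "ltm e Q s0 sf G B \<tau>"
  have m: "Some (s, b # w) \<in> ltm_states Q G B" "Some (sf, []) \<in> ltm_states Q G B"
    using Cons Q by (auto simp: ltm_states_mem)
  have "e (Some (s, b # w)) \<noteq> e (Some (sf, []))" using e_eq [OF m] by simp
  then have "step ?M (e (Some (s, b # w)), [T, otape out]) =
      (e (Some (s, w)), [T, act (b, MoveRight) (otape out)])"
    using m by (simp add: step_def ltm_def del: One_nat_def)
  moreover have "act (b, MoveRight) (otape out) = otape (out @ [b])"
    by (simp add: act_def otape_def tape_of_snoc)
  ultimately show ?case using Cons.IH [of "out @ [b]"] Cons.prems by (simp add: funpow_swap1)
qed simp

lemma ltape_scan: "fst (ltape L R) (snd (ltape L R)) = (case R of [] \<Rightarrow> 0 | a # _ \<Rightarrow> a)"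
  by (auto simp: ltape_def nth_blank_def nth_append split: list.splits)

text \<open>\<open>tl L\<close> and \<open>take 1 L\<close> describe a left move uniformly: for
  empty \<open>L\<close> the head is in cell 0 and stays there.\<close>

lemma ltape_act:
  "act (c, MoveRight) (ltape L (a # R)) = ltape (c # L) R"
  "act (c, MoveLeft) (ltape L (a # R)) = ltape (tl L) (take 1 L @ c # R)"
  "act (0, MoveLeft) (ltape L []) = ltape (tl L) (take 1 L)"
proof -
  have *: "(nth_blank (rev L @ a # R))(length L := c) = nth_blank (rev L @ c # R)"
    using list_update_length [of "rev L" a R c] by (simp add: nth_blank_update)
  show "act (c, MoveRight) (ltape L (a # R)) = ltape (c # L) R"
    "act (c, MoveLeft) (ltape L (a # R)) = ltape (tl L) (take 1 L @ c # R)"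
    using * by (cases L; simp add: ltape_def act_def)+
  show "act (0, MoveLeft) (ltape L []) = ltape (tl L) (take 1 L)"
    using nth_blank_update_blank [of "rev L"] by (cases L) (simp_all add: ltape_def act_def)
qed

text \<open>One step costs one transition plus one for each symbol of the printed word, which is why
  \<open>B + 1\<close> bounds it.\<close>

lemma ltm_step:
  assumes "s \<in> Q" "s \<noteq> sf" "lconf_ok G (s, L, R, out)" "0 < G"
    and st: "lstep \<tau> (s, L, R, out) = (s', L', R', out')"
  shows "lconf_ok G (s', L', R', out')" "s' \<in> Q" "length out' \<le> length out + B"
    "\<exists>t\<le>B + 1. (step (ltm e Q s0 sf G B \<tau>) ^^ t) (e (Some (s, [])), [ltape L R, otape out]) =
         (e (Some (s', [])), [ltape L' R', otape out'])"
proof -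
  let ?M = "ltm e Q s0 sf G B \<tau>"
  define a where "a = (case R of [] \<Rightarrow> 0 | a # _ \<Rightarrow> a)"
  have aG: "a < G" using assms by (auto simp: a_def lconf_ok_def split: list.splits)
  obtain s1 c d w where t: "\<tau> s a = (s1, c, d, w)" by (metis prod_cases4)
  have o: "s1 \<in> Q" "a \<noteq> 0 \<longrightarrow> 0 < c \<and> c < G" "set w \<subseteq> {..<G}" "length w \<le> B"
    using ltrans_okD [OF \<tau> assms(1,2) aG t] by blast+
  have m: "Some (s, []) \<in> ltm_states Q G B" "Some (sf, []) \<in> ltm_states Q G B"
    using assms Q by (auto simp: ltm_states_mem)
  have ne: "e (Some (s, [])) \<noteq> e (Some (sf, []))" using e_eq [OF m] assms by simp
  have a0: "a = 0 \<longleftrightarrow> R = []" using assms(3) by (auto simp: a_def lconf_ok_def split: list.splits)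
  have st1: "step ?M (e (Some (s, [])), [ltape L R, otape out]) =
      (e (Some (s1, w)), [act (if a = 0 then (0, MoveLeft) else (c, if d then MoveRight else MoveLeft)) (ltape L R),
        otape out])"
    using ne m aG t by (simp add: step_def ltm_def ltape_scan a_def [symmetric] del: One_nat_def)
  have e1: "s' = s1" "out' = out @ w"
    using st t by (cases R; auto simp: a_def split: if_splits)+
  have e2: "act (if a = 0 then (0, MoveLeft) else (c, if d then MoveRight else MoveLeft)) (ltape L R) = ltape L' R'"
    using st t a0 by (cases R; cases d) (auto simp: a_def ltape_act)
  have "(step ?M ^^ (Suc (length w))) (e (Some (s, [])), [ltape L R, otape out]) =
         (e (Some (s', [])), [ltape L' R', otape out'])"
    using st1 e2 ltm_flush [OF o(1,3,4)] by (simp add: funpow_swap1 e1)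
  then show "\<exists>t\<le>B + 1. (step ?M ^^ t) (e (Some (s, [])), [ltape L R, otape out]) =
         (e (Some (s', [])), [ltape L' R', otape out'])"
    using o(4) by (intro exI [of _ "Suc (length w)"]) simp
  show "s' \<in> Q" "length out' \<le> length out + B" using e1 o by simp_all
  have L: "x \<in> set (tl L) \<Longrightarrow> x \<in> set L" "x \<in> set (take (Suc 0) L) \<Longrightarrow> x \<in> set L" for x
    by (cases L; auto)+
  show "lconf_ok G (s', L', R', out')"
    using st t o(2) a0 assms(3) L
    by (cases R; cases d) (auto simp: a_def lconf_ok_def dest: L)
qed

lemma ltm_run:
  assumes "lreach \<tau> sf n c c'" "c = (s, L, R, out)" "c' = (s', L', R', out')"
    and "s \<in> Q" "lconf_ok G c" "0 < G"
  shows "length out' \<le> length out + n * B \<and>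
    (\<exists>t\<le>n * (B + 1). (step (ltm e Q s0 sf G B \<tau>) ^^ t) (e (Some (s, [])), [ltape L R, otape out]) =
         (e (Some (s', [])), [ltape L' R', otape out']))"
  using assms
proof (induction arbitrary: s L R out rule: lreach.induct)
  case (lreach_refl c)
  then show ?case by auto
next
  case (lreach_step c n c')
  obtain s1 L1 R1 out1 where st: "lstep \<tau> (s, L, R, out) = (s1, L1, R1, out1)" by (metis prod_cases4)
  note * = ltm_step [OF _ _ _ _ st]
  have s: "s \<in> Q" "s \<noteq> sf" "lconf_ok G (s, L, R, out)" using lreach_step by auto
  obtain t1 where t1: "t1 \<le> B + 1"
    "(step (ltm e Q s0 sf G B \<tau>) ^^ t1) (e (Some (s, [])), [ltape L R, otape out]) =
         (e (Some (s1, [])), [ltape L1 R1, otape out1])"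
    using *(4) s \<open>0 < G\<close> by blast
  obtain t2 where t2: "t2 \<le> n * (B + 1)"
    "(step (ltm e Q s0 sf G B \<tau>) ^^ t2) (e (Some (s1, [])), [ltape L1 R1, otape out1]) =
         (e (Some (s', [])), [ltape L' R', otape out'])"
    and l2: "length out' \<le> length out1 + n * B"
    using lreach_step.IH [of s1 L1 R1 out1] *(1,2) s \<open>0 < G\<close> lreach_step.prems st by auto
  have "(step (ltm e Q s0 sf G B \<tau>) ^^ (t1 + t2)) (e (Some (s, [])), [ltape L R, otape out]) =
         (e (Some (s', [])), [ltape L' R', otape out'])"
    unfolding step_pow_add t1 t2 by simp
  moreover have "t1 + t2 \<le> Suc n * (B + 1)" using t1 t2 by simp
  moreover have "length out' \<le> length out + Suc n * B" using l2 *(3) s \<open>0 < G\<close> by auto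
  ultimately show ?case by blast
qed

end

text \<open>The additional step in the time bound is the initial one, which puts the output head on
  cell 1.\<close>

lemma lreach_ptime:
  assumes Q: "finite Q" "s0 \<in> Q" "sf \<in> Q" and \<tau>: "ltrans_ok Q sf G B \<tau>" and G: "2 \<le> G"
    and D: "\<And>x. x \<in> D \<Longrightarrow> set (eI x) \<subseteq> {0<..<G}"
    and run: "\<And>x. x \<in> D \<Longrightarrow>
      \<exists>n\<le>poly p (length (eI x)). \<exists>L R. lreach \<tau> sf n (s0, [], 1 # eI x, []) (sf, L, R, eO (F x))"
  shows "ptime D eI eO F"
proof -
  \<comment> \<open>Turing machine states are natural numbers; any injection of the finite set of
    structured states will do.\<close>
  obtain e :: "_ \<Rightarrow> nat" where e: "inj_on e (ltm_states Q G B)"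
    using finite_imp_inj_to_nat_seg [OF finite_ltm_states [OF Q(1)]] by metis
  let ?M = "ltm e Q s0 sf G B \<tau>"
  note ltm_run = ltm_run [OF e Q \<tau>]
  have None: "None \<in> ltm_states Q G B" by (simp add: ltm_states_def)
  have "length (eO (F x)) \<le> poly (smult (B + 1) p + 1) (length (eI x)) \<and>
        (\<exists>t\<le>poly (smult (B + 1) p + 1) (length (eI x)). computes ?M (eI x) (eO (F x)) t)"
    if x: "x \<in> D" for x
  proof -
    obtain n L R where n: "n \<le> poly p (length (eI x))"
      "lreach \<tau> sf n (s0, [], 1 # eI x, []) (sf, L, R, eO (F x))"
      using run [OF x] by blast
    have ok: "lconf_ok G (s0, [], 1 # eI x, [])" using D [OF x] G by (auto simp: lconf_ok_def)
    obtain t where t: "t \<le> n * (B + 1)" "(step ?M ^^ t) (e (Some (s0, [])), [ltape [] (1 # eI x), otape []]) =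
         (e (Some (sf, [])), [ltape L R, otape (eO (F x))])"
      and len: "length (eO (F x)) \<le> n * B"
      using ltm_run [OF n(2) refl refl Q(2) ok] G by auto
    have ne: "e None \<noteq> e (Some (sf, []))" 
      using e_eq [OF e Q \<tau> None, of "Some (sf, [])"] Q by (simp add: ltm_states_def)
    have "ltape [] (1 # eI x) = (tape_of (eI x), 0)"
      by (auto simp: ltape_def nth_blank_def tape_of_def fun_eq_iff nth_Cons')
    moreover have "(tape_of [])(0 := 1) = tape_of []" "tape_of [] 0 = 1" by (auto simp: tape_of_def)
    ultimately have "step ?M (start_config ?M (eI x)) = (e (Some (s0, [])), [ltape [] (1 # eI x), otape []])"
      using ne by (simp add: start_config_def step_def ltm_def decode [OF e Q \<tau> None] otape_def act_def
          fun_upd_idem)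
    then have "(step ?M ^^ Suc t) (start_config ?M (eI x)) = (e (Some (sf, [])), [ltape L R, otape (eO (F x))])"
      using t(2) by (simp add: funpow_swap1)
    then have "computes ?M (eI x) (eO (F x)) (Suc t)"
      unfolding computes_def by (simp add: ltm_def otape_def)
    moreover have "Suc t \<le> poly (smult (B + 1) p + 1) (length (eI x))"
      using order.trans [OF t(1) mult_le_mono1 [OF n(1), of "B + 1"]] by (simp add: mult.commute)
    moreover have "length (eO (F x)) \<le> poly (smult (B + 1) p + 1) (length (eI x))"
      using order.trans [OF len mult_le_mono [OF n(1), of B "B + 1"]] by (simp add: mult.commute)
    ultimately show ?thesis by blast
  qed
  then show ?thesis unfolding ptime_def using good_ltm [OF e Q \<tau>] by blast
qed

text \<open>A machine sees encoded words only, so the objects behind them can be exchanged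
  freely.\<close>

lemma ptime_precompose:
  assumes "ptime (g ` D) eI eO F" "\<And>x. x \<in> D \<Longrightarrow> eI' x = eI (g x)" "\<And>x. x \<in> D \<Longrightarrow> eO' (F' x) = eO (F (g x))"
  shows "ptime D eI' eO' F'"
  using assms unfolding ptime_def by (metis (mono_tags, lifting) image_eqI)

lemma ptime_mono: "ptime E eI eO F \<Longrightarrow> D \<subseteq> E \<Longrightarrow> ptime D eI eO F"
  unfolding ptime_def by (meson subsetD)

lemma finite_words_bound:
  fixes S :: "nat list set"
  assumes "finite S"
  obtains G B where "\<And>w. w \<in> S \<Longrightarrow> set w \<subseteq> {..<G} \<and> length w \<le> B"
proof -
  have "finite (\<Union> (set ` S))" "finite (length ` S)" using assms by auto
  then obtain G B where "\<forall>a\<in>\<Union> (set ` S). a < G" "\<forall>l\<in>length ` S. l \<le> B"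
    by (metis finite_nat_set_iff_bounded finite_nat_set_iff_bounded_le)
  then show ?thesis by (intro that [of G B]) auto
qed

lemma lreach_step':
  assumes "s \<noteq> sf" "lstep \<tau> (s, L, R, out) = c'" "lreach \<tau> sf n c' c''"
  shows "lreach \<tau> sf (Suc n) (s, L, R, out) c''"
  using assms by (intro lreach_step) auto

lemma lreach_one:
  assumes "s \<noteq> sf" "lstep \<tau> (s, L, R, out) = c'"
  shows "lreach \<tau> sf 1 (s, L, R, out) c'"
  using lreach_step' [OF assms lreach_refl] by simp

section \<open>Letter-to-word substitution\<close>

text \<open>A single sweep to the right. The end marker 1 and the blank after the input are
  substituted as well, which yields a prefix and a suffix of the output.\<close>

lemma subst_ptime:
  assumes D: "\<And>x. x \<in> D \<Longrightarrow> set (eI x) \<subseteq> {0<..<G}"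
    and out: "\<And>x. x \<in> D \<Longrightarrow> eO (F x) = concat (map h (1 # eI x)) @ h 0"
  shows "ptime D eI eO F"
proof -
  define G1 where "G1 = max G 2"
  obtain G2 B where G2: "\<And>w. w \<in> h ` {..<G1} \<Longrightarrow> set w \<subseteq> {..<G2} \<and> length w \<le> B"
    by (rule finite_words_bound [of "h ` {..<G1}"]) auto
  define G3 where "G3 = max G1 G2"
  \<comment> \<open>State \<open>True\<close> means finished. The guard \<open>a < G1\<close>
    restricts the output words to those bounded by \<open>G2\<close> and \<open>B\<close>.\<close>
  define \<tau> :: "bool ltrans" where "\<tau> = (\<lambda>s a. (a = 0, a, True, if a < G1 then h a else []))"
  have "ltrans_ok UNIV True G3 B \<tau>"
    unfolding ltrans_ok_def \<tau>_def using G2 by (auto simp: G3_def less_max_iff_disj) fastforce+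
  moreover have "\<exists>n\<le>poly [:2, 1:] (length (eI x)). \<exists>L R. lreach \<tau> True n (False, [], 1 # eI x, []) (True, L, R, eO (F x))"
    if x: "x \<in> D" for x
  proof -
    have *: "\<exists>L. lreach \<tau> True (length R) (False, L', R, out) (False, L, [], out @ concat (map h R))"
      if "set R \<subseteq> {0<..<G1}" for R L' out
      using that
    proof (induction R arbitrary: L' out)
      case Nil
      then show ?case by (auto intro: lreach_refl)
    next
      case (Cons a R)
      then show ?case
        using Cons.IH [of "a # L'" "out @ h a"]
        by (auto intro!: lreach_step' simp: \<tau>_def)
    qed
    have "set (1 # eI x) \<subseteq> {0<..<G1}" using D [OF x] by (auto simp: G1_def)
    from * [OF this, of "[]" "[]"] obtain L
      where 1: "lreach \<tau> True (length (1 # eI x)) (False, [], 1 # eI x, []) (False, L, [], concat (map h (1 # eI x)))"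
      by auto
    have "lreach \<tau> True 1 (False, L, [], concat (map h (1 # eI x))) (True, tl L, take 1 L, eO (F x))"
      by (rule lreach_one) (auto simp: \<tau>_def out [OF x] G1_def)
    from lreach_trans [OF 1 this] show ?thesis
      by (intro exI [of _ "length (1 # eI x) + 1"]) auto
  qed
  moreover have "set (eI x) \<subseteq> {0<..<G3}" if "x \<in> D" for x
    using D [OF that] by (auto simp: G3_def G1_def less_max_iff_disj)
  ultimately show ?thesis
    by (intro lreach_ptime [of UNIV False True G3 B \<tau> D eI "[:2, 1:]"]) (simp_all add: G3_def G1_def)
qed

section \<open>Words separated into blocks\<close>

text \<open>0, 1 and 2 stay reserved for the blank, the end marker and the block separator.\<close>

definition code :: "'a::countable \<Rightarrow> nat" where
  "code a = to_nat a + 3"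

definition decode :: "nat \<Rightarrow> 'a::countable" where
  "decode n = from_nat (n - 3)"

lemma decode_code [simp]: "decode (code a) = a"
  by (simp add: code_def decode_def)

lemma code_ge: "3 \<le> code a" by (simp add: code_def)

definition encB :: "'a::countable list list \<Rightarrow> nat list" where
  "encB Bs = concat (map (\<lambda>B. map code B @ [2]) Bs)"

definition blocks_over :: "'a set \<Rightarrow> 'a list list set" where
  "blocks_over A = {Bs. \<forall>B\<in>set Bs. set B \<subseteq> A}"

lemma encB_ge2: "set (encB Bs) \<subseteq> {2..}"
  by (auto simp: encB_def code_def)

lemma encB_Cons: "encB (B # Bs) = map code B @ 2 # encB Bs"
  by (simp add: encB_def)

section \<open>Marking every position of every block\<close>

definition mark :: "nat \<Rightarrow> ('a \<times> bool list) list \<Rightarrow> ('a \<times> bool list) list" where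
  "mark i B = map (\<lambda>j. (fst (B ! j), snd (B ! j) @ [j = i])) [0..<length B]"

text \<open>Squares every block: length l becomes l blocks of length l, one for each value of a new
  innermost loop variable.\<close>

definition bsq :: "('a \<times> bool list) list list \<Rightarrow> ('a \<times> bool list) list list" where
  "bsq Bs = concat (map (\<lambda>B. map (\<lambda>i. mark i B) [0..<length B]) Bs)"

definition add_mark :: "bool \<Rightarrow> 'a \<times> bool list \<Rightarrow> 'a \<times> bool list" where
  "add_mark b p = (fst p, snd p @ [b])"

lemma mark_split:
  "mark (length pre) (pre @ c # post) = map (add_mark False) pre @ add_mark True c # map (add_mark False) post"
  by (rule nth_equalityI)
    (auto simp: mark_def add_mark_def nth_append nth_Cons' simp del: upt_Suc)

text \<open>
  State 1 expects the next position to be marked under the head and marks it by adding \<open>G\<close>, state 2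
  moves back to the start of the block, state 3 outputs the block, and state 4 returns to the mark.
\<close>

definition bsq_trans :: "nat \<Rightarrow> (bool \<Rightarrow> nat \<Rightarrow> nat) \<Rightarrow> nat ltrans" where
  "bsq_trans G f = (\<lambda>s a.
     if s = 0 then (1, a, True, [])
     else if s = 1 then
       (if a = 2 then (1, 2, True, [])
        else if 3 \<le> a \<and> a < G then (2, a + G, False, [])
        else (5, a, False, []))
     else if s = 2 then
       (if a = 1 \<or> a = 2 then (3, a, True, []) else (2, a, False, []))
     else if s = 3 then
       (if a = 2 then (4, a, False, [2])
        else if a < G then (3, a, True, [f False a])
        else if a < 2 * G then (3, a, True, [f True (a - G)])
        else (5, a, True, []))
     else if a > G then (1, a - G, True, []) else (4, a, False, []))"

context
  fixes G :: nat and f :: "bool \<Rightarrow> nat \<Rightarrow> nat" and \<tau>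
  assumes \<tau>_def: "\<tau> = bsq_trans G f"
begin

text \<open>The start configuration has the shape in which \<open>lstep\<close> leaves a left move,
  so that no case distinction on empty \<open>xs\<close> is needed when runs are chained.
  \<open>d\<close> is what precedes the block: the end marker or the separator of the previous
  block.\<close>

lemma bsq_rewind:
  assumes "\<forall>x\<in>set xs. 3 \<le> x" "d = 1 \<or> d = 2"
  shows "lreach \<tau> 5 (Suc (length xs)) (2, tl (rev xs @ d # L), take 1 (rev xs @ d # L) @ R, out) (3, d # L, xs @ R, out)"
  using assms
proof (induction xs arbitrary: R rule: rev_induct)
  case Nil
  then show ?case by (auto intro!: lreach_one [simplified] simp: \<tau>_def bsq_trans_def)
next
  case (snoc x xs)
  from snoc.IH [of "x # R"] snoc.prems show ?case
    by (auto intro!: lreach_step' simp: \<tau>_def bsq_trans_def)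
qed

lemma bsq_scan:
  assumes "\<forall>x\<in>set xs. 3 \<le> x \<and> x < 2 * G"
  shows "lreach \<tau> 5 (length xs) (3, L, xs @ R, out)
    (3, rev xs @ L, R, out @ map (\<lambda>x. if x < G then f False x else f True (x - G)) xs)"
  using assms
proof (induction xs arbitrary: L out)
  case Nil
  then show ?case by (auto intro: lreach_refl)
next
  case (Cons x xs)
  from Cons.IH [of "x # L" "out @ [if x < G then f False x else f True (x - G)]"] Cons.prems show ?case
    by (auto intro!: lreach_step' simp: \<tau>_def bsq_trans_def)
qed

lemma bsq_back:
  assumes "\<forall>x\<in>set xs. 3 \<le> x \<and> x < G" "0 < c"
  shows "lreach \<tau> 5 (Suc (length xs)) (4, tl (rev xs @ (c + G) # L), take 1 (rev xs @ (c + G) # L) @ R, out)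
    (1, c # L, xs @ R, out)"
  using assms
proof (induction xs arbitrary: R rule: rev_induct)
  case Nil
  then show ?case by (auto intro!: lreach_one [simplified] simp: \<tau>_def bsq_trans_def)
next
  case (snoc x xs)
  from snoc.IH [of "x # R"] snoc.prems show ?case
    by (auto intro!: lreach_step' simp: \<tau>_def bsq_trans_def)
qed

text \<open>The time is 1 for marking, \<open>length pre + 1\<close> back to the start of the block,
  one pass over the block, 1 for turning at the separator, and \<open>length post + 1\<close> back
  to the mark, which is removed.\<close>

lemma bsq_mark:
  assumes "\<forall>x\<in>set (pre @ c # post). 3 \<le> x \<and> x < G" "d = 1 \<or> d = 2"
  shows "lreach \<tau> 5 (2 * length (pre @ c # post) + 3)
    (1, rev pre @ d # L, c # post @ 2 # R, out)
    (1, rev (pre @ [c]) @ d # L, post @ 2 # R,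
      out @ map (f False) pre @ f True c # map (f False) post @ [2])"
proof -
  let ?xs = "pre @ (c + G) # post"
  let ?out = "out @ map (\<lambda>x. if x < G then f False x else f True (x - G)) ?xs"
  have "lreach \<tau> 5 1 (1, rev pre @ d # L, c # post @ 2 # R, out)
      (2, tl (rev pre @ d # L), take 1 (rev pre @ d # L) @ (c + G) # post @ 2 # R, out)"
    using assms by (intro lreach_one) (auto simp: \<tau>_def bsq_trans_def)
  moreover have "lreach \<tau> 5 (Suc (length pre))
      (2, tl (rev pre @ d # L), take 1 (rev pre @ d # L) @ (c + G) # post @ 2 # R, out)
      (3, d # L, ?xs @ 2 # R, out)"
    using bsq_rewind [of pre d L "(c + G) # post @ 2 # R" out] assms by simp
  moreover have "lreach \<tau> 5 (length ?xs) (3, d # L, ?xs @ 2 # R, out)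
     (3, rev ?xs @ d # L, 2 # R, ?out)"
  proof (rule bsq_scan)
    have "x < G \<Longrightarrow> x < 2 * G" for x by simp
    then show "\<forall>x\<in>set ?xs. 3 \<le> x \<and> x < 2 * G" using assms(1) by (auto simp: ball_Un)
  qed
  moreover have "lreach \<tau> 5 1 (3, rev ?xs @ d # L, 2 # R, ?out)
      (4, tl (rev ?xs @ d # L), take 1 (rev ?xs @ d # L) @ 2 # R, ?out @ [2])"
    by (intro lreach_one) (auto simp: \<tau>_def bsq_trans_def)
  moreover have "lreach \<tau> 5 (Suc (length post))
      (4, tl (rev ?xs @ d # L), take 1 (rev ?xs @ d # L) @ 2 # R, ?out @ [2])
      (1, c # rev pre @ d # L, post @ 2 # R, ?out @ [2])"
    using bsq_back [of post c "rev pre @ d # L" "2 # R" "?out @ [2]"] assms by simp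
  ultimately have "lreach \<tau> 5 (1 + (Suc (length pre) + (length ?xs + (1 + Suc (length post)))))
     (1, rev pre @ d # L, c # post @ 2 # R, out) (1, c # rev pre @ d # L, post @ 2 # R, ?out @ [2])"
    by (blast intro: lreach_trans)
  moreover have "?out @ [2] = out @ map (f False) pre @ f True c # map (f False) post @ [2]"
    using assms(1) by auto
  moreover have "1 + (Suc (length pre) + (length ?xs + (1 + Suc (length post)))) =
      2 * length (pre @ c # post) + 3" by simp
  ultimately show ?thesis by (simp only: rev_append rev.simps append.simps append_assoc)
qed

text \<open>Induction on the letters that have not been marked yet; \<open>pre\<close> consists of
  those already treated.\<close>

lemma bsq_block:
  assumes "\<forall>x\<in>set (pre @ post). 3 \<le> x \<and> x < G" "d = 1 \<or> d = 2"
  shows "lreach \<tau> 5 (length post * (2 * length (pre @ post) + 3) + 1)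
    (1, rev pre @ d # L, post @ 2 # R, out)
    (1, 2 # rev (pre @ post) @ d # L, R,
      out @ concat (map (\<lambda>i. map (f False) (take i (pre @ post)) @ f True ((pre @ post) ! i) #
                             map (f False) (drop (Suc i) (pre @ post)) @ [2])
              [length pre..<length (pre @ post)]))"
  using assms
proof (induction post arbitrary: pre out)
  case Nil
  then show ?case by (auto intro!: lreach_one [simplified] simp: \<tau>_def bsq_trans_def)
next
  case (Cons c post)
  have 1: "lreach \<tau> 5 (2 * length (pre @ c # post) + 3)
    (1, rev pre @ d # L, c # post @ 2 # R, out)
    (1, rev (pre @ [c]) @ d # L, post @ 2 # R,
      out @ map (f False) pre @ f True c # map (f False) post @ [2])"
    by (rule bsq_mark) (use Cons.prems in auto)
  have u: "[length pre..<length (pre @ c # post)] = length pre # [length (pre @ [c])..<length ((pre @ [c]) @ post)]"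
    by (simp add: upt_rec)
  have n: "length (c # post) * (2 * length (pre @ c # post) + 3) + 1 =
     2 * length (pre @ c # post) + 3 + (length post * (2 * length ((pre @ [c]) @ post) + 3) + 1)"
    by simp
  show ?case
    unfolding u n
    using lreach_trans [OF 1 Cons.IH [of "pre @ [c]"]] Cons.prems by (simp add: nth_append)
qed

end

text \<open>\<open>add_mark\<close> on the level of tape symbols. The \<open>itself\<close> argument
  fixes the letter type, which is invisible in the type of the result.\<close>

definition mark_code :: "'a::countable itself \<Rightarrow> bool \<Rightarrow> nat \<Rightarrow> nat" where
  "mark_code _ b a = code (add_mark b (decode a :: 'a \<times> bool list))"

lemma bsq_blocks:
  fixes Bs :: "('a::countable \<times> bool list) list list"
  assumes "\<forall>x\<in>set (encB Bs). x < G" "d = 1 \<or> d = 2"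
  shows "\<exists>n\<le>length (encB Bs) * (2 * length (encB Bs) + 3). \<exists>L'.
    lreach (bsq_trans G (mark_code TYPE('a))) 5 n (1, d # L, encB Bs, out)
      (1, L', [], out @ encB (bsq Bs)) \<and> L' \<noteq> []"
  using assms
proof (induction Bs arbitrary: L out d)
  case Nil
  have "lreach (bsq_trans G (mark_code TYPE('a))) 5 0 (1, d # L, encB [], out)
      (1, d # L, [], out @ encB (bsq ([] :: ('a \<times> bool list) list list)))"
    by (simp add: encB_def bsq_def lreach_refl)
  then show ?case by blast
next
  case (Cons B Bs)
  let ?\<tau> = "bsq_trans G (mark_code TYPE('a))"
  let ?f = "mark_code TYPE('a)"
  let ?o = "concat (map (\<lambda>i. map (?f False) (take i (map code B)) @ ?f True ((map code B) ! i) #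
                             map (?f False) (drop (Suc i) (map code B)) @ [2])
              [0..<length (map code B)])"
  have 1: "lreach ?\<tau> 5 (length (map code B) * (2 * length ([] @ map code B) + 3) + 1)
      (1, d # L, map code B @ 2 # encB Bs, out) (1, 2 # rev (map code B) @ d # L, encB Bs, out @ ?o)"
    using bsq_block [OF refl, of "[]" "map code B" G d ?f L "encB Bs" out] Cons.prems
    by (auto simp: encB_Cons code_ge)
  obtain n L' where 2: "n \<le> length (encB Bs) * (2 * length (encB Bs) + 3)"
    "lreach ?\<tau> 5 n (1, 2 # rev (map code B) @ d # L, encB Bs, out @ ?o) (1, L', [], (out @ ?o) @ encB (bsq Bs))" "L' \<noteq> []"
    using Cons.IH [of 2 "rev (map code B) @ d # L" "out @ ?o"] Cons.prems by (auto simp: encB_Cons)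
  have "?o = encB (map (\<lambda>i. mark i B) [0..<length B])"
    unfolding encB_def map_map
  proof (intro arg_cong [where f = concat], rule map_cong)
    fix i assume "i \<in> set [0..<length B]"
    then have i: "i < length B" by simp
    have "mark i B = map (add_mark False) (take i B) @ add_mark True (B ! i) # map (add_mark False) (drop (Suc i) B)"
      using mark_split [of "take i B" "B ! i" "drop (Suc i) B"] i
      by (simp add: id_take_nth_drop [symmetric])
    then show "map (?f False) (take i (map code B)) @ ?f True ((map code B) ! i) #
                             map (?f False) (drop (Suc i) (map code B)) @ [2] =
        ((\<lambda>B. map code B @ [2]) \<circ> (\<lambda>i. mark i B)) i"
      using i by (simp add: mark_code_def take_map drop_map)
  qed simp
  then have o: "out @ encB (bsq (B # Bs)) = (out @ ?o) @ encB (bsq Bs)"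
    by (simp add: bsq_def encB_def)
  \<comment> \<open>The bound n (2 n + 3) is superadditive, and the separator, which counts in the
    length of the encoding, pays for the extra step.\<close>
  have "length (map code B) * (2 * length ([] @ map code B) + 3) + 1 + n \<le>
     length (encB (B # Bs)) * (2 * length (encB (B # Bs)) + 3)"
  proof -
    define a where "a = length B"
    define b where "b = length (encB Bs)"
    have "a * (2 * a + 3) + 1 + b * (2 * b + 3) \<le> (a + 1 + b) * (2 * (a + 1 + b) + 3)"
      by (simp add: algebra_simps)
    then show ?thesis using 2(1) unfolding a_def b_def encB_Cons by simp
  qed
  then show ?case
    using lreach_trans [OF 1 2(2)] 2(3) unfolding encB_Cons o [unfolded encB_Cons, symmetric] by blast
qed

lemma bsq_ptime:
  fixes A :: "('a::countable \<times> bool list) set"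
  assumes A: "finite A"
  shows "ptime (blocks_over A) encB encB bsq"
proof -
  obtain G1 where G1: "\<forall>a\<in>code ` A. a < G1"
    using A finite_nat_set_iff_bounded by blast
  define G where "G = max G1 3"
  let ?f = "mark_code TYPE('a)"
  have "finite ((\<lambda>(b, a). ?f b a) ` (UNIV \<times> {..<2 * G}))" by simp
  then obtain G2 where G2: "\<forall>x\<in>(\<lambda>(b, a). ?f b a) ` (UNIV \<times> {..<2 * G}). x < G2"
    using finite_nat_set_iff_bounded by blast
  \<comment> \<open>Marked letters on the tape are below \<open>2 * G\<close>; the printed letters
    carry one more mark, and their codes are only known to be below \<open>G2\<close>.\<close>
  define G' where "G' = max (2 * G) G2"
  have f: "?f b a < G'" if "a < 2 * G" for a b
    using G2 that by (fastforce simp: G'_def less_max_iff_disj)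
  have GG: "2 * G \<le> G'" "3 \<le> G" by (auto simp: G'_def G_def)
  have "ltrans_ok {..5} 5 G' 1 (bsq_trans G ?f)"
    unfolding ltrans_ok_def bsq_trans_def using GG by (auto intro!: f)
  then show ?thesis
  proof (rule lreach_ptime [where p = "[:2, 1:] * [:3, 2:]", rotated 3])
    fix Bs assume Bs: "Bs \<in> blocks_over A"
    have "\<forall>B\<in>set Bs. \<forall>x\<in>set B. code x < G1"
      using Bs G1 unfolding blocks_over_def by blast
    then have lt: "\<forall>x\<in>set (encB Bs). x < G"
      by (auto simp: encB_def G_def less_max_iff_disj)
    then show "set (encB Bs) \<subseteq> {0<..<G'}"
      using encB_ge2 [of Bs] GG by fastforce
    let ?\<tau> = "bsq_trans G ?f"
    have 1: "lreach ?\<tau> 5 1 (0, [], 1 # encB Bs, []) (1, [1], encB Bs, [])"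
      by (rule lreach_one) (auto simp: bsq_trans_def)
    obtain n L' where 2: "n \<le> length (encB Bs) * (2 * length (encB Bs) + 3)"
      "lreach ?\<tau> 5 n (1, [1], encB Bs, []) (1, L', [], encB (bsq Bs))"
      using bsq_blocks [OF lt, of 1 "[]" "[]"] by auto
    have 3: "lreach ?\<tau> 5 1 (1, L', [], encB (bsq Bs)) (5, tl L', take 1 L', encB (bsq Bs))"
      by (rule lreach_one) (auto simp: bsq_trans_def)
    have "1 + (n + 1) \<le> poly ([:2, 1:] * [:3, 2:]) (length (encB Bs))"
      using 2(1) by (simp add: algebra_simps)
    then show "\<exists>n\<le>poly ([:2, 1:] * [:3, 2:]) (length (encB Bs)). \<exists>L R.
        lreach ?\<tau> 5 n (0, [], 1 # encB Bs, []) (5, L, R, encB (bsq Bs))"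
      using lreach_trans [OF 1 lreach_trans [OF 2(2) 3]] by blast
  qed (use GG in auto)
qed

section \<open>Local information on blocks\<close>

definition adj :: "'a list \<Rightarrow> ('a \<times> 'a) set" where
  "adj B = set (zip B (tl B))"

lemma adj_snoc: "adj (B @ [x]) = (if B = [] then {} else insert (last B, x) (adj B))"
proof (induction B)
  case (Cons a B)
  then show ?case by (cases B) (auto simp: adj_def)
qed (simp add: adj_def)

type_synonym 'a info = "'a option \<times> 'a set \<times> ('a \<times> 'a) set"

text \<open>The last letter is remembered only to form the next adjacent pair.\<close>

definition block_info :: "'a list \<Rightarrow> 'a info" where
  "block_info B = (if B = [] then None else Some (last B), set B, adj B)"

definition info_trans :: "'a::countable set \<Rightarrow> ('a set \<Rightarrow> ('a \<times> 'a) set \<Rightarrow> nat list) \<Rightarrow> nat list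
    \<Rightarrow> 'a info option ltrans" where
  "info_trans A W suf = (\<lambda>s a.
     case s of None \<Rightarrow> (None, a, True, [])
     | Some (l, S, E) \<Rightarrow>
       if a = 0 then (None, a, True, suf)
       else if a = 2 then (Some (None, {}, {}), a, True, W S E)
       else if a \<in> code ` A then
         (let x = decode a
          in (Some (Some x, insert x S, (case l of None \<Rightarrow> {} | Some y \<Rightarrow> insert (y, x) E)), a, True, []))
       else (s, a, True, []))"

lemma block_info_snoc:
  "block_info (B @ [x]) = (Some x, insert x (set B), if B = [] then {} else insert (last B, x) (adj B))"
  by (auto simp: block_info_def adj_snoc)

lemma info_letters:
  assumes "set C \<subseteq> A"
  shows "lreach (info_trans A W suf) None (length C) (Some (block_info B), L, map code C @ R, out)
           (Some (block_info (B @ C)), rev (map code C) @ L, R, out)"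
  using assms
proof (induction C arbitrary: B L)
  case Nil
  then show ?case by (auto intro: lreach_refl)
next
  case (Cons c C)
  have "lstep (info_trans A W suf) (Some (block_info B), L, code c # map code C @ R, out) =
        (Some (block_info (B @ [c])), code c # L, map code C @ R, out)"
    using Cons.prems code_ge [of c] unfolding block_info_snoc
    by (auto simp: info_trans_def block_info_def)
  then show ?case
    using Cons.IH [of "B @ [c]" "code c # L"] Cons.prems by (auto intro!: lreach_step')
qed

lemma info_blocks:
  assumes "Bs \<in> blocks_over A"
  shows "\<exists>L'. lreach (info_trans A W suf) None (length (encB Bs)) (Some (block_info []), L, encB Bs, out)
           (Some (block_info []), L', [], out @ concat (map (\<lambda>B. W (set B) (adj B)) Bs))"
  using assms
proof (induction Bs arbitrary: L out)
  case Nil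
  then show ?case by (auto simp: encB_def intro: lreach_refl)
next
  case (Cons B Bs)
  have 1: "lreach (info_trans A W suf) None (length B) (Some (block_info []), L, map code B @ 2 # encB Bs, out)
           (Some (block_info B), rev (map code B) @ L, 2 # encB Bs, out)"
    using info_letters [of B A W suf "[]"] Cons.prems by (auto simp: blocks_over_def)
  have 2: "lreach (info_trans A W suf) None 1 (Some (block_info B), rev (map code B) @ L, 2 # encB Bs, out)
           (Some (block_info []), 2 # rev (map code B) @ L, encB Bs, out @ W (set B) (adj B))"
    by (rule lreach_one) (auto simp: info_trans_def block_info_def adj_def)
  obtain L' where "lreach (info_trans A W suf) None (length (encB Bs))
      (Some (block_info []), 2 # rev (map code B) @ L, encB Bs, out @ W (set B) (adj B))
           (Some (block_info []), L', [], (out @ W (set B) (adj B)) @ concat (map (\<lambda>B. W (set B) (adj B)) Bs))"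
    using Cons.IH [of "2 # rev (map code B) @ L" "out @ W (set B) (adj B)"] Cons.prems
    by (auto simp: blocks_over_def)
  from lreach_trans [OF 1 lreach_trans [OF 2 this]] show ?case by (auto simp: encB_Cons)
qed

text \<open>Over a finite alphabet there are finitely many sets of letters and of adjacent pairs.
  They fit into the state, and the words \<open>W S E\<close> have a common bound, so
  \<open>W\<close> may be an arbitrary function.\<close>

lemma info_ptime:
  fixes A :: "'a::countable set"
  assumes A: "finite A"
    and out: "\<And>Bs. Bs \<in> blocks_over A \<Longrightarrow> eO (F Bs) = concat (map (\<lambda>B. W (set B) (adj B)) Bs) @ suf"
  shows "ptime (blocks_over A) encB eO F"
proof -
  obtain G1 where G1: "\<forall>a\<in>code ` A. a < G1"
    using A finite_nat_set_iff_bounded by blast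
  define Ws where "Ws = insert suf ((\<lambda>(S, E). W S E) ` (Pow A \<times> Pow (A \<times> A)))"
  have "finite Ws" using A by (auto simp: Ws_def)
  then obtain G2 B where G2: "\<And>w. w \<in> Ws \<Longrightarrow> set w \<subseteq> {..<G2} \<and> length w \<le> B"
    using finite_words_bound by metis
  define G where "G = max 3 (max G1 G2)"
  have suf: "set suf \<subseteq> {..<G}" "length suf \<le> B"
    using G2 [of suf] by (auto simp: Ws_def G_def less_max_iff_disj)
  have W: "set (W S E) \<subseteq> {..<G}" "length (W S E) \<le> B" if "S \<subseteq> A" "E \<subseteq> A \<times> A" for S E
  proof -
    have "W S E \<in> Ws" using that by (auto simp: Ws_def)
    then show "set (W S E) \<subseteq> {..<G}" "length (W S E) \<le> B"
      using G2 by (fastforce simp: G_def less_max_iff_disj)+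
  qed
  define Q where "Q = insert None (Some ` (insert None (Some ` A) \<times> Pow A \<times> Pow (A \<times> A)))"
  let ?\<tau> = "info_trans A W suf"
  have "ltrans_ok Q None G B ?\<tau>"
    unfolding ltrans_ok_def
  proof (intro ballI allI impI)
    fix s a assume "s \<in> Q - {None}" "a < G"
    then obtain l S E where s: "s = Some (l, S, E)" "l \<in> insert None (Some ` A)" "S \<subseteq> A" "E \<subseteq> A \<times> A"
      by (auto simp: Q_def)
    then show "case ?\<tau> s a of (s', c, right, w) \<Rightarrow>
        s' \<in> Q \<and> (a \<noteq> 0 \<longrightarrow> 0 < c \<and> c < G) \<and> set w \<subseteq> {..<G} \<and> length w \<le> B"
      using suf W [OF s(3,4)] \<open>a < G\<close>
      by (auto simp: info_trans_def Q_def Let_def split: option.splits)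
  qed
  moreover have "finite Q" using A by (auto simp: Q_def)
  ultimately show ?thesis
  proof (intro lreach_ptime [where p = "[:2, 1:]" and \<tau> = ?\<tau> and ?s0.0 = "Some (block_info [])"])
    fix Bs assume Bs: "Bs \<in> blocks_over A"
    have "\<forall>B\<in>set Bs. \<forall>x\<in>set B. code x < G1"
      using Bs G1 unfolding blocks_over_def by blast
    then have lt: "\<forall>x\<in>set (encB Bs). x < G"
      by (auto simp: encB_def G_def less_max_iff_disj)
    then show "set (encB Bs) \<subseteq> {0<..<G}"
      using encB_ge2 [of Bs] by fastforce
    \<comment> \<open>Hence the end marker falls into the last branch of \<open>info_trans\<close>,
      which leaves the state unchanged.\<close>
    have "1 \<notin> code ` A" by (auto simp: code_def)
    then have 1: "lreach ?\<tau> None 1 (Some (block_info []), [], 1 # encB Bs, []) (Some (block_info []), [1], encB Bs, [])"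
      by (intro lreach_one) (auto simp: info_trans_def block_info_def)
    obtain L' where 2: "lreach ?\<tau> None (length (encB Bs)) (Some (block_info []), [1], encB Bs, [])
           (Some (block_info []), L', [], concat (map (\<lambda>B. W (set B) (adj B)) Bs))"
      using info_blocks [OF Bs, of W suf "[1]" "[]"] by auto
    have 3: "lreach ?\<tau> None 1 (Some (block_info []), L', [], concat (map (\<lambda>B. W (set B) (adj B)) Bs))
        (None, tl L', take 1 L', eO (F Bs))"
      by (rule lreach_one) (auto simp: info_trans_def block_info_def out [OF Bs])
    from lreach_trans [OF 1 lreach_trans [OF 2 3]]
    show "\<exists>n\<le>poly [:2, 1:] (length (encB Bs)). \<exists>L R.
        lreach ?\<tau> None n (Some (block_info []), [], 1 # encB Bs, []) (None, L, R, eO (F Bs))"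
      by (intro exI [of _ "1 + (length (encB Bs) + 1)"]) auto
  qed (auto simp: Q_def block_info_def adj_def G_def)
qed

section \<open>Nested loops over the positions of a word\<close>

primrec tups :: "nat \<Rightarrow> nat \<Rightarrow> nat list list" where
  "tups 0 m = [[]]"
| "tups (Suc k) m = concat (map (\<lambda>is. map (\<lambda>i. is @ [i]) [0..<m]) (tups k m))"

lemma tups_mem: "is \<in> set (tups k m) \<longleftrightarrow> length is = k \<and> set is \<subseteq> {..<m}"
proof (induction k arbitrary: "is")
  case (Suc k)
  show ?case by (cases "is" rule: rev_cases) (auto simp: Suc.IH image_iff)
qed auto

definition enc_word :: "'a::countable list \<Rightarrow> nat list" where
  "enc_word X = encB [map (\<lambda>a. (a, [] :: bool list)) X]"

lemma enc_word_ge2: "set (enc_word X) \<subseteq> {2..}"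
  by (simp add: enc_word_def encB_ge2)

text \<open>Represents a tuple of positions inside the word: each letter carries one bit per loop
  variable, set iff the variable points to it.\<close>

definition marked :: "'a list \<Rightarrow> nat list \<Rightarrow> ('a \<times> bool list) list" where
  "marked X is = map (\<lambda>j. (X ! j, map (\<lambda>i. j = i) is)) [0..<length X]"

lemma marked_Nil: "marked X [] = map (\<lambda>a. (a, [])) X"
  by (rule nth_equalityI) (auto simp: marked_def)

lemma mark_marked: "mark i (marked X is) = marked X (is @ [i])"
  by (rule nth_equalityI) (auto simp: marked_def mark_def)

lemma bsq_marked: "bsq (map (marked X) T) = map (marked X) (concat (map (\<lambda>is. map (\<lambda>i. is @ [i]) [0..<length X]) T))"
proof -
  have "length (marked X is) = length X" for "is" by (simp add: marked_def)
  then show ?thesis by (induction T) (auto simp: bsq_def mark_marked)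
qed

text \<open>Each application of \<open>bsq\<close> adds one innermost loop. The number of loops is
  fixed, so the composition stays polynomial.\<close>

lemma marked_tups_ptime:
  fixes A :: "'a::countable set"
  assumes A: "finite A"
  shows "ptime {X. set X \<subseteq> A} enc_word encB (\<lambda>X. map (marked X) (tups (Suc k) (length X)))"
proof (induction k)
  case 0
  have "ptime (blocks_over (A \<times> {[]})) encB encB bsq"
    by (rule bsq_ptime) (use A in auto)
  then have "ptime ((\<lambda>X. [marked X []]) ` {X. set X \<subseteq> A}) encB encB bsq"
    by (rule ptime_mono) (auto simp: blocks_over_def marked_Nil)
  then show ?case
    by (rule ptime_precompose) (auto simp: enc_word_def marked_Nil [symmetric] bsq_marked [of _ "[[]]", simplified])
next
  case (Suc k)
  define A' where "A' = A \<times> {bs :: bool list. length bs = Suc k}"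
  have "finite {bs :: bool list. set bs \<subseteq> UNIV \<and> length bs = Suc k}" by (rule finite_lists_length_eq) simp
  then have "finite A'" using A by (simp add: A'_def)
  then have "ptime (blocks_over A') encB encB bsq" by (rule bsq_ptime)
  moreover have "map (marked X) (tups (Suc k) (length X)) \<in> blocks_over A'" if "set X \<subseteq> A" for X
    using that unfolding blocks_over_def A'_def
    by (auto simp: tups_mem marked_def simp del: tups.simps dest: nth_mem)
  ultimately have "ptime {X. set X \<subseteq> A} enc_word encB (\<lambda>X. bsq (map (marked X) (tups (Suc k) (length X))))"
    using Suc by (intro ptime_compose [OF Suc]) (auto dest: encB_ge2 [THEN subsetD])
  then show ?case by (simp add: bsq_marked)
qed

definition eq_at :: "nat list \<Rightarrow> nat \<Rightarrow> nat \<Rightarrow> bool" where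
  "eq_at is p q \<longleftrightarrow> p < length is \<and> q < length is \<and> is ! p = is ! q"

definition succ_at :: "nat list \<Rightarrow> nat \<Rightarrow> nat \<Rightarrow> bool" where
  "succ_at is p q \<longleftrightarrow> p < length is \<and> q < length is \<and> is ! q = Suc (is ! p)"

lemma mem_marked: "(a, bs) \<in> set (marked X is) \<longleftrightarrow> (\<exists>j<length X. a = X ! j \<and> bs = map (\<lambda>i. j = i) is)"
  by (auto simp: marked_def)

text \<open>Bit \<open>p\<close> is set at exactly one position, hence the letter carrying it can be
  recovered from the set of letters alone.\<close>

lemma label_marked:
  assumes "set is \<subseteq> {..<length X}" "p < length is"
  shows "(THE a. \<exists>bs. (a, bs) \<in> set (marked X is) \<and> bs ! p) = X ! (is ! p)"
proof (rule the_equality)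
  have "is ! p < length X" using assms nth_mem by blast
  then show "\<exists>bs. (X ! (is ! p), bs) \<in> set (marked X is) \<and> bs ! p"
    using assms by (auto simp: mem_marked)
qed (use assms in \<open>auto simp: mem_marked\<close>)

lemma eq_marked:
  assumes "set is \<subseteq> {..<length X}"
  shows "eq_at is p q \<longleftrightarrow> p < length is \<and> q < length is \<and> (\<exists>(a, bs)\<in>set (marked X is). bs ! p \<and> bs ! q)"
proof -
  have l: "is ! p < length X" if "p < length is" for p using assms that nth_mem by blast
  show ?thesis
  proof (cases "p < length is \<and> q < length is")
    case True
    then show ?thesis using l [of p]
      by (auto simp: eq_at_def mem_marked intro!: exI [of _ "is ! p"] bexI [of _ "(X ! (is ! p), map (\<lambda>i. is ! p = i) is)"])
  qed (auto simp: eq_at_def)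
qed

lemma adj_marked:
  "(x, y) \<in> adj (marked X is) \<longleftrightarrow> (\<exists>j. Suc j < length X \<and> x = marked X is ! j \<and> y = marked X is ! Suc j)"
proof -
  define B where "B = marked X is"
  have "length B = length X" by (simp add: B_def marked_def)
  then have "(x, y) \<in> adj B \<longleftrightarrow> (\<exists>j < length X - 1. x = B ! j \<and> y = B ! Suc j)"
    by (auto simp: adj_def set_zip nth_tl)
  then show ?thesis unfolding B_def [symmetric] by (simp add: less_diff_conv conj_ac)
qed

lemma succ_marked:
  assumes "set is \<subseteq> {..<length X}"
  shows "succ_at is p q \<longleftrightarrow> p < length is \<and> q < length is \<and>
    (\<exists>(x, y)\<in>adj (marked X is). snd x ! p \<and> snd y ! q)"
proof -
  have l: "is ! p < length X" if "p < length is" for p using assms that nth_mem by blast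
  have m: "snd (marked X is ! j) ! p \<longleftrightarrow> j = is ! p" if "j < length X" "p < length is" for j p
    using that by (simp add: marked_def)
  show ?thesis
  proof (cases "p < length is \<and> q < length is")
    case True
    then have "succ_at is p q \<longleftrightarrow> (\<exists>j. Suc j < length X \<and> j = is ! p \<and> Suc j = is ! q)"
      using l [of q] by (auto simp: succ_at_def)
    also have "\<dots> \<longleftrightarrow> (\<exists>j. Suc j < length X \<and> snd (marked X is ! j) ! p \<and> snd (marked X is ! Suc j) ! q)"
      using True m by auto
    also have "\<dots> \<longleftrightarrow> (\<exists>(x, y)\<in>adj (marked X is). snd x ! p \<and> snd y ! q)"
    proof -
      have "(\<exists>(x, y)\<in>adj (marked X is). snd x ! p \<and> snd y ! q) \<longleftrightarrow>
          (\<exists>x y. (x, y) \<in> adj (marked X is) \<and> snd x ! p \<and> snd y ! q)" by blast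
      then show ?thesis unfolding adj_marked by blast
    qed
    finally show ?thesis using True by simp
  qed (auto simp: succ_at_def)
qed

text \<open>The set of letters and the set of adjacent pairs of a marked block determine the labels,
  equalities and adjacencies of the loop positions: two positions are equal iff their marks meet in
  one letter, and adjacent iff their marks meet in one adjacent pair. So a transducer with finite
  memory can print \<open>W\<close>.\<close>

lemma loops_ptime:
  fixes A :: "'a::countable set" and eO :: "'b \<Rightarrow> nat list"
  assumes A: "finite A"
    and out: "\<And>X. set X \<subseteq> A \<Longrightarrow> eO (F X) =
      concat (map (\<lambda>is. W (map ((!) X) is) (eq_at is) (succ_at is)) (tups (Suc k) (length X))) @ suf"
  shows "ptime {X. set X \<subseteq> A} enc_word eO F"
proof -
  define W' where "W' = (\<lambda>S E. W (map (\<lambda>p. THE a. \<exists>bs. (a, bs) \<in> S \<and> bs ! p) [0..<Suc k])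
     (\<lambda>p q. p < Suc k \<and> q < Suc k \<and> (\<exists>(a :: 'a, bs :: bool list)\<in>S. bs ! p \<and> bs ! q))
     (\<lambda>p q. p < Suc k \<and> q < Suc k \<and> (\<exists>(x :: 'a \<times> bool list, y :: 'a \<times> bool list)\<in>E. snd x ! p \<and> snd y ! q)))"
  define H where "H = (\<lambda>Bs. concat (map (\<lambda>B. W' (set B) (adj B)) Bs) @ suf)"
  define A' where "A' = A \<times> {bs :: bool list. length bs = Suc k}"
  have "finite {bs :: bool list. set bs \<subseteq> UNIV \<and> length bs = Suc k}" by (rule finite_lists_length_eq) simp
  then have fA: "finite A'" using A by (simp add: A'_def)
  have sub: "map (marked X) (tups (Suc k) (length X)) \<in> blocks_over A'" if "set X \<subseteq> A" for X
    using that unfolding blocks_over_def A'_def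
    by (auto simp: tups_mem marked_def simp del: tups.simps dest: nth_mem)
  have "ptime (blocks_over A') encB (\<lambda>w. w) H"
    by (rule info_ptime [OF fA, where W = W' and suf = suf]) (simp add: H_def)
  then have "ptime {X. set X \<subseteq> A} enc_word (\<lambda>w. w) (\<lambda>X. H (map (marked X) (tups (Suc k) (length X))))"
    using sub by (intro ptime_compose [OF marked_tups_ptime [OF A]]) (auto dest: encB_ge2 [THEN subsetD])
  then have H: "ptime ((\<lambda>X. X) ` {X. set X \<subseteq> A}) enc_word (\<lambda>w. w) (\<lambda>X. H (map (marked X) (tups (Suc k) (length X))))"
    by (simp only: image_ident)
  have "H (map (marked X) (tups (Suc k) (length X))) = eO (F X)" if "set X \<subseteq> A" for X
  proof -
    have "W' (set (marked X is)) (adj (marked X is)) = W (map ((!) X) is) (eq_at is) (succ_at is)"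
      if "is \<in> set (tups (Suc k) (length X))" for "is"
    proof -
      have i: "length is = Suc k" "set is \<subseteq> {..<length X}" using that tups_mem by blast+
      have "map (\<lambda>p. THE a. \<exists>bs. (a, bs) \<in> set (marked X is) \<and> bs ! p) [0..<Suc k] = map ((!) X) is"
        using i by (intro nth_equalityI) (auto simp: label_marked simp del: upt_Suc)
      then show ?thesis
        unfolding W'_def using i by (simp add: eq_marked succ_marked fun_eq_iff del: upt_Suc)
          (simp add: eq_marked [OF i(2), abs_def] succ_marked [OF i(2), abs_def] i(1))
    qed
    then show ?thesis
      unfolding out [OF that] H_def map_map
      by (intro arg_cong [where f = "\<lambda>w. concat w @ suf"] map_cong) (auto simp del: tups.simps)
  qed
  then show ?thesis by (intro ptime_precompose [OF H refl]) (simp only: mem_Collect_eq)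
qed

section \<open>Tilings\<close>

type_synonym env = "bool \<times> bool \<times> nat"

text \<open>Time and cells share the index set of \<open>Y\<close>, so one word can serve the loops
  over both. A tile sees its position only through this finite information, which the printer can
  recover from letters.\<close>

definition tile_env :: "nat list \<Rightarrow> nat \<Rightarrow> nat \<Rightarrow> env" where
  "tile_env Y t j = (t = 0, Suc t = length Y, Y ! j)"

definition tiling :: "'t set \<Rightarrow> (env \<Rightarrow> 't \<Rightarrow> bool) \<Rightarrow> (env \<Rightarrow> 't \<Rightarrow> 't \<Rightarrow> bool) \<Rightarrow>
    (env \<Rightarrow> 't \<Rightarrow> 't \<Rightarrow> bool) \<Rightarrow> nat list \<Rightarrow> (nat \<Rightarrow> nat \<Rightarrow> 't) \<Rightarrow> bool" where
  "tiling T U H V Y \<tau> \<longleftrightarrow>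
     (\<forall>t<length Y. \<forall>j<length Y. \<tau> t j \<in> T \<and> U (tile_env Y t j) (\<tau> t j) \<and>
        (Suc j < length Y \<longrightarrow> H (tile_env Y t j) (\<tau> t j) (\<tau> t (Suc j))) \<and>
        (Suc t < length Y \<longrightarrow> V (tile_env Y t j) (\<tau> t j) (\<tau> (Suc t) j)))"

lemma tilingD:
  assumes "tiling T U H V Y \<tau>" "t < length Y" "j < length Y"
  shows "\<tau> t j \<in> T" "U (tile_env Y t j) (\<tau> t j)"
    "Suc j < length Y \<Longrightarrow> H (tile_env Y t j) (\<tau> t j) (\<tau> t (Suc j))"
    "Suc t < length Y \<Longrightarrow> V (tile_env Y t j) (\<tau> t j) (\<tau> (Suc t) j)"
  using assms unfolding tiling_def by blast+

text \<open>Tiles become coordinates of features and arguments of constraint kinds, and are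
  therefore renamed to numbers.\<close>

lemma tiling_number_tiles:
  assumes "finite T"
  shows "\<exists>(n :: nat) U' H' V'. \<forall>Y. (\<exists>\<tau>. tiling {..<n} U' H' V' Y \<tau>) \<longleftrightarrow> (\<exists>\<tau>. tiling T U H V Y \<tau>)"
proof -
  obtain n :: nat and f where f: "T = f ` {i. i < n}" "inj_on f {i. i < n}"
    using finite_imp_nat_seg_image_inj_on [OF assms] by blast
  let ?U = "\<lambda>e s. U e (f s)" and ?H = "\<lambda>e s s'. H e (f s) (f s')" and ?V = "\<lambda>e s s'. V e (f s) (f s')"
  have "(\<exists>\<tau>. tiling {..<n} ?U ?H ?V Y \<tau>) \<longleftrightarrow> (\<exists>\<tau>. tiling T U H V Y \<tau>)" for Y
  proof
    assume "\<exists>\<tau>. tiling {..<n} ?U ?H ?V Y \<tau>"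
    then obtain \<tau> where "tiling {..<n} ?U ?H ?V Y \<tau>" ..
    then have "tiling T U H V Y (\<lambda>t j. f (\<tau> t j))" by (auto simp: tiling_def f)
    then show "\<exists>\<tau>. tiling T U H V Y \<tau>" by blast
  next
    assume "\<exists>\<tau>. tiling T U H V Y \<tau>"
    then obtain \<tau> where \<tau>: "tiling T U H V Y \<tau>" ..
    define \<sigma> where "\<sigma> = (\<lambda>t j. inv_into {i. i < n} f (\<tau> t j))"
    have "\<sigma> t j < n \<and> f (\<sigma> t j) = \<tau> t j" if "t < length Y" "j < length Y" for t j
    proof -
      have "\<tau> t j \<in> f ` {i. i < n}" using \<tau> that by (simp add: tiling_def f)
      from inv_into_into [OF this] f_inv_into_f [OF this] show ?thesis by (simp add: \<sigma>_def)
    qed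
    then have "tiling {..<n} ?U ?H ?V Y \<sigma>" using \<tau> by (simp add: tiling_def)
    then show "\<exists>\<tau>. tiling {..<n} ?U ?H ?V Y \<tau>" by blast
  qed
  then show ?thesis by blast
qed

section \<open>Computations as tilings\<close>

text \<open>
  The scanned symbol is repeated in all cells of a tape, and each cell knows whether the head is at
  the cell itself or at its left or right neighbour. Hence the next symbol and the next head position
  can be determined from the cell alone.
\<close>

datatype cell = Cell (scanned: nat) (sym: nat) (here: bool) (left: bool) (right: bool)

definition cell_of :: "nat \<Rightarrow> tape \<Rightarrow> cell" where
  "cell_of j tp = Cell (fst tp (snd tp)) (fst tp j) (snd tp = j) (Suc (snd tp) = j) (snd tp = Suc j)"

definition view :: "config \<Rightarrow> nat \<Rightarrow> nat \<times> cell list" where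
  "view c j = (fst c, map (cell_of j) (snd c))"

definition actions :: "turing_machine \<Rightarrow> nat \<Rightarrow> nat list \<Rightarrow> nat \<times> (nat \<times> move) list" where
  "actions M q rs = (if q = halt M then (q, map (\<lambda>r. (r, Stay)) rs) else delta M q rs)"

lemma step_actions:
  "step M c = (let r = actions M (fst c) (map (\<lambda>tp. fst tp (snd tp)) (snd c))
               in (fst r, map2 act (snd r) (snd c)))"
  by (auto simp: step_def actions_def Let_def comp_def map2_act_stay prod_eq_iff)

text \<open>
  Labels of the cells of the input tape: 1 stands for the end marker, 2 and 3 for fixed bits, 4 for a
  cell of the certificate, 0 for a blank, and 5 for the blank in the last cell.
\<close>

definition cell_labels :: "bool list \<Rightarrow> nat \<Rightarrow> nat \<Rightarrow> nat list" where
  "cell_labels x p r = 1 # map bit_symbol (encode_bits x) @ replicate p 4 @ replicate r 0 @ [5]"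

text \<open>Label 4 admits the blank because a certificate may be shorter than its bound;
  \<open>horizontal\<close> then forces the cells after the first blank to be blank.\<close>

definition label_allows :: "nat \<Rightarrow> nat \<Rightarrow> bool" where
  "label_allows lab s \<longleftrightarrow>
     (if lab = 5 then s = 0 else if lab = 4 then s \<in> {0, 2, 3} else s = lab)"

definition tile_set :: "turing_machine \<Rightarrow> (nat \<times> cell list) set" where
  "tile_set M = states M \<times> {cs. set cs \<subseteq> {Cell r s h l rt | r s h l rt. r < symbols M \<and> s < symbols M}
     \<and> length cs = tapes M}"

text \<open>At the two ends of a row no neighbour can refute a wrong \<open>left\<close> or
  \<open>right\<close> flag, so the labels 1 and 5 do it.\<close>

definition unary :: "turing_machine \<Rightarrow> env \<Rightarrow> nat \<times> cell list \<Rightarrow> bool" where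
  "unary M e v = (case (e, v) of ((f, l, lab), (q, cs)) \<Rightarrow>
     (\<forall>c\<in>set cs. (here c \<longrightarrow> scanned c = sym c) \<and> (lab = 1 \<longrightarrow> \<not> left c) \<and> (lab = 5 \<longrightarrow> \<not> right c)) \<and>
     (f \<longrightarrow> q = start M \<and>
        (\<forall>k<tapes M. here (cs ! k) = (lab = 1) \<and>
           (if k = 0 then label_allows lab (sym (cs ! k))
            else sym (cs ! k) = (if lab = 1 then 1 else 0)))))"

text \<open>
  The last conjunct expresses acceptance: on the output tape, 1 only occurs in cell 0, so that the
  output is the single bit True iff 1 is followed by 3 and 3 is followed by 0.
\<close>

definition horizontal :: "turing_machine \<Rightarrow> env \<Rightarrow> nat \<times> cell list \<Rightarrow> nat \<times> cell list \<Rightarrow> bool" where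
  "horizontal M e v v' = (case (e, v, v') of ((f, l, lab), (q, cs), (q', cs')) \<Rightarrow>
     q' = q \<and>
     (\<forall>k<tapes M. scanned (cs' ! k) = scanned (cs ! k) \<and>
        left (cs' ! k) = here (cs ! k) \<and> right (cs ! k) = here (cs' ! k)) \<and>
     (f \<longrightarrow> sym (cs ! 0) = 0 \<longrightarrow> sym (cs' ! 0) = 0) \<and>
     (l \<longrightarrow> (sym (cs ! 1) = 1 \<longrightarrow> sym (cs' ! 1) = 3) \<and> (sym (cs ! 1) = 3 \<longrightarrow> sym (cs' ! 1) = 0)))"

definition vertical :: "turing_machine \<Rightarrow> env \<Rightarrow> nat \<times> cell list \<Rightarrow> nat \<times> cell list \<Rightarrow> bool" where
  "vertical M e v v' = (case (e, v, v') of ((f, l, lab), (q, cs), (q', cs')) \<Rightarrow>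
     (let r = actions M q (map scanned cs) in
        q' = fst r \<and>
        (\<forall>k<tapes M.
           sym (cs' ! k) = (if here (cs ! k) then fst (snd r ! k) else sym (cs ! k)) \<and>
           here (cs' ! k) = (case snd (snd r ! k) of
              MoveLeft \<Rightarrow> right (cs ! k) \<or> here (cs ! k) \<and> lab = 1
            | Stay \<Rightarrow> here (cs ! k)
            | MoveRight \<Rightarrow> left (cs ! k)))))"

lemma finite_tile_set:
  assumes "wf_tm M"
  shows "finite (tile_set M)"
proof -
  have "{Cell r s h l rt | r s h l rt. r < symbols M \<and> s < symbols M} =
      (\<lambda>(r, s, h, l, rt). Cell r s h l rt) ` ({..<symbols M} \<times> {..<symbols M} \<times> UNIV)"
    by (auto simp: image_iff)
  then have "finite {Cell r s h l rt | r s h l rt. r < symbols M \<and> s < symbols M}" by simp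
  from finite_lists_length_eq [OF this, of "tapes M"] show ?thesis
    using assms unfolding tile_set_def wf_tm_def by simp
qed

lemma length_cell_labels: "length (cell_labels x p r) = length (encode_bits x) + p + r + 2"
  by (simp add: cell_labels_def)

lemma cell_labels_nth:
  assumes "j < length (cell_labels x p r)"
  shows "cell_labels x p r ! j =
    (if j = 0 then 1 else if j \<le> length (encode_bits x) then bit_symbol (encode_bits x ! (j - 1))
     else if j \<le> length (encode_bits x) + p then 4
     else if j \<le> length (encode_bits x) + p + r then 0 else 5)"
  using assms by (auto simp: cell_labels_def nth_append nth_Cons')

lemma cell_labels_eq_1: "j < length (cell_labels x p r) \<Longrightarrow> cell_labels x p r ! j = 1 \<longleftrightarrow> j = 0"
  by (auto simp: cell_labels_nth bit_symbol_def)

lemma cell_labels_eq_5: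
  "j < length (cell_labels x p r) \<Longrightarrow> cell_labels x p r ! j = 5 \<longleftrightarrow> Suc j = length (cell_labels x p r)"
  by (auto simp: cell_labels_nth length_cell_labels bit_symbol_def)

locale verifier =
  fixes M :: turing_machine
  assumes wf: "wf_tm M"
begin

abbreviation K :: nat where "K \<equiv> tapes M"

lemma K2: "2 \<le> K" using wf by (simp add: wf_tm_def)

definition ok_config :: "config \<Rightarrow> bool" where
  "ok_config c \<longleftrightarrow> fst c \<in> states M \<and> length (snd c) = K \<and> (\<forall>tp\<in>set (snd c). \<forall>i. fst tp i < symbols M)"

lemma length_actions:
  assumes "ok_config c"
  shows "length (snd (actions M (fst c) (map (\<lambda>tp. fst tp (snd tp)) (snd c)))) = K"
proof -
  have "set (map (\<lambda>tp. fst tp (snd tp)) (snd c)) \<subseteq> {..<symbols M}"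
    using assms by (auto simp: ok_config_def)
  then show ?thesis using assms wf unfolding ok_config_def actions_def wf_tm_def by auto
qed

lemma ok_step:
  assumes "ok_config c"
  shows "ok_config (step M c)"
proof (cases "fst c = halt M")
  case True
  then show ?thesis using assms by (simp add: step_def)
next
  case False
  define r where "r = delta M (fst c) (map (\<lambda>tp. fst tp (snd tp)) (snd c))"
  have "set (map (\<lambda>tp. fst tp (snd tp)) (snd c)) \<subseteq> {..<symbols M}"
    using assms by (auto simp: ok_config_def)
  then have r: "fst r \<in> states M" "length (snd r) = K" "fst ` set (snd r) \<subseteq> {..<symbols M}"
    using assms wf False unfolding ok_config_def r_def wf_tm_def by auto
  have st: "step M c = (fst r, map2 act (snd r) (snd c))" using False by (simp add: step_def r_def Let_def)
  have "fst tp i < symbols M" if "tp \<in> set (map2 act (snd r) (snd c))" for tp i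
  proof -
    have "tp \<in> (\<lambda>(a, tp). act a tp) ` set (zip (snd r) (snd c))" using that by simp
    then obtain a tp' where z: "(a, tp') \<in> set (zip (snd r) (snd c))" "tp = act a tp'" by auto
    then have "a \<in> set (snd r)" "tp' \<in> set (snd c)"
      using set_zip_leftD [OF z(1)] set_zip_rightD [OF z(1)] by blast+
    with z(2) show ?thesis using r(3) assms by (auto simp: act_def ok_config_def)
  qed
  then show ?thesis using r assms unfolding st ok_config_def by simp
qed

lemma ok_init: "ok_config (init_config M y)"
proof -
  have "tape_contents z i < symbols M" for z i
    using wf by (auto simp: tape_contents_def bit_symbol_def wf_tm_def)
  then show ?thesis
    using wf K2 unfolding ok_config_def by (auto simp: init_config_def wf_tm_def)
qed

lemma ok_steps: "ok_config ((step M ^^ t) (init_config M y))"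
  by (induction t) (auto intro: ok_init ok_step)

lemma nth_step:
  assumes "ok_config c" "k < K"
  shows "snd (step M c) ! k =
    act (snd (actions M (fst c) (map (\<lambda>tp. fst tp (snd tp)) (snd c))) ! k) (snd c ! k)"
  using assms length_actions [OF assms(1)] by (simp add: step_actions Let_def ok_config_def)

lemma view_in_tile_set:
  assumes "ok_config c"
  shows "view c j \<in> tile_set M"
  using assms unfolding tile_set_def view_def ok_config_def cell_of_def by auto

lemma vertical_view:
  assumes "ok_config c" "lab = 1 \<longleftrightarrow> j = 0"
  shows "vertical M (f, l, lab) (view c j) (view (step M c) j)"
proof -
  have "length (snd (step M c)) = K" "length (snd c) = K"
    using ok_step [OF assms(1)] assms(1) by (auto simp: ok_config_def)
  moreover have "scanned \<circ> cell_of j = (\<lambda>tp. fst tp (snd tp))"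
    by (auto simp: cell_of_def)
  moreover have "fst (step M c) = fst (actions M (fst c) (map (\<lambda>tp. fst tp (snd tp)) (snd c)))"
    by (simp add: step_actions Let_def)
  ultimately show ?thesis using assms
    by (auto simp: vertical_def view_def Let_def nth_step cell_of_def act_def split: move.splits)
qed

lemma horizontal_view:
  assumes "ok_config c"
    and "f \<Longrightarrow> fst (snd c ! 0) j = 0 \<Longrightarrow> fst (snd c ! 0) (Suc j) = 0"
    and "l \<Longrightarrow> (fst (snd c ! 1) j = 1 \<longrightarrow> fst (snd c ! 1) (Suc j) = 3) \<and>
               (fst (snd c ! 1) j = 3 \<longrightarrow> fst (snd c ! 1) (Suc j) = 0)"
  shows "horizontal M (f, l, lab) (view c j) (view c (Suc j))"
  using assms K2 by (auto simp: horizontal_def view_def cell_of_def ok_config_def)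

text \<open>Symbols and head flags determine the redundant parts of the tiles:
  \<open>horizontal\<close> makes the scanned symbol constant along the row, \<open>unary\<close>
  fixes it in the cell of the head, and the neighbour flags are copies of head flags next door. A
  head outside the row would leave the scanned symbol undetermined, hence the assumption on the
  heads.\<close>

lemma row_eq_view:
  assumes ok: "ok_config c" and m: "m = length Y"
    and Y1: "\<And>j. j < m \<Longrightarrow> Y ! j = 1 \<longleftrightarrow> j = 0" and Y5: "\<And>j. j < m \<Longrightarrow> Y ! j = 5 \<longleftrightarrow> Suc j = m"
    and heads: "\<And>k. k < K \<Longrightarrow> snd (snd c ! k) < m"
    and R: "\<And>j. j < m \<Longrightarrow> fst (R j) = fst c \<and> length (snd (R j)) = K \<and>
       (\<forall>k<K. sym (snd (R j) ! k) = fst (snd c ! k) j \<and> here (snd (R j) ! k) = (snd (snd c ! k) = j))"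
    and U: "\<And>j. j < m \<Longrightarrow> unary M (f, l, Y ! j) (R j)"
    and H: "\<And>j. Suc j < m \<Longrightarrow> horizontal M (f, l, Y ! j) (R j) (R (Suc j))"
    and j: "j < m"
  shows "R j = view c j"
proof -
  have H': "scanned (snd (R (Suc j)) ! k) = scanned (snd (R j) ! k) \<and>
      left (snd (R (Suc j)) ! k) = here (snd (R j) ! k) \<and> right (snd (R j) ! k) = here (snd (R (Suc j)) ! k)"
    if "Suc j < m" "k < K" for j k
    using H [OF that(1)] that(2) by (auto simp: horizontal_def split: prod.splits)
  have U': "(here (snd (R j) ! k) \<longrightarrow> scanned (snd (R j) ! k) = sym (snd (R j) ! k)) \<and>
      (Y ! j = 1 \<longrightarrow> \<not> left (snd (R j) ! k)) \<and> (Y ! j = 5 \<longrightarrow> \<not> right (snd (R j) ! k))"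
    if "j < m" "k < K" for j k
    using U [OF that(1)] R [OF that(1)] that(2) by (auto simp: unary_def split: prod.splits)
  have const: "scanned (snd (R j) ! k) = scanned (snd (R 0) ! k)" if "j < m" "k < K" for j k
    using that(1) by (induction j) (use H' that in auto)
  have "snd (R j) ! k = cell_of j (snd c ! k)" if k: "k < K" for k
  proof -
    define h where "h = snd (snd c ! k)"
    have h: "h < m" using heads [OF k] by (simp add: h_def)
    have "scanned (snd (R h) ! k) = fst (snd c ! k) h"
      using U' [OF h k] R [OF h] k by (simp add: h_def)
    then have r: "scanned (snd (R j) ! k) = fst (snd c ! k) h"
      using const [OF h k] const [OF j k] by simp
    have l: "left (snd (R j) ! k) = (Suc h = j)"
    proof (cases j)
      case 0
      then show ?thesis using U' [OF j k] Y1 [OF j] by simp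
    next
      case (Suc i)
      then show ?thesis using H' [of i k] R [of i] j k by (simp add: h_def)
    qed
    have rt: "right (snd (R j) ! k) = (h = Suc j)"
    proof (cases "Suc j = m")
      case True
      then show ?thesis using U' [OF j k] Y5 [OF j] h by simp
    next
      case False
      then show ?thesis using H' [of j k] R [of "Suc j"] j k by (simp add: h_def)
    qed
    show ?thesis
      using r l rt R [OF j] k by (intro cell.expand) (simp add: cell_of_def h_def)
  qed
  then show ?thesis
    using R [OF j] ok by (auto simp: view_def ok_config_def prod_eq_iff intro!: nth_equalityI)
qed

lemma head_init: "k < K \<Longrightarrow> snd (snd ((step M ^^ t) (init_config M y)) ! k) \<le> t"
proof -
  assume "k < K"
  moreover have "length (snd ((step M ^^ t) (init_config M y))) = K"
    using ok_steps by (simp add: ok_config_def)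
  moreover have "\<forall>tp\<in>set (snd ((step M ^^ t) (init_config M y))). snd tp \<le> t"
    by (rule head_steps_le) (auto simp: init_config_def)
  ultimately show ?thesis by simp
qed

text \<open>Induction on the rows. After \<open>t\<close> steps no head is beyond cell
  \<open>t\<close>, which is still inside the square, so \<open>row_eq_view\<close> applies to every
  row.\<close>

lemma tiling_imp_view:
  assumes Y: "Y = cell_labels x p r"
    and \<tau>: "tiling (tile_set M) (unary M) (horizontal M) (vertical M) Y \<tau>"
    and y: "\<And>j. j < length Y \<Longrightarrow> sym (snd (\<tau> 0 j) ! 0) = tape_contents y j"
    and t: "t < length Y"
  shows "\<forall>j<length Y. \<tau> t j = view ((step M ^^ t) (init_config M y)) j"
  using t
proof (induction t)
  case 0
  note Y1 = cell_labels_eq_1 [of _ x p r, folded Y] and Y5 = cell_labels_eq_5 [of _ x p r, folded Y]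
  have K0: "0 < K" using K2 by simp
  have len: "length (snd (\<tau> 0 j)) = K" if "j < length Y" for j
    using \<tau> 0 that by (auto simp: tiling_def tile_set_def mem_Times_iff)
  show ?case
  proof (intro allI impI row_eq_view [where Y = Y])
    fix j assume j: "j < length Y"
    then have u: "unary M (True, Suc 0 = length Y, Y ! j) (\<tau> 0 j)"
      using tilingD(2) [OF \<tau> 0 j] by (simp add: tile_env_def)
    have "sym (snd (\<tau> 0 j) ! k) = fst (snd (init_config M y) ! k) j \<and>
       here (snd (\<tau> 0 j) ! k) = (snd (snd (init_config M y) ! k) = j)" if "k < K" for k
      using u y [OF j] Y1 [OF j] that
      by (cases k) (auto simp: unary_def init_config_def tape_contents_def split: prod.splits)
    then show "fst (\<tau> 0 j) = fst ((step M ^^ 0) (init_config M y)) \<and> length (snd (\<tau> 0 j)) = K \<and>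
       (\<forall>k<K. sym (snd (\<tau> 0 j) ! k) = fst (snd ((step M ^^ 0) (init_config M y)) ! k) j \<and>
         here (snd (\<tau> 0 j) ! k) = (snd (snd ((step M ^^ 0) (init_config M y)) ! k) = j))"
      using len [OF j] u by (auto simp: unary_def init_config_def split: prod.splits)
    show "unary M (True, Suc 0 = length Y, Y ! j) (\<tau> 0 j)" by (rule u)
  next
    fix j assume "Suc j < length Y"
    then show "horizontal M (True, Suc 0 = length Y, Y ! j) (\<tau> 0 j) (\<tau> 0 (Suc j))"
      using tilingD(3) [OF \<tau> 0, of j] by (simp add: tile_env_def)
  next
    fix k assume "k < K"
    then show "snd (snd ((step M ^^ 0) (init_config M y)) ! k) < length Y"
      using head_init [of k 0 y] 0 by simp
  qed (use Y1 Y5 ok_steps [of 0 y] in auto)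
next
  case (Suc t)
  note Y1 = cell_labels_eq_1 [of _ x p r, folded Y] and Y5 = cell_labels_eq_5 [of _ x p r, folded Y]
  define c where "c = (step M ^^ t) (init_config M y)"
  have ok: "ok_config c" by (simp add: c_def ok_steps)
  have IH: "\<tau> t j = view c j" if "j < length Y" for j using Suc that by (simp add: c_def)
  have len: "length (snd (\<tau> (Suc t) j)) = K" if "j < length Y" for j
    using \<tau> Suc.prems that by (auto simp: tiling_def tile_set_def mem_Times_iff)
  have c': "(step M ^^ Suc t) (init_config M y) = step M c" by (simp add: c_def)
  show ?case
    unfolding c'
  proof (intro allI impI row_eq_view [where Y = Y])
    fix j assume j: "j < length Y"
    have "vertical M (tile_env Y t j) (\<tau> t j) (\<tau> (Suc t) j)"
      using tilingD(4) [OF \<tau> _ j] Suc.prems by simp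
    then have v1: "vertical M (tile_env Y t j) (view c j) (\<tau> (Suc t) j)" using IH [OF j] by simp
    \<comment> \<open>The true successor row satisfies the same condition. As this condition
      determines the state, the symbols and the head flags, comparison with \<open>v1\<close>
      identifies them.\<close>
    have v2: "vertical M (tile_env Y t j) (view c j) (view (step M c) j)"
      unfolding tile_env_def by (rule vertical_view [OF ok]) (use Y1 [OF j] in simp)
    have lc: "length (snd (step M c)) = K" using ok_step [OF ok] by (simp add: ok_config_def)
    show "fst (\<tau> (Suc t) j) = fst (step M c) \<and> length (snd (\<tau> (Suc t) j)) = K \<and>
       (\<forall>k<K. sym (snd (\<tau> (Suc t) j) ! k) = fst (snd (step M c) ! k) j \<and>
         here (snd (\<tau> (Suc t) j) ! k) = (snd (snd (step M c) ! k) = j))"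
      using v1 v2 len [OF j] lc
      by (auto simp: vertical_def view_def cell_of_def Let_def split: prod.splits)
    show "unary M (False, Suc (Suc t) = length Y, Y ! j) (\<tau> (Suc t) j)"
      using tilingD(2) [OF \<tau> Suc.prems j] by (simp add: tile_env_def)
  next
    fix j assume "Suc j < length Y"
    then show "horizontal M (False, Suc (Suc t) = length Y, Y ! j) (\<tau> (Suc t) j) (\<tau> (Suc t) (Suc j))"
      using tilingD(3) [OF \<tau> Suc.prems, of j] by (simp add: tile_env_def)
  next
    fix k assume "k < K"
    then show "snd (snd (step M c) ! k) < length Y"
      using head_init [of k "Suc t" y] Suc.prems unfolding c' by simp
  qed (use Y1 Y5 ok_step [OF ok] in auto)
qed

text \<open>The last row lies beyond time \<open>r\<close>, and halting configurations do not
  change, so it shows the output whatever the halting time is. The certificate is what a tiling puts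
  into the cells with label 4 of row 0.\<close>

lemma accepts_iff_tiling:
  assumes V: "\<And>u. length u \<le> p \<Longrightarrow> \<exists>t \<le> r. computes_in M (string_pair x u) (V (string_pair x u)) t"
  shows "(\<exists>u. length u \<le> p \<and> V (string_pair x u) = [True]) \<longleftrightarrow>
    (\<exists>\<tau>. tiling (tile_set M) (unary M) (horizontal M) (vertical M) (cell_labels x p r) \<tau>)"
proof
  define Y where "Y = cell_labels x p r"
  note Y1 = cell_labels_eq_1 [of _ x p r, folded Y_def] and Y5 = cell_labels_eq_5 [of _ x p r, folded Y_def]
  note Yn = cell_labels_nth [of _ x p r, folded Y_def]
  define b where "b = length (encode_bits x)"
  have m: "length Y = b + p + r + 2" by (simp add: Y_def length_cell_labels b_def)
  then have m0: "0 < length Y" by simp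
  have b1: "1 \<le> b" by (simp add: b_def encode_bits_def)
  have last: "fst (snd ((step M ^^ (length Y - 1)) (init_config M (string_pair x u))) ! 1) = tape_contents (V (string_pair x u))"
    if u: "length u \<le> p" for u
  proof -
    obtain t where t: "t \<le> r" "computes_in M (string_pair x u) (V (string_pair x u)) t" using V [OF u] by blast
    then have h: "fst ((step M ^^ t) (init_config M (string_pair x u))) = halt M"
      by (simp add: computes_in_def Let_def)
    have "length Y - 1 = t + (length Y - 1 - t)" using t m by simp
    then have "(step M ^^ (length Y - 1)) (init_config M (string_pair x u)) = (step M ^^ t) (init_config M (string_pair x u))"
      using step_halt_pow [OF h] step_pow_add by metis
    then show ?thesis using t by (simp add: computes_in_def Let_def)
  qed
  {
    assume "\<exists>u. length u \<le> p \<and> V (string_pair x u) = [True]"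
    then obtain u where u: "length u \<le> p" "V (string_pair x u) = [True]" by blast
    define y where "y = string_pair x u"
    define c where "c = (\<lambda>t. (step M ^^ t) (init_config M y))"
    have ok: "ok_config (c t)" for t by (simp add: c_def ok_steps)
    have len: "length (snd (c t)) = K" for t using ok [of t] by (simp add: ok_config_def)
    have "tiling (tile_set M) (unary M) (horizontal M) (vertical M) Y (\<lambda>t. view (c t))"
      unfolding tiling_def
    proof (intro allI impI conjI)
      fix t j assume t: "t < length Y" and j: "j < length Y"
      show "view (c t) j \<in> tile_set M" by (rule view_in_tile_set) (rule ok)
      have hd: "snd tp < length Y" if "tp \<in> set (snd (c t))" for tp
        using that head_init [of _ t y] t len [of t] by (force simp: in_set_conv_nth c_def)
      have a: "label_allows (Y ! j) (tape_contents y j)"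
        using Yn [OF j] u j unfolding y_def string_pair_def tape_contents_def label_allows_def b_def m
        by (auto simp: nth_append bit_symbol_def)
      have "unary M (t = 0, Suc t = length Y, Y ! j) (view (c 0) j)" if "t = 0"
        using a Y1 [OF j] that unfolding unary_def view_def
        by (auto simp: cell_of_def c_def init_config_def nth_Cons' tape_contents_def [of "[]"])
      moreover have "unary M (False, Suc t = length Y, Y ! j) (view (c t) j)"
        using Y1 [OF j] Y5 [OF j] hd unfolding unary_def view_def
        by (auto simp: cell_of_def dest!: hd)
      ultimately show "unary M (tile_env Y t j) (view (c t) j)"
        unfolding tile_env_def by (cases "t = 0") auto
      show "vertical M (tile_env Y t j) (view (c t) j) (view (c (Suc t)) j)" if "Suc t < length Y"
        using vertical_view [OF ok [of t], of "Y ! j" j] Y1 [OF j] by (simp add: tile_env_def c_def)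
      show "horizontal M (tile_env Y t j) (view (c t) j) (view (c t) (Suc j))" if "Suc j < length Y"
        unfolding tile_env_def
      proof (rule horizontal_view [OF ok])
        assume "t = 0" "fst (snd (c t) ! 0) j = 0"
        then show "fst (snd (c t) ! 0) (Suc j) = 0"
          by (auto simp: c_def init_config_def tape_contents_def bit_symbol_def split: if_splits)
      next
        assume "Suc t = length Y"
        then have "t = length Y - 1" by simp
        then have "fst (snd (c t) ! 1) = tape_contents [True]"
          using last [OF u(1)] u(2) unfolding c_def y_def by simp
        then show "(fst (snd (c t) ! 1) j = 1 \<longrightarrow> fst (snd (c t) ! 1) (Suc j) = 3) \<and>
               (fst (snd (c t) ! 1) j = 3 \<longrightarrow> fst (snd (c t) ! 1) (Suc j) = 0)"
          by (auto simp: tape_contents_def bit_symbol_def)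
      qed
    qed
    then show "\<exists>\<tau>. tiling (tile_set M) (unary M) (horizontal M) (vertical M) (cell_labels x p r) \<tau>"
      unfolding Y_def by blast
  }
  {
    assume "\<exists>\<tau>. tiling (tile_set M) (unary M) (horizontal M) (vertical M) (cell_labels x p r) \<tau>"
    then obtain \<tau> where \<tau>: "tiling (tile_set M) (unary M) (horizontal M) (vertical M) Y \<tau>"
      unfolding Y_def by blast
    define s where "s = (\<lambda>j. sym (snd (\<tau> 0 j) ! 0))"
    have s_allowed: "label_allows (Y ! j) (s j)" if "j < length Y" for j
      using tilingD(2) [OF \<tau> m0 that] that K2
      by (auto simp: tile_env_def unary_def s_def split: prod.splits)
    have s_mono: "s (Suc j) = 0" if "Suc j < length Y" "s j = 0" for j
    proof -
      have "horizontal M (tile_env Y 0 j) (\<tau> 0 j) (\<tau> 0 (Suc j))"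
        using tilingD(3) [OF \<tau> m0, of j] that by simp
      then show ?thesis using that by (auto simp: tile_env_def horizontal_def s_def split: prod.splits)
    qed
    \<comment> \<open>The length of the certificate: the number of certificate cells before the
      first blank, at most \<open>p\<close>.\<close>
    define l where "l = (LEAST i. i = p \<or> s (Suc (b + i)) = 0)"
    have l: "l \<le> p" "l = p \<or> s (Suc (b + l)) = 0"
      unfolding l_def using Least_le [of "\<lambda>i. i = p \<or> s (Suc (b + i)) = 0" p]
        LeastI [of "\<lambda>i. i = p \<or> s (Suc (b + i)) = 0" p] by simp_all
    have l_less: "s (Suc (b + i)) \<noteq> 0" if "i < l" for i
      using not_less_Least that unfolding l_def by blast
    define u where "u = map (\<lambda>i. s (Suc (b + i)) = 3) [0..<l]"
    define y where "y = string_pair x u"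
    have ly: "length y = b + l" by (simp add: y_def string_pair_def b_def u_def)
    have blank: "s (Suc (b + l) + i) = 0" if "Suc (b + l) + i < length Y" for i
      using that
    proof (induction i)
      case 0
      show ?case
      proof (cases "l = p")
        case True
        then show ?thesis using s_allowed [of "Suc (b + p)"] Yn [of "Suc (b + p)"] m
          by (auto simp: label_allows_def b_def split: if_splits)
      qed (use l in auto)
    qed (use s_mono in auto)
    have y: "s j = tape_contents y j" if j: "j < length Y" for j
    proof -
      consider "j = 0" | "1 \<le> j" "j \<le> b" | i where "j = Suc (b + i)" "i < l" | i where "j = Suc (b + l) + i"
        by (metis One_nat_def Suc_leI add_Suc bot_nat_0.not_eq_extremum le_Suc_ex nat_add_left_cancel_less not_less_eq_eq not_le)
      then show ?thesis
      proof cases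
        case 1
        then show ?thesis using s_allowed [OF j] Yn [OF j] by (simp add: label_allows_def tape_contents_def)
      next
        case 2
        then have "s j = bit_symbol (encode_bits x ! (j - 1))"
          using s_allowed [OF j] Yn [OF j] by (auto simp: label_allows_def b_def bit_symbol_def split: if_splits)
        moreover have "y ! (j - 1) = encode_bits x ! (j - 1)"
          using 2 by (auto simp: y_def string_pair_def nth_append b_def)
        ultimately show ?thesis using 2 ly by (simp add: tape_contents_def)
      next
        case 3
        then have "s j \<in> {0, 2, 3}"
          using s_allowed [OF j] Yn [OF j] l by (auto simp: label_allows_def b_def)
        moreover have "y ! (j - 1) = (s j = 3)"
          using 3 by (auto simp: y_def string_pair_def nth_append b_def u_def)
        ultimately show ?thesis using 3 ly l_less [of i] by (auto simp: tape_contents_def bit_symbol_def)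
      next
        case 4
        then show ?thesis using blank [of i] j ly by (simp add: tape_contents_def)
      qed
    qed
    have u: "length u \<le> p" using l by (simp add: u_def)
    define c where "c = (step M ^^ (length Y - 1)) (init_config M y)"
    have \<tau>c: "\<tau> (length Y - 1) j = view c j" if "j < length Y" for j
      using tiling_imp_view [OF Y_def \<tau> y [unfolded s_def], of "length Y - 1"] that m by (simp add: c_def)
    have "ok_config c" by (simp add: c_def ok_steps)
    then have lc: "length (snd c) = K" by (simp add: ok_config_def)
    have c1: "fst (snd c ! 1) = tape_contents (V y)"
      using last [OF u] by (simp add: c_def y_def)
    have "horizontal M (tile_env Y (length Y - 1) j) (view c j) (view c (Suc j))" if "Suc j < length Y" for j
    proof -
      have "horizontal M (tile_env Y (length Y - 1) j) (\<tau> (length Y - 1) j) (\<tau> (length Y - 1) (Suc j))"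
        using tilingD(3) [OF \<tau>, of "length Y - 1" j] that m by simp
      then show ?thesis using that \<tau>c by simp
    qed
    then have fin: "(tape_contents (V y) j = 1 \<longrightarrow> tape_contents (V y) (Suc j) = 3) \<and>
        (tape_contents (V y) j = 3 \<longrightarrow> tape_contents (V y) (Suc j) = 0)" if "Suc j < length Y" for j
      using that m K2 lc c1 by (fastforce simp: horizontal_def tile_env_def view_def cell_of_def)
    have "tape_contents (V y) 1 = 3" using fin [of 0] m by (simp add: tape_contents_def)
    moreover from this have "tape_contents (V y) 2 = 0" using fin [of 1] m b1 by (simp add: numeral_2_eq_2)
    ultimately have "V y = [True]"
      by (cases "V y"; cases "tl (V y)") (auto simp: tape_contents_def bit_symbol_def split: if_splits)
    then show "\<exists>u. length u \<le> p \<and> V (string_pair x u) = [True]" using u y_def by blast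
  }
qed

end

lemma NP_tiling:
  assumes "A \<in> NP"
  shows "\<exists>(n :: nat) U H V (p :: nat poly) (r :: nat poly). \<forall>x. x \<in> A \<longleftrightarrow>
    (\<exists>\<tau>. tiling {..<n} U H V (cell_labels x (poly p (length x)) (poly r (length x))) \<tau>)"
proof -
  obtain W and p :: "nat poly" where W: "polytime W"
    "\<And>x. x \<in> A \<longleftrightarrow> (\<exists>u. length u \<le> poly p (length x) \<and> W (string_pair x u) = [True])"
    using assms unfolding NP_def by blast
  obtain M and q :: "nat poly" where M: "wf_tm M" "\<And>x. \<exists>t \<le> poly q (length x). computes_in M x (W x) t"
    using W(1) unfolding polytime_def by blast
  interpret verifier M by unfold_locales (rule M)
  \<comment> \<open>\<open>encode_bits x\<close> has length 1 + 2 n for an input of length n, the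
    certificate adds at most p(n), and \<open>q\<close> is the time bound of the verifier.\<close>
  define r where "r = pcompose q ([:1, 2:] + p)"
  have enc: "length (encode_bits x) = 2 * length x + 1" for x
    by (induction x) (auto simp: encode_bits_def)
  have "\<exists>t \<le> poly r (length x). computes_in M (string_pair x u) (W (string_pair x u)) t"
    if u: "length u \<le> poly p (length x)" for x u
  proof -
    have "length (string_pair x u) \<le> poly ([:1, 2:] + p) (length x)"
      using u enc [of x] by (simp add: string_pair_def)
    then have "poly q (length (string_pair x u)) \<le> poly r (length x)"
      unfolding r_def poly_pcompose by (rule poly_nat_mono)
    then show ?thesis using M(2) order.trans by blast
  qed
  then have "x \<in> A \<longleftrightarrow> (\<exists>\<tau>. tiling (tile_set M) (unary M) (horizontal M) (vertical M)
      (cell_labels x (poly p (length x)) (poly r (length x))) \<tau>)" for x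
    unfolding W(2) by (rule accepts_iff_tiling)
  then show ?thesis
    using tiling_number_tiles [OF finite_tile_set [OF M(1)], of "unary M" "horizontal M" "vertical M"] by metis
qed

section \<open>Instances with one neighbour and budget zero\<close>

lemma arg_max_mem:
  fixes f :: "'a \<Rightarrow> real"
  assumes "finite A" "A \<noteq> {}"
  shows "(ARG_MAX f x. x \<in> A) \<in> A"
proof -
  have "\<exists>x. is_arg_max f (\<lambda>x. x \<in> A) x"
    using ex_is_arg_min_if_finite [OF assms, of "\<lambda>x. - f x"]
    by (auto simp: is_arg_max_def is_arg_min_def)
  then have "is_arg_max f (\<lambda>x. x \<in> A) (ARG_MAX f x. x \<in> A)"
    unfolding arg_max_def by (rule someI_ex)
  then show ?thesis by (simp add: is_arg_max_def)
qed

lemma arg_min_mem: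
  fixes f :: "'a \<Rightarrow> real"
  assumes "finite A" "A \<noteq> {}"
  shows "(ARG_MIN f x. x \<in> A) \<in> A"
proof -
  have "is_arg_min f (\<lambda>x. x \<in> A) (ARG_MIN f x. x \<in> A)"
    unfolding arg_min_def using ex_is_arg_min_if_finite [OF assms, of f] by (rule someI_ex)
  then show ?thesis by (simp add: is_arg_min_def)
qed

definition nearest :: "metric_family \<Rightarrow> fsp \<Rightarrow> nat set \<Rightarrow> nat \<Rightarrow> nat \<Rightarrow> bool" where
  "nearest dI I S i j \<longleftrightarrow> j < num_points I \<and> j \<noteq> i \<and>
     (\<forall>j'<num_points I. j' \<noteq> i \<longrightarrow> inst_dist dI I S i j \<le> inst_dist dI I S i j')"

text \<open>Fewer than one strict neighbour means none, so the threshold is the least distance. Both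
  rules then pick a member of the same finite nonempty set of singletons, and only membership is
  used.\<close>

lemma one_neighbour:
  assumes "admissible_metrics dI" "valid_fsp I" "nbh_size I = 1" "i < num_points I"
  shows "\<exists>j. nbhd_opt dI dX I i S = {j} \<and> nearest dI I S i j"
    and "\<exists>j. nbhd_pess dI dX I i S = {j} \<and> nearest dI I S i j"
proof -
  define e where "e = threshold dI I i S"
  have th: "is_threshold dI I i S e"
    unfolding e_def threshold_def by (rule theI') (rule threshold_ex1 [OF assms(1,2,4)])
  have fin: "finite (strict_nbrs dI I e i S)" "finite (border_nbrs dI I e i S)"
    by (auto simp: strict_nbrs_def border_nbrs_def)
  then have s: "strict_nbrs dI I e i S = {}" using th assms(3) by (simp add: is_threshold_def)
  then have tb: "tie_breaks dI I i S = {J. J \<subseteq> border_nbrs dI I e i S \<and> card J = 1}"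
    by (simp add: tie_breaks_def e_def [symmetric] assms(3))
  have "1 \<le> card (border_nbrs dI I e i S)"
    using th s assms(3) by (simp add: is_threshold_def nbrs_def)
  then obtain b where "b \<in> border_nbrs dI I e i S" by fastforce
  then have "{b} \<in> tie_breaks dI I i S" by (simp add: tb)
  then have ne: "tie_breaks dI I i S \<noteq> {}" by blast
  have "finite (tie_breaks dI I i S)" unfolding tb using fin(2) by simp
  note mem = arg_min_mem [OF this ne] arg_max_mem [OF this ne]
  have *: "\<exists>j. J = {j} \<and> nearest dI I S i j" if "J \<in> tie_breaks dI I i S" for J
  proof -
    from that have "card J = 1" by (simp add: tb)
    then obtain j where j: "J = {j}" by (rule card_1_singletonE)
    then have j': "j < num_points I" "j \<noteq> i" "inst_dist dI I S i j = e"
      using that by (auto simp: tb border_nbrs_def)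
    have "inst_dist dI I S i j \<le> inst_dist dI I S i k" if "k < num_points I" "k \<noteq> i" for k
    proof (rule ccontr)
      assume "\<not> ?thesis"
      then have "k \<in> strict_nbrs dI I e i S" using that j' by (simp add: strict_nbrs_def)
      then show False using s by blast
    qed
    then show ?thesis using j j' by (simp add: nearest_def)
  qed
  show "\<exists>j. nbhd_opt dI dX I i S = {j} \<and> nearest dI I S i j"
    unfolding nbhd_opt_def e_def [symmetric] s using * [OF mem(1)] by simp
  show "\<exists>j. nbhd_pess dI dX I i S = {j} \<and> nearest dI I S i j"
    unfolding nbhd_pess_def e_def [symmetric] s using * [OF mem(2)] by simp
qed

text \<open>This is where the two versions merge: both values arise from some choice
  \<open>\<nu>\<close> of nearest points, and what follows holds for every such choice.\<close>

lemma value_cases: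
  assumes "admissible_metrics dI" "valid_fsp I" "nbh_size I = 1"
    and "val = value_opt dI dX I S \<or> val = value_pess dI dX I S"
  shows "\<exists>\<nu>. val = (\<Sum>i<num_points I. sol_dist dX I i (\<nu> i)) \<and> (\<forall>i<num_points I. nearest dI I S i (\<nu> i))"
proof -
  have *: "\<exists>\<nu>. (\<Sum>i<num_points I. \<Sum>j\<in>nb i. sol_dist dX I i j) = (\<Sum>i<num_points I. sol_dist dX I i (\<nu> i))
      \<and> (\<forall>i<num_points I. nearest dI I S i (\<nu> i))"
    if nb: "\<And>i. i < num_points I \<Longrightarrow> \<exists>j. nb i = {j} \<and> nearest dI I S i j" for nb
  proof -
    obtain \<nu> where "\<And>i. i < num_points I \<Longrightarrow> nb i = {\<nu> i} \<and> nearest dI I S i (\<nu> i)"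
      using nb by metis
    then show ?thesis by (intro exI [of _ \<nu>]) simp
  qed
  from assms(4) show ?thesis
  proof
    assume "val = value_opt dI dX I S"
    then show ?thesis unfolding value_opt_def
      by (simp only:) (rule *, rule one_neighbour(1) [OF assms(1-3)])
  next
    assume "val = value_pess dI dX I S"
    then show ?thesis unfolding value_pess_def
      by (simp only:) (rule *, rule one_neighbour(2) [OF assms(1-3)])
  qed
qed

definition mk_fsp :: "nat \<Rightarrow> nat \<Rightarrow> nat \<Rightarrow> ('x \<Rightarrow> nat list) \<Rightarrow> ('x \<Rightarrow> nat) \<Rightarrow> 'x list \<Rightarrow> fsp" where
  "mk_fsp cI cX L v s D =
     \<lparr>points = map (\<lambda>x. (map of_nat (v x), [of_nat (s x)])) D, inst_metric = cI, sol_metric = cX,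
      nbh_size = 1, feature_bound = L, budget = 0\<rparr>"

context
  fixes dI dX :: metric_family and cI cX L P z :: nat and v :: "'x \<Rightarrow> nat list" and s :: "'x \<Rightarrow> nat"
    and D :: "'x list" and a b :: 'x and I
  assumes dI: "admissible_metrics dI" and dX: "admissible_metrics dX"
    and l1I: "\<And>n x y. length x = n \<Longrightarrow> length y = n \<Longrightarrow> dI cI n x y = l1_dist n x y"
    and l1X: "\<And>n x y. length x = n \<Longrightarrow> length y = n \<Longrightarrow> dX cX n x y = l1_dist n x y"
    and D: "distinct D" and v: "\<And>x. x \<in> set D \<Longrightarrow> length (v x) = P"
    and a: "a \<in> set D" "v a = replicate P 0" "s a = 0"
    and b: "b \<in> set D" "b \<noteq> a" "s b = 0"
    and zero: "\<And>x. x \<in> set D \<Longrightarrow> x \<noteq> a \<Longrightarrow> s x = 0 \<Longrightarrow> v x = replicate P 4"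
    and dup: "\<And>x. x \<in> set D \<Longrightarrow> x \<noteq> a \<Longrightarrow> \<exists>y\<in>set D. y \<noteq> x \<and> v y = v x \<and> s y = s x"
    and z: "z < P" "\<And>x. x \<in> set D \<Longrightarrow> s x \<noteq> 0 \<Longrightarrow> v x ! z \<noteq> 0 \<and> v x ! z \<noteq> 4"
    and s01: "\<And>x. x \<in> set D \<Longrightarrow> s x \<le> 1"
    and I: "I = mk_fsp cI cX L v s D"
begin

lemma mk_fsp_sel [simp]:
  "num_points I = length D" "inst_metric I = cI" "sol_metric I = cX" "nbh_size I = 1"
  "feature_bound I = L" "budget I = 0"
  by (auto simp: num_points_def I mk_fsp_def)

lemma mk_fsp_dims: "inst_dim I = P" "sol_dim I = 1"
proof -
  obtain x D' where D': "D = x # D'" using a by (cases D) auto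
  then show "inst_dim I = P" "sol_dim I = 1" using v [of x] by (auto simp: inst_dim_def sol_dim_def I mk_fsp_def)
qed

lemma mk_fsp_valid: "valid_fsp I"
proof -
  have "card {a, b} \<le> card (set D)" using a b by (intro card_mono) auto
  then have "2 \<le> length D" using b(2) card_length [of D] by simp
  then show ?thesis
    unfolding valid_fsp_def mk_fsp_dims mk_fsp_sel using v by (auto simp: I mk_fsp_def)
qed

lemma mk_fsp_inst_dist:
  assumes "i < length D" "j < length D" "S \<subseteq> {..<P}"
  shows "inst_dist dI I S i j = (\<Sum>f\<in>S. \<bar>real (v (D ! i) ! f) - real (v (D ! j) ! f)\<bar>)"
proof -
  have vec: "inst_vec I i = map real (v (D ! i))" if "i < length D" for i
    using that by (simp add: inst_vec_def I mk_fsp_def comp_def)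
  have len: "length (v (D ! i)) = P" if "i < length D" for i using v that by simp
  have "inst_dist dI I S i j = l1_dist P (project S (inst_vec I i)) (project S (inst_vec I j))"
    unfolding inst_dist_def mk_fsp_sel mk_fsp_dims
    by (rule l1I) (use assms vec len in \<open>auto simp: project_def\<close>)
  also have "\<dots> = (\<Sum>f\<in>S. \<bar>inst_vec I i ! f - inst_vec I j ! f\<bar>)"
    by (rule l1_dist_project) (use assms vec len in auto)
  also have "\<dots> = (\<Sum>f\<in>S. \<bar>real (v (D ! i) ! f) - real (v (D ! j) ! f)\<bar>)"
    by (rule sum.cong) (use assms vec len in auto)
  finally show ?thesis .
qed

lemma mk_fsp_sol_dist:
  assumes "i < length D" "j < length D"
  shows "sol_dist dX I i j = \<bar>real (s (D ! i)) - real (s (D ! j))\<bar>"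
proof -
  have vec: "sol_vec I i = [real (s (D ! i))]" if "i < length D" for i
    using that by (simp add: sol_vec_def I mk_fsp_def)
  show ?thesis
    unfolding sol_dist_def mk_fsp_sel mk_fsp_dims using assms by (simp add: l1X vec l1_dist_def)
qed

lemma sum_replicate: "v x = replicate P c \<Longrightarrow> S \<subseteq> {..<P} \<Longrightarrow> (\<Sum>f\<in>S. real (v x ! f)) = c * real (card S)"
  by (subst sum.cong [of S S _ "\<lambda>_. real c"]) auto

text \<open>All terms vanish, so the neighbour of the anchor has solution 0 and thus distance
  \<open>4 * card S\<close>; the point \<open>x\<close> cannot be nearer. The inequality is weak
  because a tie may have been broken either way.\<close>

lemma value_le_0_imp:
  assumes val: "val = value_opt dI dX I S \<or> val = value_pess dI dX I S" and "val \<le> 0"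
    and S: "S \<subseteq> {..<P}" and x: "x \<in> set D" "s x \<noteq> 0"
  shows "4 * card S \<le> (\<Sum>f\<in>S. v x ! f)"
proof -
  obtain \<nu> where \<nu>: "val = (\<Sum>i<length D. sol_dist dX I i (\<nu> i))" "\<forall>i<length D. nearest dI I S i (\<nu> i)"
    using value_cases [OF dI mk_fsp_valid _ val] by auto
  have lt: "\<nu> i < length D" "\<nu> i \<noteq> i" if "i < length D" for i
    using \<nu>(2) that by (auto simp: nearest_def)
  have nn: "0 \<le> sol_dist dX I i (\<nu> i)" if "i < length D" for i
    using that lt by (simp add: mk_fsp_sol_dist)
  obtain i where i: "i < length D" "D ! i = a" using a by (auto simp: in_set_conv_nth)
  obtain k where k: "k < length D" "D ! k = x" using x by (auto simp: in_set_conv_nth)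
  have "(\<Sum>i<length D. sol_dist dX I i (\<nu> i)) = 0"
    using \<open>val \<le> 0\<close> \<nu>(1) sum_nonneg [of "{..<length D}" "\<lambda>i. sol_dist dX I i (\<nu> i)"] nn by auto
  then have "sol_dist dX I i (\<nu> i) = 0"
    using sum_nonneg_eq_0_iff [of "{..<length D}" "\<lambda>i. sol_dist dX I i (\<nu> i)"] nn i by auto
  then have s0: "s (D ! \<nu> i) = 0" using i lt a by (simp add: mk_fsp_sol_dist)
  have "D ! \<nu> i \<noteq> a" using i lt D by (metis nth_eq_iff_index_eq)
  then have v4: "v (D ! \<nu> i) = replicate P 4" using zero s0 lt i by simp
  have "k \<noteq> i" using k i x a by auto
  then have "inst_dist dI I S i (\<nu> i) \<le> inst_dist dI I S i k"
    using \<nu>(2) i k by (simp add: nearest_def)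
  moreover have "inst_dist dI I S i j = (\<Sum>f\<in>S. real (v (D ! j) ! f))" if "j < length D" for j
    unfolding mk_fsp_inst_dist [OF i(1) that S] using a(2) i S by (intro sum.cong) auto
  ultimately have "(\<Sum>f\<in>S. real (v (D ! \<nu> i) ! f)) \<le> (\<Sum>f\<in>S. real (v (D ! k) ! f))"
    using lt i k by simp
  then have "real (4 * card S) \<le> real (\<Sum>f\<in>S. v x ! f)"
    unfolding sum_replicate [OF v4 S] k(2) by simp
  then show ?thesis by linarith
qed

text \<open>For the anchor, every point with solution 1 is strictly farther away than
  \<open>b\<close>. Any other point has a duplicate, so its neighbour is at distance 0 too and
  agrees with it in the selected coordinate \<open>z\<close>, which separates the solutions.\<close>

lemma value_le_0I:
  assumes val: "val = value_opt dI dX I S \<or> val = value_pess dI dX I S"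
    and S: "S \<subseteq> {..<P}" "z \<in> S" and lt4: "\<And>x. x \<in> set D \<Longrightarrow> s x \<noteq> 0 \<Longrightarrow> 4 * card S < (\<Sum>f\<in>S. v x ! f)"
  shows "val \<le> 0"
proof -
  obtain \<nu> where \<nu>: "val = (\<Sum>i<length D. sol_dist dX I i (\<nu> i))" "\<forall>i<length D. nearest dI I S i (\<nu> i)"
    using value_cases [OF dI mk_fsp_valid _ val] by auto
  have fS: "finite S" using S finite_subset by blast
  have "s (D ! \<nu> i) = s (D ! i)" if i: "i < length D" for i
  proof -
    have le: "inst_dist dI I S i (\<nu> i) \<le> inst_dist dI I S i j" if "j < length D" "j \<noteq> i" for j
      using \<nu>(2) i that by (auto simp: nearest_def)
    have n: "\<nu> i < length D" "\<nu> i \<noteq> i"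
      using \<nu>(2) i by (auto simp: nearest_def)
    show ?thesis
    proof (cases "D ! i = a")
      case True
      obtain j where j: "j < length D" "D ! j = b" using b by (auto simp: in_set_conv_nth)
      have "j \<noteq> i" using j True b by auto
      moreover have "inst_dist dI I S i j = (\<Sum>f\<in>S. real (v (D ! j) ! f))" if "j < length D" for j
        unfolding mk_fsp_inst_dist [OF i that S(1)] using a(2) True S by (intro sum.cong) auto
      ultimately have "(\<Sum>f\<in>S. real (v (D ! \<nu> i) ! f)) \<le> (\<Sum>f\<in>S. real (v b ! f))"
        using le [of j] n j by simp
      then have "(\<Sum>f\<in>S. real (v (D ! \<nu> i) ! f)) \<le> real (4 * card S)"
        using sum_replicate [OF zero [OF b] S(1)] by simp
      then have "(\<Sum>f\<in>S. v (D ! \<nu> i) ! f) \<le> 4 * card S"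
        by (metis of_nat_le_iff of_nat_sum)
      then have "s (D ! \<nu> i) = 0" using lt4 [of "D ! \<nu> i"] n by (metis leD nth_mem)
      then show ?thesis using True a by simp
    next
      case False
      obtain y where y: "y \<in> set D" "y \<noteq> D ! i" "v y = v (D ! i)" "s y = s (D ! i)"
        using dup [of "D ! i"] i False by auto
      then obtain j where j: "j < length D" "D ! j = y" by (auto simp: in_set_conv_nth)
      have "inst_dist dI I S i j = 0"
        unfolding mk_fsp_inst_dist [OF i j(1) S(1)] using j y by simp
      then have "inst_dist dI I S i (\<nu> i) \<le> 0" using le [of j] j y by auto
      then have "(\<Sum>f\<in>S. \<bar>real (v (D ! i) ! f) - real (v (D ! \<nu> i) ! f)\<bar>) = 0"
        unfolding mk_fsp_inst_dist [OF i n(1) S(1)]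
        using sum_nonneg [of S "\<lambda>f. \<bar>real (v (D ! i) ! f) - real (v (D ! \<nu> i) ! f)\<bar>"] by linarith
      then have "\<bar>real (v (D ! i) ! z) - real (v (D ! \<nu> i) ! z)\<bar> = 0"
        using S(2) fS by (subst (asm) sum_nonneg_eq_0_iff) auto
      then have zz: "v (D ! \<nu> i) ! z = v (D ! i) ! z" by simp
      have cls: "s x = 0 \<longleftrightarrow> v x ! z = 0 \<or> v x ! z = 4" if "x \<in> set D" for x
        using z(1) z(2) [of x] zero [of x] that a by (cases "x = a"; cases "s x = 0") auto
      have "s (D ! \<nu> i) = 0 \<longleftrightarrow> s (D ! i) = 0" using cls [of "D ! i"] cls [of "D ! \<nu> i"] zz i n by simp
      then show ?thesis using s01 [of "D ! i"] s01 [of "D ! \<nu> i"] i n by fastforce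
    qed
  qed
  moreover have "\<nu> i < length D" if "i < length D" for i using \<nu>(2) that by (auto simp: nearest_def)
  ultimately have "val = 0" unfolding \<nu>(1) by (intro sum.neutral) (auto simp: mk_fsp_sol_dist)
  then show ?thesis by simp
qed

lemma mk_fsp_feasible: "feasible I S \<longleftrightarrow> S \<subseteq> {..<P} \<and> S \<noteq> {} \<and> card S \<le> L"
  by (simp add: feasible_def mk_fsp_dims)

end

section \<open>Tilings as instances of feature selection\<close>

datatype kind = Anchor | Ref | Dom | Imp nat | Single nat | Hor nat nat | Ver nat nat

definition kinds :: "nat \<Rightarrow> kind list" where
  "kinds n = [Anchor, Ref, Dom] @ map Imp [0..<n] @ map Single [0..<n] @
     map (\<lambda>(a, b). Hor a b) (List.product [0..<n] [0..<n]) @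
     map (\<lambda>(a, b). Ver a b) (List.product [0..<n] [0..<n])"

lemma distinct_kinds: "distinct (kinds n)"
  by (auto simp: kinds_def distinct_map distinct_product inj_on_def)

lemma set_kinds:
  "set (kinds n) = {Anchor, Ref, Dom} \<union> Imp ` {..<n} \<union> Single ` {..<n} \<union>
     (\<lambda>(a, b). Hor a b) ` ({..<n} \<times> {..<n}) \<union> (\<lambda>(a, b). Ver a b) ` ({..<n} \<times> {..<n})"
  by (auto simp: kinds_def lessThan_atLeast0)

definition tagged_kinds :: "nat \<Rightarrow> (kind \<times> bool) list" where
  "tagged_kinds n = List.product (kinds n) [False, True]"

text \<open>
  The feature with coordinates \<open>(t', j', s)\<close> says that tile \<open>s\<close> is placed at time \<open>t'\<close> in cell \<open>j'\<close>;
  the last feature is the additional one, which a row of kind \<open>Imp\<close> enforces as soon as tile \<open>a\<close> is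
  selected at \<open>(t, j)\<close>. Rows of kind \<open>Dom\<close> demand some tile at \<open>(t, j)\<close>, and the remaining ones
  exclude a forbidden tile or a forbidden pair of tiles. The Boolean arguments of \<open>hit\<close> are
  \<open>t' = t\<close>, \<open>t' = Suc t\<close>, \<open>j' = j\<close>, \<open>j' = Suc j\<close>.
\<close>

context
  fixes U :: "env \<Rightarrow> nat \<Rightarrow> bool" and H V :: "env \<Rightarrow> nat \<Rightarrow> nat \<Rightarrow> bool"
begin

fun hit :: "env \<Rightarrow> kind \<Rightarrow> bool \<Rightarrow> bool \<Rightarrow> bool \<Rightarrow> bool \<Rightarrow> nat \<Rightarrow> bool" where
  "hit e Dom et st ej sj s \<longleftrightarrow> et \<and> ej"
| "hit e (Imp a) et st ej sj s \<longleftrightarrow> et \<and> ej \<and> s = a"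
| "hit e (Single a) et st ej sj s \<longleftrightarrow> et \<and> ej \<and> s = a \<and> \<not> U e a"
| "hit e (Hor a b) et st ej sj s \<longleftrightarrow> \<not> H e a b \<and> et \<and> (ej \<and> s = a \<or> sj \<and> s = b)"
| "hit e (Ver a b) et st ej sj s \<longleftrightarrow> \<not> V e a b \<and> ej \<and> (et \<and> s = a \<or> st \<and> s = b)"
| "hit e _ et st ej sj s \<longleftrightarrow> False"

text \<open>Position (0, 0) expressed through the environment, since the printer sees letters
  instead of indices.\<close>

definition is_anchor :: "env \<Rightarrow> kind \<times> bool \<Rightarrow> bool" where
  "is_anchor e \<kappa> \<longleftrightarrow> \<kappa> = (Anchor, False) \<and> fst e \<and> snd (snd e) = 1"

definition weight :: "env \<Rightarrow> kind \<times> bool \<Rightarrow> bool \<Rightarrow> bool \<Rightarrow> bool \<Rightarrow> bool \<Rightarrow> nat \<Rightarrow> nat" where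
  "weight e \<kappa> et st ej sj s =
     (if is_anchor e \<kappa> then 0
      else if hit e (fst \<kappa>) et st ej sj s then (if fst \<kappa> = Dom then 6 else 2) else 4)"

text \<open>The deviations from 4 are -1 for \<open>Dom\<close>, 1 for \<open>Single\<close>, and 3
  for \<open>Imp\<close>, \<open>Hor\<close> and \<open>Ver\<close>. A row of kind
  \<open>Imp\<close> concerns a single tile feature: if that is selected, the sum is 3 - 2 with the
  additional feature but -2 without it.\<close>

definition last_weight :: "env \<Rightarrow> kind \<times> bool \<Rightarrow> nat" where
  "last_weight e \<kappa> =
     (if is_anchor e \<kappa> then 0
      else case fst \<kappa> of Anchor \<Rightarrow> 4 | Ref \<Rightarrow> 4 | Dom \<Rightarrow> 3 | Single _ \<Rightarrow> 5 | _ \<Rightarrow> 7)"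

definition sol_val :: "kind \<times> bool \<Rightarrow> nat" where
  "sol_val \<kappa> = (if fst \<kappa> \<in> {Anchor, Ref} then 0 else 1)"

context
  fixes n m :: nat and Y :: "nat list"
begin

definition feats :: "(nat \<times> nat \<times> nat) list" where
  "feats = List.product [0..<m] (List.product [0..<m] [0..<n])"

definition tags :: "(nat \<times> nat \<times> kind \<times> bool) list" where
  "tags = List.product [0..<m] (List.product [0..<m] (tagged_kinds n))"

definition feat_weight :: "nat \<times> nat \<times> kind \<times> bool \<Rightarrow> nat \<times> nat \<times> nat \<Rightarrow> nat" where
  "feat_weight x y = (case (x, y) of ((t, j, \<kappa>), (t', j', s)) \<Rightarrow>
     weight (tile_env Y t j) \<kappa> (t' = t) (t' = Suc t) (j' = j) (j' = Suc j) s)"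

definition point_vec :: "nat \<times> nat \<times> kind \<times> bool \<Rightarrow> nat list" where
  "point_vec x = map (feat_weight x) feats @ [case x of (t, j, \<kappa>) \<Rightarrow> last_weight (tile_env Y t j) \<kappa>]"

definition sol_of :: "nat \<times> nat \<times> kind \<times> bool \<Rightarrow> nat" where
  "sol_of x = sol_val (snd (snd x))"

definition feat_hit :: "nat \<times> nat \<times> kind \<times> bool \<Rightarrow> nat \<times> nat \<times> nat \<Rightarrow> bool" where
  "feat_hit x y = (case (x, y) of ((t, j, \<kappa>), (t', j', s)) \<Rightarrow>
     hit (tile_env Y t j) (fst \<kappa>) (t' = t) (t' = Suc t) (j' = j) (j' = Suc j) s)"

lemma distinct_feats: "distinct feats"
  by (simp add: feats_def distinct_product)

lemma set_feats: "set feats = {..<m} \<times> {..<m} \<times> {..<n}"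
  by (simp add: feats_def lessThan_atLeast0)

lemma distinct_tags: "distinct tags"
  by (simp add: tags_def tagged_kinds_def distinct_product distinct_kinds)

lemma set_tags: "(t, j, \<kappa>, copy) \<in> set tags \<longleftrightarrow> t < m \<and> j < m \<and> \<kappa> \<in> set (kinds n)"
  by (auto simp: tags_def tagged_kinds_def)

abbreviation last_feat :: nat where "last_feat \<equiv> length feats"

lemma length_vec: "length (point_vec x) = Suc last_feat"
  by (simp add: point_vec_def)

text \<open>All tile features hit by a point deviate from 4 by the same amount, so only their number
  matters.\<close>

lemma sum_vec:
  assumes S: "S \<subseteq> {..<Suc last_feat}" and x: "sol_of x \<noteq> 0"
  shows "int (\<Sum>f\<in>S. point_vec x ! f) - 4 * int (card S) =
    (if fst (snd (snd x)) = Dom then 2 else - 2) * int (card {f\<in>S. f < last_feat \<and> feat_hit x (feats ! f)}) +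
    (if last_feat \<in> S then int (point_vec x ! last_feat) - 4 else 0)"
proof -
  obtain t j \<kappa> where xe: "x = (t, j, \<kappa>)" by (metis prod_cases3)
  have na: "\<not> is_anchor e \<kappa>" for e using x by (auto simp: sol_of_def sol_val_def is_anchor_def xe)
  have fS: "finite S" using S finite_subset by blast
  define c :: int where "c = (if fst \<kappa> = Dom then 2 else - 2)"
  have w: "int (point_vec x ! f) - 4 = c * of_bool (feat_hit x (feats ! f))" if "f < last_feat" for f
    using that na by (auto simp: point_vec_def nth_append feat_weight_def feat_hit_def weight_def xe c_def split: prod.splits)
  have "S = {f\<in>S. f < last_feat} \<union> (if last_feat \<in> S then {last_feat} else {})" using S by (auto simp: less_Suc_eq)
  then have "(\<Sum>f\<in>S. int (point_vec x ! f) - 4) = (\<Sum>f\<in>{f\<in>S. f < last_feat} \<union> (if last_feat \<in> S then {last_feat} else {}). int (point_vec x ! f) - 4)"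
    by simp
  also have "\<dots> = (\<Sum>f\<in>{f\<in>S. f < last_feat}. int (point_vec x ! f) - 4) + (if last_feat \<in> S then int (point_vec x ! last_feat) - 4 else 0)"
    using fS by (subst sum.union_disjoint) auto
  also have "(\<Sum>f\<in>{f\<in>S. f < last_feat}. int (point_vec x ! f) - 4) = (\<Sum>f\<in>{f\<in>S. f < last_feat}. c * of_bool (feat_hit x (feats ! f)))"
    by (rule sum.cong) (auto simp: w)
  also have "\<dots> = c * (\<Sum>f\<in>{f\<in>S. f < last_feat}. of_bool (feat_hit x (feats ! f)))"
    by (simp add: sum_distrib_left)
  also have "(\<Sum>f\<in>{f\<in>S. f < last_feat}. of_bool (feat_hit x (feats ! f))) =
      int (card ({f\<in>S. f < last_feat} \<inter> {f. feat_hit x (feats ! f)}))"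
    by (rule sum_of_bool_eq) (use fS in auto)
  also have "{f\<in>S. f < last_feat} \<inter> {f. feat_hit x (feats ! f)} = {f\<in>S. f < last_feat \<and> feat_hit x (feats ! f)}" by auto
  finally show ?thesis by (simp add: sum_subtractf c_def xe)
qed

lemma feats_nth_inject: "f < last_feat \<Longrightarrow> g < last_feat \<Longrightarrow> feats ! f = feats ! g \<longleftrightarrow> f = g"
  by (rule nth_eq_iff_index_eq [OF distinct_feats])

lemma feats_index: "t < m \<Longrightarrow> j < m \<Longrightarrow> s < n \<Longrightarrow> \<exists>f<last_feat. feats ! f = (t, j, s)"
  using set_feats by (metis SigmaI in_set_conv_nth lessThan_iff)

text \<open>The selection has one feature per cell, plus the additional one. With \<open>N\<close>
  hits, a tiling gives \<open>N\<close> at least 1 for \<open>Dom\<close>, \<open>N = 0\<close> for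
  \<open>Single\<close>, and at most one hit for the other kinds, so that all sums are
  positive.\<close>

lemma tiling_imp_selection:
  assumes m: "m = length Y" and \<tau>: "tiling {..<n} U H V Y \<tau>"
    and S: "S = {f. f < last_feat \<and> (\<exists>t j. feats ! f = (t, j, \<tau> t j))} \<union> {last_feat}"
    and x: "x \<in> set tags" "sol_of x \<noteq> 0"
  shows "4 * card S < (\<Sum>f\<in>S. point_vec x ! f)"
proof -
  obtain t j \<kappa> copy where xe: "x = (t, j, \<kappa>, copy)" by (metis prod_cases4)
  have tj: "t < m" "j < m" "\<kappa> \<in> set (kinds n)" using x by (auto simp: xe set_tags)
  note \<tau>D = tilingD [OF \<tau>, folded m]
  let ?C = "{f\<in>S. f < last_feat \<and> feat_hit x (feats ! f)}"
  have fC: "finite ?C" by (rule finite_subset [of _ "{..<last_feat}"]) auto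
  have C: "f \<in> ?C \<Longrightarrow> f < last_feat \<and> (\<exists>t' j'. feats ! f = (t', j', \<tau> t' j') \<and> t' < m \<and> j' < m \<and> feat_hit x (t', j', \<tau> t' j'))" for f
  proof -
    assume f: "f \<in> ?C"
    then obtain t' j' where f': "feats ! f = (t', j', \<tau> t' j')" "f < last_feat" by (auto simp: S)
    then have "(t', j', \<tau> t' j') \<in> set feats" by (metis nth_mem)
    then show ?thesis using f f' by (auto simp: set_feats)
  qed
  have le1: "card ?C \<le> 1" if uniq: "\<And>t' j' t'' j''. feat_hit x (t', j', \<tau> t' j') \<Longrightarrow> feat_hit x (t'', j'', \<tau> t'' j'') \<Longrightarrow>
      t' < m \<Longrightarrow> j' < m \<Longrightarrow> t'' < m \<Longrightarrow> j'' < m \<Longrightarrow> t' = t'' \<and> j' = j''"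
  proof -
    have "f = g" if "f \<in> ?C" "g \<in> ?C" for f g
    proof -
      obtain t' j' where 1: "feats ! f = (t', j', \<tau> t' j')" "t' < m" "j' < m" "feat_hit x (t', j', \<tau> t' j')" "f < last_feat"
        using C [OF \<open>f \<in> ?C\<close>] by blast
      obtain t'' j'' where 2: "feats ! g = (t'', j'', \<tau> t'' j'')" "t'' < m" "j'' < m" "feat_hit x (t'', j'', \<tau> t'' j'')" "g < last_feat"
        using C [OF \<open>g \<in> ?C\<close>] by blast
      have "t' = t'' \<and> j' = j''" using 1 2 uniq by blast
      then show "f = g" using 1 2 feats_nth_inject by metis
    qed
    then show ?thesis using fC by (simp add: card_le_Suc0_iff_eq)
  qed
  have zS: "last_feat \<in> S" by (simp add: S)
  have vz: "point_vec x ! last_feat = last_weight (tile_env Y t j) (\<kappa>, copy)" by (simp add: point_vec_def nth_append xe)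
  have na: "\<not> is_anchor e (\<kappa>, copy)" for e using x by (auto simp: sol_of_def sol_val_def is_anchor_def xe)
  define N where "N = card ?C"
  have "0 < (if \<kappa> = Dom then 2 else - 2) * int N + (int (point_vec x ! last_feat) - 4)"
  proof (cases \<kappa>)
    case Dom
    obtain f where f: "f < last_feat" "feats ! f = (t, j, \<tau> t j)"
      using feats_index [OF tj(1,2)] \<tau>D(1) [OF tj(1,2)] by auto
    then have "f \<in> ?C" by (auto simp: S feat_hit_def xe Dom)
    then have "N \<noteq> 0" unfolding N_def using fC by auto
    then show ?thesis using Dom na by (simp add: vz last_weight_def)
  next
    case (Imp a)
    have "N \<le> 1" unfolding N_def by (rule le1) (auto simp: feat_hit_def xe Imp)
    then show ?thesis using Imp na by (simp add: vz last_weight_def)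
  next
    case (Single a)
    have "?C = {}" using C \<tau>D(2) [OF tj(1,2)] by (fastforce simp: feat_hit_def xe Single)
    then have "N = 0" unfolding N_def by (simp only: card.empty)
    then show ?thesis using Single na by (simp add: vz last_weight_def)
  next
    case (Hor a b)
    have "N \<le> 1" unfolding N_def using \<tau>D(3) [OF tj(1,2)] by (intro le1) (auto simp: feat_hit_def xe Hor)
    then show ?thesis using Hor na by (simp add: vz last_weight_def)
  next
    case (Ver a b)
    have "N \<le> 1" unfolding N_def using \<tau>D(4) [OF tj(1,2)] by (intro le1) (auto simp: feat_hit_def xe Ver)
    then show ?thesis using Ver na by (simp add: vz last_weight_def)
  qed (use x in \<open>simp_all add: sol_of_def sol_val_def xe\<close>)
  then have "0 < int (\<Sum>f\<in>S. point_vec x ! f) - 4 * int (card S)"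
    using zS by (subst sum_vec) (use x in \<open>auto simp: S xe N_def\<close>)
  then show ?thesis by linarith
qed

text \<open>The weak inequalities are as good as strict ones, since the sums are odd once the
  additional feature is known to be selected. A cell may hold several selected tiles, and
  \<open>\<tau>\<close> picks any of them.\<close>

lemma selection_imp_tiling:
  assumes m: "m = length Y" and S: "S \<subseteq> {..<Suc last_feat}" "S \<noteq> {}"
    and le: "\<And>x. x \<in> set tags \<Longrightarrow> sol_of x \<noteq> 0 \<Longrightarrow> 4 * card S \<le> (\<Sum>f\<in>S. point_vec x ! f)"
  shows "\<exists>\<tau>. tiling {..<n} U H V Y \<tau>"
proof -
  have fS: "finite S" using S finite_subset by blast
  define C where "C = (\<lambda>x. {f\<in>S. f < last_feat \<and> feat_hit x (feats ! f)})"
  have fC: "finite (C x)" for x using fS by (simp add: C_def)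
  have ge: "0 \<le> (if \<kappa> = Dom then 2 else - 2) * int (card (C (t, j, \<kappa>, False))) +
      (if last_feat \<in> S then int (last_weight (tile_env Y t j) (\<kappa>, False)) - 4 else 0)"
    if "t < m" "j < m" "\<kappa> \<in> set (kinds n) - {Anchor, Ref}" for t j \<kappa>
  proof -
    have x: "(t, j, \<kappa>, False) \<in> set tags" "sol_of (t, j, \<kappa>, False) \<noteq> 0"
      using that by (auto simp: set_tags sol_of_def sol_val_def)
    have vz: "point_vec (t, j, \<kappa>, False) ! last_feat = last_weight (tile_env Y t j) (\<kappa>, False)"
      by (simp add: point_vec_def nth_append)
    have "0 \<le> int (\<Sum>f\<in>S. point_vec (t, j, \<kappa>, False) ! f) - 4 * int (card S)" using le [OF x] by linarith
    then show ?thesis unfolding sum_vec [OF S(1) x(2)] C_def by (simp only: vz fst_conv snd_conv)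
  qed
  have na: "\<not> is_anchor e (\<kappa>, copy)" if "\<kappa> \<noteq> Anchor" for e \<kappa> copy using that by (simp add: is_anchor_def)
  \<comment> \<open>Otherwise a selected tile feature would violate its own \<open>Imp\<close> row,
    whose sum is then negative.\<close>
  have zS: "last_feat \<in> S"
  proof (rule ccontr)
    assume nz: "last_feat \<notin> S"
    obtain f where "f \<in> S" using S(2) by blast
    then have f: "f \<in> S" "f < last_feat" using S(1) nz by (auto simp: less_Suc_eq)
    obtain t j s where e: "feats ! f = (t, j, s)" by (metis prod_cases3)
    then have tj: "t < m" "j < m" "s < n" using f nth_mem [of f feats] set_feats by auto
    have "f \<in> C (t, j, Imp s, False)" using f e by (simp add: C_def feat_hit_def)
    then have "card (C (t, j, Imp s, False)) \<noteq> 0" using fC by auto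
    then show False using ge [OF tj(1,2), of "Imp s"] tj(3) nz by (simp add: set_kinds)
  qed
  have "\<exists>s. s < n \<and> (\<exists>f\<in>S. f < last_feat \<and> feats ! f = (t, j, s))" if tj: "t < m" "j < m" for t j
  proof -
    have "card (C (t, j, Dom, False)) \<noteq> 0"
      using ge [OF tj, of Dom] zS na [of Dom] by (auto simp: set_kinds last_weight_def simp del: card_0_eq)
    then have "C (t, j, Dom, False) \<noteq> {}" by auto
    then obtain f where f: "f \<in> C (t, j, Dom, False)" by blast
    obtain t' j' s where e: "feats ! f = (t', j', s)" by (metis prod_cases3)
    then have "t' = t" "j' = j" "f \<in> S" "f < last_feat" using f by (auto simp: C_def feat_hit_def)
    then show ?thesis using e nth_mem [of f feats] set_feats by auto
  qed
  then obtain \<tau> where \<tau>: "\<And>t j. t < m \<Longrightarrow> j < m \<Longrightarrow> \<tau> t j < n \<and> (\<exists>f\<in>S. f < last_feat \<and> feats ! f = (t, j, \<tau> t j))"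
    by metis
  have "tiling {..<n} U H V Y \<tau>"
    unfolding tiling_def m [symmetric]
  proof (intro allI impI conjI)
    fix t j assume tj: "t < m" "j < m"
    then obtain f where f: "f \<in> S" "f < last_feat" "feats ! f = (t, j, \<tau> t j)" and tn: "\<tau> t j < n" using \<tau> by blast
    show "\<tau> t j \<in> {..<n}" using tn by simp
    show "U (tile_env Y t j) (\<tau> t j)"
    proof (rule ccontr)
      assume "\<not> ?thesis"
      then have "f \<in> C (t, j, Single (\<tau> t j), False)" using f by (simp add: C_def feat_hit_def)
      then have "card (C (t, j, Single (\<tau> t j), False)) \<noteq> 0" using fC by auto
      then show False using ge [OF tj, of "Single (\<tau> t j)"] zS tn na by (simp add: set_kinds last_weight_def)
    qed
    \<comment> \<open>The two tiles of a pair are different features because their positions differ,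
      and two hits push 3 - 2N below 0.\<close>
    have two: "2 \<le> card (C x)" if "f \<in> C x" "g \<in> C x" "f \<noteq> g" for x g
      using card_mono [OF fC, of "{f, g}" x] that by auto
    show "H (tile_env Y t j) (\<tau> t j) (\<tau> t (Suc j))" if sj: "Suc j < m"
    proof (rule ccontr)
      assume nH: "\<not> ?thesis"
      obtain g where g: "g \<in> S" "g < last_feat" "feats ! g = (t, Suc j, \<tau> t (Suc j))" "\<tau> t (Suc j) < n" using \<tau> tj sj by blast
      have "2 \<le> card (C (t, j, Hor (\<tau> t j) (\<tau> t (Suc j)), False))"
        by (rule two [of _ g]) (use f g nH in \<open>auto simp: C_def feat_hit_def\<close>)
      then show False using ge [OF tj, of "Hor (\<tau> t j) (\<tau> t (Suc j))"] zS tn g(4) na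
        by (auto simp: set_kinds last_weight_def image_iff)
    qed
    show "V (tile_env Y t j) (\<tau> t j) (\<tau> (Suc t) j)" if st: "Suc t < m"
    proof (rule ccontr)
      assume nV: "\<not> ?thesis"
      obtain g where g: "g \<in> S" "g < last_feat" "feats ! g = (Suc t, j, \<tau> (Suc t) j)" "\<tau> (Suc t) j < n" using \<tau> tj st by blast
      have "2 \<le> card (C (t, j, Ver (\<tau> t j) (\<tau> (Suc t) j), False))"
        by (rule two [of _ g]) (use f g nV in \<open>auto simp: C_def feat_hit_def\<close>)
      then show False using ge [OF tj, of "Ver (\<tau> t j) (\<tau> (Suc t) j)"] zS tn g(4) na
        by (auto simp: set_kinds last_weight_def image_iff)
    qed
  qed
  then show ?thesis by blast
qed

lemma tiling_iff_fsp:
  assumes dI: "admissible_metrics dI" and dX: "admissible_metrics dX"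
    and l1I: "\<And>n x y. length x = n \<Longrightarrow> length y = n \<Longrightarrow> dI cI n x y = l1_dist n x y"
    and l1X: "\<And>n x y. length x = n \<Longrightarrow> length y = n \<Longrightarrow> dX cX n x y = l1_dist n x y"
    and Y: "m = length Y" "0 < m" "\<And>j. j < m \<Longrightarrow> Y ! j = 1 \<longleftrightarrow> j = 0"
    and L: "Suc last_feat \<le> L" and I: "I = mk_fsp cI cX L point_vec sol_of tags"
    and val: "val = value_opt dI dX I \<or> val = value_pess dI dX I"
  shows "valid_fsp I" "(\<exists>S. feasible I S \<and> val S \<le> 0) \<longleftrightarrow> (\<exists>\<tau>. tiling {..<n} U H V Y \<tau>)"
proof -
  define a where "a = (0 :: nat, 0 :: nat, Anchor, False)"
  define b where "b = (0 :: nat, 0 :: nat, Anchor, True)"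
  have anchor: "is_anchor (tile_env Y t j) \<kappa> \<longleftrightarrow> (t, j, \<kappa>) = a" if "t < m" "j < m" for t j \<kappa>
    using Y(3) [OF that(2)] by (auto simp: is_anchor_def tile_env_def a_def)
  have anchor_a: "is_anchor (tile_env Y 0 0) (Anchor, False)"
    using anchor [of 0 0] Y by (simp add: a_def)
  have 1: "a \<in> set tags" "b \<in> set tags" "b \<noteq> a" "sol_of a = 0" "sol_of b = 0"
    using Y(2) by (auto simp: a_def b_def set_tags set_kinds sol_of_def sol_val_def)
  have va: "point_vec a = replicate (Suc last_feat) 0"
    by (rule nth_equalityI) (auto simp: length_vec point_vec_def nth_append feat_weight_def weight_def
      last_weight_def a_def anchor_a simp del: replicate_Suc split: prod.splits)
  have zero: "point_vec x = replicate (Suc last_feat) 4" if "x \<in> set tags" "x \<noteq> a" "sol_of x = 0" for x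
  proof -
    obtain t j \<kappa> copy where xe: "x = (t, j, \<kappa>, copy)" by (metis prod_cases4)
    have \<kappa>: "\<kappa> = Anchor \<or> \<kappa> = Ref" using that(3) by (auto simp: xe sol_of_def sol_val_def split: if_splits)
    have na: "\<not> is_anchor (tile_env Y t j) (\<kappa>, copy)" using that anchor by (auto simp: xe set_tags)
    show ?thesis
      using \<kappa> na by (intro nth_equalityI) (auto simp: length_vec point_vec_def nth_append feat_weight_def
        weight_def last_weight_def xe simp del: replicate_Suc split: prod.splits)
  qed
  have dup: "\<exists>y\<in>set tags. y \<noteq> x \<and> point_vec y = point_vec x \<and> sol_of y = sol_of x" if x: "x \<in> set tags" "x \<noteq> a" for x
  proof -
    obtain t j \<kappa> copy where xe: "x = (t, j, \<kappa>, copy)" by (metis prod_cases4)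
    have tj: "t < m" "j < m" "\<kappa> \<in> set (kinds n)" using x by (auto simp: xe set_tags)
    show ?thesis
    proof (cases "\<kappa> = Anchor")
      case True
      \<comment> \<open>The other copy may be the anchor itself, so the twin is taken from the
        reference points at the same position.\<close>
      define y where "y = (t, j, Ref, copy)"
      have "y \<in> set tags" "y \<noteq> x" "y \<noteq> a" "sol_of y = 0" "sol_of x = 0"
        using tj True by (auto simp: y_def xe set_tags set_kinds a_def sol_of_def sol_val_def)
      then show ?thesis using zero x by (intro bexI [of _ y]) simp_all
    next
      case False
      define y where "y = (t, j, \<kappa>, \<not> copy)"
      have "point_vec y = point_vec x" using False
        by (auto simp: point_vec_def feat_weight_def weight_def last_weight_def is_anchor_def xe y_def split: prod.splits)
      moreover have "y \<in> set tags" "y \<noteq> x" "sol_of y = sol_of x"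
        using tj by (auto simp: y_def xe set_tags sol_of_def sol_val_def)
      ultimately show ?thesis by blast
    qed
  qed
  have zz: "point_vec x ! last_feat \<noteq> 0 \<and> point_vec x ! last_feat \<noteq> 4" if "x \<in> set tags" "sol_of x \<noteq> 0" for x
  proof -
    obtain t j \<kappa> copy where xe: "x = (t, j, \<kappa>, copy)" by (metis prod_cases4)
    show ?thesis
      using that(2) by (auto simp: xe point_vec_def nth_append last_weight_def sol_of_def sol_val_def is_anchor_def
        split: kind.splits if_splits)
  qed
  have s01: "sol_of x \<le> 1" if "x \<in> set tags" for x by (simp add: sol_of_def sol_val_def)
  have len: "length (point_vec x) = Suc last_feat" if "x \<in> set tags" for x by (rule length_vec)
  have z0: "last_feat < Suc last_feat" by simp
  note core = dI dX l1I l1X distinct_tags len 1(1) va 1(4) 1(2,3,5) zero dup z0 zz s01 I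
  show "valid_fsp I"
    by (rule mk_fsp_valid [OF core])
  have feas: "feasible I S \<longleftrightarrow> S \<subseteq> {..<Suc last_feat} \<and> S \<noteq> {} \<and> card S \<le> L" for S
    by (rule mk_fsp_feasible [OF core])
  have val': "val S = value_opt dI dX I S \<or> val S = value_pess dI dX I S" for S using val by auto
  show "(\<exists>S. feasible I S \<and> val S \<le> 0) \<longleftrightarrow> (\<exists>\<tau>. tiling {..<n} U H V Y \<tau>)"
  proof
    assume "\<exists>S. feasible I S \<and> val S \<le> 0"
    then obtain S where S: "S \<subseteq> {..<Suc last_feat}" "S \<noteq> {}" "val S \<le> 0" using feas by blast
    have "4 * card S \<le> (\<Sum>f\<in>S. point_vec x ! f)" if "x \<in> set tags" "sol_of x \<noteq> 0" for x
      by (rule value_le_0_imp [OF core val' S(3) S(1) that])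
    then show "\<exists>\<tau>. tiling {..<n} U H V Y \<tau>" by (rule selection_imp_tiling [OF Y(1) S(1,2)])
  next
    assume "\<exists>\<tau>. tiling {..<n} U H V Y \<tau>"
    then obtain \<tau> where \<tau>: "tiling {..<n} U H V Y \<tau>" by blast
    define S where "S = {f. f < last_feat \<and> (\<exists>t j. feats ! f = (t, j, \<tau> t j))} \<union> {last_feat}"
    have S: "S \<subseteq> {..<Suc last_feat}" "last_feat \<in> S" by (auto simp: S_def)
    have "val S \<le> 0"
      by (rule value_le_0I [OF core val' S]) (auto intro: tiling_imp_selection [OF Y(1) \<tau> S_def])
    moreover have "card S \<le> L" using card_mono [OF _ S(1)] L by simp
    ultimately show "\<exists>S. feasible I S \<and> val S \<le> 0" using S feas by blast
  qed
qed

end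

end

section \<open>Evaluating nested loops\<close>

lemma concat_map_concat: "concat (map f (concat xss)) = concat (map (\<lambda>xs. concat (map f xs)) xss)"
  by (induction xss) auto

lemma concat_concat: "concat (concat xss) = concat (map concat xss)"
  by (induction xss) auto

text \<open>\<open>tups\<close> appends the innermost index, as iterated marking does; the
  evaluation of the printing loops peels off the outermost one.\<close>

lemma tups_Cons: "tups (Suc k) m = concat (map (\<lambda>i. map ((#) i) (tups k m)) [0..<m])"
proof (induction k)
  case (Suc k)
  have "tups (Suc (Suc k)) m = concat (map (\<lambda>is. map (\<lambda>i. is @ [i]) [0..<m])
      (concat (map (\<lambda>i. map ((#) i) (tups k m)) [0..<m])))"
    by (subst tups.simps) (simp only: Suc)
  also have "\<dots> = concat (map (\<lambda>i. map ((#) i) (tups (Suc k) m)) [0..<m])"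
    by (simp add: concat_map_concat map_concat comp_def concat_concat)
  finally show ?case .
qed (simp add: concat_map_singleton)

lemma concat_tups_Suc:
  "concat (map W (tups (Suc k) m)) = concat (map (\<lambda>i. concat (map (\<lambda>is. W (i # is)) (tups k m))) [0..<m])"
  unfolding tups_Cons by (simp add: concat_map_concat comp_def)

lemma concat_first:
  assumes "distinct xs" "xs \<noteq> []"
  shows "concat (map (\<lambda>x. (if x = hd xs then A else []) @ g x) xs) = A @ concat (map g xs)"
proof -
  obtain a ys where xs: "xs = a # ys" using assms by (cases xs) auto
  have "concat (map (\<lambda>x. (if x = a then A else []) @ g x) ys) = concat (map g ys)"
    using assms xs by (intro arg_cong [where f = concat] map_cong) auto
  then show ?thesis by (simp add: xs)
qed

lemma concat_last:
  assumes "distinct xs" "xs \<noteq> []"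
  shows "concat (map (\<lambda>x. g x @ (if x = last xs then B else [])) xs) = concat (map g xs) @ B"
proof -
  obtain a ys where xs: "xs = ys @ [a]" using assms by (cases xs rule: rev_cases) auto
  have "concat (map (\<lambda>x. g x @ (if x = a then B else [])) ys) = concat (map g ys)"
    using assms xs by (intro arg_cong [where f = concat] map_cong) auto
  then show ?thesis by (simp add: xs)
qed

text \<open>In a duplicate-free range the first and the last iteration are recognized by their
  values. This is how brackets around the output of a loop are printed from inside it.\<close>

lemma concat_first_last:
  assumes "distinct xs" "xs \<noteq> []"
  shows "concat (map (\<lambda>x. (if x = hd xs then A else []) @ g x @ (if x = last xs then B else [])) xs) =
    A @ concat (map g xs) @ B"
  using concat_first [OF assms, of A "\<lambda>x. g x @ (if x = last xs then B else [])"] concat_last [OF assms]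
  by simp

lemma concat_product:
  "concat (map f (List.product xs ys)) = concat (map (\<lambda>x. concat (map (\<lambda>y. f (x, y)) ys)) xs)"
  by (induction xs) (simp_all add: comp_def)

lemma product_snoc: "List.product (xs @ [x]) ys = List.product xs ys @ map (Pair x) ys"
  by (induction xs) auto

lemma hd_last_product:
  "hd (List.product [0..<Suc k] [0..<Suc k]) = (0, 0)"
  "last (List.product [0..<Suc k] [0..<Suc k]) = (k, k)"
proof -
  have "[0..<Suc k] = 0 # [Suc 0..<Suc k]" by (rule upt_conv_Cons) simp
  then show "hd (List.product [0..<Suc k] [0..<Suc k]) = (0, 0)" by (simp del: upt_Suc)
  have "List.product [0..<Suc k] ys = List.product [0..<k] ys @ map (Pair k) ys" for ys :: "nat list"
    by (simp add: product_snoc)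
  then show "last (List.product [0..<Suc k] [0..<Suc k]) = (k, k)"
    by (simp add: last_map del: upt_Suc)
qed

lemma distinct_tups: "distinct (tups k m)"
proof (induction k)
  case (Suc k)
  have "tups (Suc k) m = map (\<lambda>(i, is). i # is) (List.product [0..<m] (tups k m))"
    by (simp add: tups_Cons product_concat_map map_concat comp_def del: tups.simps)
  then show ?case using Suc by (auto simp: distinct_map distinct_product inj_on_def)
qed simp

lemma length_tups: "length (tups k m) = m ^ k"
  by (induction k) (simp_all add: length_concat comp_def sum_list_triv)

lemma tups_hd_last:
  "tups k (Suc m) \<noteq> []" "hd (tups k (Suc m)) = replicate k 0" "last (tups k (Suc m)) = replicate k m"
proof -
  have ne: "tups k (Suc m) \<noteq> []" for k using length_tups [of k "Suc m"] by auto
  show "tups k (Suc m) \<noteq> []" by (rule ne)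
  show "hd (tups k (Suc m)) = replicate k 0"
    by (induction k) (simp_all add: tups_Cons upt_conv_Cons ne hd_map del: upt_Suc tups.simps(2))
  show "last (tups k (Suc m)) = replicate k m"
    by (induction k) (simp_all add: tups_Cons ne last_map del: tups.simps(2))
qed

section \<open>Unary counters\<close>

lemma ptime_compose_word:
  assumes "ptime D eI enc_word F" "ptime E enc_word eO G" "\<And>x. x \<in> D \<Longrightarrow> F x \<in> E"
  shows "ptime D eI eO (\<lambda>x. G (F x))"
  by (rule ptime_compose [OF assms(1,2)]) (use assms(3) enc_word_ge2 in blast)+

lemma loops_word:
  fixes A :: "'a::countable set" and F :: "'a list \<Rightarrow> 'b::countable list"
  assumes "finite A"
    and F: "\<And>X. set X \<subseteq> A \<Longrightarrow> F X =
      concat (map (\<lambda>is. W (map ((!) X) is)) (tups (Suc k) (length X))) @ suf"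
  shows "ptime {X. set X \<subseteq> A} enc_word enc_word F"
proof -
  let ?c = "map (\<lambda>a. code (a, [] :: bool list))"
  show ?thesis
    by (rule loops_ptime [OF assms(1), where W = "\<lambda>ls _ _. ?c (W ls)" and suf = "?c suf @ [2]"])
      (simp add: F enc_word_def encB_def map_concat comp_def del: tups.simps)
qed

text \<open>
  The letters of a counter word: 1 is the end marker of the tape, 2 and 3 are the bits of the input, 6
  ends the input, 4 counts the cells of the certificate, and 0 counts blanks. Looping over pairs of
  positions multiplies a counter by the length of the input and adds a constant, which is a step of
  the Horner scheme.
\<close>

definition counter_word :: "bool list \<Rightarrow> nat \<Rightarrow> nat \<Rightarrow> nat list" where
  "counter_word x f b = 1 # map bit_symbol x @ [6] @ replicate f 4 @ replicate b 0"

text \<open>\<open>u\<close> decides what a pass over all \<open>v\<close> contributes: the marker 1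
  copies everything but the counter \<open>l\<close>, each input bit copies this counter once, and 6
  adds the constant \<open>a\<close>.\<close>

definition grow :: "nat \<Rightarrow> nat \<Rightarrow> nat \<Rightarrow> nat \<Rightarrow> nat list" where
  "grow l a u v =
     (if u = 1 then (if v = l then [] else [v])
      else if u = 6 then (if v = 1 then replicate a l else [])
      else if u \<in> {2, 3} then (if v = l then [v] else [])
      else [])"

lemma loop_letters: "concat (map (\<lambda>i. f (X ! i)) [0..<length X]) = concat (map f X)"
  by (metis (no_types, lifting) map_map map_nth comp_def map_eq_conv)

lemma loops_1: "concat (map (\<lambda>is. W (map ((!) X) is)) (tups (Suc 0) (length X))) = concat (map (\<lambda>u. W [u]) X)"
  unfolding concat_tups_Suc using loop_letters [of "\<lambda>u. W [u]" X] by simp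

lemma loops_2: "concat (map (\<lambda>is. W (map ((!) X) is)) (tups (Suc (Suc 0)) (length X))) =
    concat (map (\<lambda>u. concat (map (\<lambda>v. W [u, v]) X)) X)"
proof -
  have "concat (map (\<lambda>is. W (map ((!) X) is)) (tups (Suc (Suc 0)) (length X))) =
      concat (map (\<lambda>i. concat (map (\<lambda>j. W [X ! i, X ! j]) [0..<length X])) [0..<length X])"
    unfolding concat_tups_Suc by simp
  also have "\<dots> = concat (map (\<lambda>i. concat (map (\<lambda>v. W [X ! i, v]) X)) [0..<length X])"
  proof -
    have "concat (map (\<lambda>j. W [X ! i, X ! j]) [0..<length X]) = concat (map (\<lambda>v. W [X ! i, v]) X)" for i
      by (rule loop_letters [of "\<lambda>v. W [X ! i, v]"])
    then show ?thesis by (simp only:)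
  qed
  also have "\<dots> = concat (map (\<lambda>u. concat (map (\<lambda>v. W [u, v]) X)) X)"
    by (rule loop_letters [of "\<lambda>u. concat (map (\<lambda>v. W [u, v]) X)"])
  finally show ?thesis .
qed

lemma concat_map_const: "concat (map (\<lambda>_. w) xs) = concat (replicate (length xs) w)"
  by (induction xs) auto

lemma concat_replicate_single: "concat (replicate k [a]) = replicate k a"
  by (induction k) auto

lemma concat_replicate_replicate: "concat (replicate k (replicate f a)) = replicate (k * f) a"
  by (induction k) (auto simp: replicate_add)

lemma concat_replicate_Nil: "concat (replicate k []) = []"
  by (induction k) auto

lemma concat_map_bits: "(\<And>u. u \<in> {2, 3} \<Longrightarrow> f u = w) \<Longrightarrow>
    concat (map f (map bit_symbol x)) = concat (replicate (length x) w)"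
  by (induction x) (auto simp: bit_symbol_def)

lemma concat_map_bits_id: "(\<And>u. u \<in> {2, 3} \<Longrightarrow> f u = [u]) \<Longrightarrow>
    concat (map f (map bit_symbol x)) = map bit_symbol x"
  by (induction x) (auto simp: bit_symbol_def)

lemma grow_counter:
  fixes x :: "bool list" and f b :: nat
  assumes "l = 4 \<or> l = 0"
  defines "X \<equiv> counter_word x f b"
  shows "concat (map (\<lambda>u. concat (map (grow l a u) X)) X) =
    counter_word x (if l = 4 then 0 else f) (if l = 4 then b else 0) @
    replicate (length x * (if l = 4 then f else b)) l @ replicate a l"
proof -
  let ?row = "\<lambda>u. concat (map (grow l a u) X)"
  have 1: "?row 1 = counter_word x (if l = 4 then 0 else f) (if l = 4 then b else 0)"
    unfolding X_def counter_word_def map_append list.map concat_append concat.simps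
    by (subst concat_map_bits_id)
      (use assms(1) in \<open>auto simp: grow_def map_replicate_const concat_replicate_single concat_replicate_Nil\<close>)
  have 2: "?row u = replicate (if l = 4 then f else b) l" if "u \<in> {2, 3}" for u
    unfolding X_def counter_word_def map_append list.map concat_append concat.simps
    by (subst concat_map_bits [where w = "[]"])
      (use assms(1) that in \<open>auto simp: grow_def map_replicate_const concat_replicate_single concat_replicate_Nil\<close>)
  have 6: "?row 6 = replicate a l"
    unfolding X_def counter_word_def map_append list.map concat_append concat.simps
    by (subst concat_map_bits [where w = "[]"])
      (auto simp: grow_def map_replicate_const concat_replicate_Nil)
  have 0: "?row u = []" if "u = 4 \<or> u = 0" for u
    using that by (auto simp: grow_def)
  have "concat (map ?row (counter_word x f b)) = ?row 1 @ concat (map ?row (map bit_symbol x)) @ ?row 6 @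
      concat (replicate f (?row 4)) @ concat (replicate b (?row 0))"
    by (simp add: counter_word_def)
  also have "concat (map ?row (map bit_symbol x)) = replicate (length x * (if l = 4 then f else b)) l"
    by (subst concat_map_bits [OF 2]) (simp_all add: concat_replicate_replicate)
  finally show ?thesis
    by (simp add: 0 6 concat_replicate_Nil X_def [symmetric] 1 [unfolded One_nat_def])
qed

definition counter_letters :: "nat set" where
  "counter_letters = {0, 1, 2, 3, 4, 6}"

lemma set_counter_word: "set (counter_word x f b) \<subseteq> counter_letters"
  by (auto simp: counter_word_def counter_letters_def bit_symbol_def split: if_splits)

lemma grow_ptime:
  assumes "ptime UNIV eI enc_word (\<lambda>x. counter_word x (f x) (b x))" "l = 4 \<or> l = 0"
  shows "ptime UNIV eI enc_word (\<lambda>x. counter_word x (if l = 4 then 0 else f x) (if l = 4 then b x else 0) @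
    replicate (length x * (if l = 4 then f x else b x)) l @ replicate a l)"
proof -
  define W where "W = (\<lambda>ls. grow l a (ls ! 0) (ls ! 1))"
  have "ptime {X. set X \<subseteq> counter_letters} enc_word enc_word
      (\<lambda>X. concat (map (\<lambda>u. concat (map (grow l a u) X)) X))"
  proof (rule loops_word [where W = W and suf = "[]" and k = "Suc 0"])
    show "concat (map (\<lambda>u. concat (map (grow l a u) X)) X) =
        concat (map (\<lambda>is. W (map ((!) X) is)) (tups (Suc (Suc 0)) (length X))) @ []" for X
      unfolding loops_2 by (simp add: W_def)
  qed (simp add: counter_letters_def)
  from ptime_compose_word [OF assms(1) this] show ?thesis
    using set_counter_word by (simp add: grow_counter [OF assms(2)])
qed

text \<open>Each \<open>pCons\<close> is a Horner step. As \<open>grow\<close> leaves the new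
  counter at the end of the word, the letters 4 are completed while there are no blanks yet.\<close>

lemma counter_ptime_4:
  "ptime UNIV (map bit_symbol) enc_word (\<lambda>x. counter_word x (poly p (length x)) 0)"
proof (induction p)
  case 0
  define h :: "nat \<Rightarrow> nat list" where
    "h = (\<lambda>a. if a = 0 then [code (6 :: nat, [] :: bool list), 2] else [code (a, [] :: bool list)])"
  have h: "concat (map h (map bit_symbol x)) = map (\<lambda>b. code (bit_symbol b, [] :: bool list)) x" for x
    by (induction x) (auto simp: h_def bit_symbol_def)
  show ?case
  proof (rule subst_ptime [where G = 4 and h = h])
    show "set (map bit_symbol x) \<subseteq> {0<..<4}" for x by (auto simp: bit_symbol_def)
    show "enc_word (counter_word x (poly 0 (length x)) 0) = concat (map h (1 # map bit_symbol x)) @ h 0" for x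
      by (simp add: h del: map_map) (simp add: h_def enc_word_def encB_def counter_word_def)
  qed
next
  case (pCons a p)
  from grow_ptime [OF pCons(2), of 4 a] show ?case
    by (simp add: counter_word_def replicate_add [symmetric] add.commute)
qed

lemma counter_ptime:
  "ptime UNIV (map bit_symbol) enc_word (\<lambda>x. counter_word x (poly p (length x)) (poly r (length x)))"
proof (induction r)
  case 0
  show ?case using counter_ptime_4 [of p] by simp
next
  case (pCons a r)
  from grow_ptime [OF pCons(2), of 0 a] show ?case
    by (simp add: counter_word_def replicate_add [symmetric] add.commute)
qed

section \<open>Printing the instance\<close>

datatype letter = Row "kind \<times> bool" | Pos nat | End

instance kind :: countable by countable_datatype
instance letter :: countable by countable_datatype

text \<open>All loops run over the same word and filter by the kind of letter. \<open>End\<close>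
  comes last, so that the fields after the list of points are printed last.\<close>

definition loop_word :: "nat \<Rightarrow> nat list \<Rightarrow> letter list" where
  "loop_word n Y = map Row (tagged_kinds n) @ map Pos Y @ [End]"

lemma loop_word_ptime:
  "ptime UNIV (map bit_symbol) enc_word
     (\<lambda>x. loop_word n (cell_labels x (poly p (length x)) (poly r (length x))))"
proof -
  \<comment> \<open>Produces \<open>encode_bits\<close>: every bit is preceded by 3 (True), and the
    terminator 6 becomes the final 2 (False).\<close>
  define h :: "nat \<Rightarrow> letter list" where
    "h = (\<lambda>u. if u = 1 then map Row (tagged_kinds n) @ [Pos 1]
              else if u \<in> {2, 3} then [Pos 3, Pos u]
              else if u = 6 then [Pos 2] else [Pos u])"
  define W where "W = (\<lambda>ls. h (ls ! 0))"
  have "ptime {X. set X \<subseteq> counter_letters} enc_word enc_word (\<lambda>X. concat (map h X) @ [Pos 5, End])"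
  proof (rule loops_word [where W = W and k = 0 and suf = "[Pos 5, End]"])
    show "concat (map h X) @ [Pos 5, End] =
        concat (map (\<lambda>is. W (map ((!) X) is)) (tups (Suc 0) (length X))) @ [Pos 5, End]" for X
      unfolding loops_1 by (simp add: W_def)
  qed (simp add: counter_letters_def)
  from ptime_compose_word [OF counter_ptime this]
  have "ptime UNIV (map bit_symbol) enc_word
     (\<lambda>x. concat (map h (counter_word x (poly p (length x)) (poly r (length x)))) @ [Pos 5, End])"
    using set_counter_word by simp
  moreover have "concat (map h (counter_word x f b)) @ [Pos 5, End] = loop_word n (cell_labels x f b)" for x f b
  proof -
    have "concat (map h (map bit_symbol x)) @ [Pos 2] = map Pos (map bit_symbol (encode_bits x))"
      by (induction x) (auto simp: h_def bit_symbol_def encode_bits_def)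
    then show ?thesis
      by (simp add: counter_word_def loop_word_def cell_labels_def h_def map_replicate_const concat_replicate_single del: map_map)
  qed
  ultimately show ?thesis by simp
qed

text \<open>
  The feature bound is not restrictive; it is a power of two because its binary code can then be
  printed by a loop.
\<close>

definition entry_code :: "nat \<Rightarrow> bool list" where
  "entry_code w = True # encode_rat (of_nat w)"

definition header_code :: "nat \<Rightarrow> nat \<Rightarrow> bool list" where
  "header_code cI cX = False # encode_nat cI @ encode_nat cX @ encode_nat 1"

definition footer_code :: "bool list" where
  "footer_code = [True, True, False] @ encode_rat 0"

context
  fixes U :: "env \<Rightarrow> nat \<Rightarrow> bool" and H V :: "env \<Rightarrow> nat \<Rightarrow> nat \<Rightarrow> bool" and n cI cX :: nat
begin

text \<open>The loop variables are t, j, the row kind, t', j'; the tile is not looped over since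
  \<open>n\<close> is fixed. Labels 1 and 5 occur only in the first and the last cell, so they tell
  whether t is first or last, and whether (t', j') is the pair at which a point is opened or
  completed. Tuples with other kinds of letters print nothing.\<close>

fun point_part :: "letter list \<Rightarrow> (nat \<Rightarrow> nat \<Rightarrow> bool) \<Rightarrow> (nat \<Rightarrow> nat \<Rightarrow> bool) \<Rightarrow> bool list" where
  "point_part [Pos a, Pos b, Row \<kappa>, Pos a', Pos b'] eq su =
     (if a' = 1 \<and> b' = 1 then [True] else []) @
     concat (map (\<lambda>s. entry_code (weight U H V (a = 1, a = 5, b) \<kappa> (eq 0 3) (su 0 3) (eq 1 4) (su 1 4) s)) [0..<n]) @
     (if a' = 5 \<and> b' = 5 then
        entry_code (last_weight (a = 1, a = 5, b) \<kappa>) @ [False] @ entry_code (sol_val \<kappa>) @ [False]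
      else [])"
| "point_part (End # ls) eq su =
     (if ls = replicate 4 (Row (Anchor, False)) then header_code cI cX else []) @
     [True, False] @
     (if ls = replicate 4 End then footer_code else [])"
| "point_part _ eq su = []"

definition print_loops :: "letter list \<Rightarrow> bool list" where
  "print_loops X = concat (map (\<lambda>is. point_part (map ((!) X) is) (eq_at is) (succ_at is)) (tups 5 (length X)))"

lemma print_loops_ptime:
  assumes "finite A"
  shows "ptime {X. set X \<subseteq> A} enc_word (map bit_symbol) print_loops"
  by (rule loops_ptime [OF assms, where W = "\<lambda>ls eq su. map bit_symbol (point_part ls eq su)" and suf = "[]" and k = 4])
    (simp add: print_loops_def map_concat comp_def del: tups.simps)

text \<open>With the least significant bit first, the zeros precede the single 1, and each zero is
  coded by the same two bits; a loop can print them.\<close>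

lemma encode_nat_power: "encode_nat (2 ^ q) = concat (replicate q [True, False]) @ [True, True, False]"
proof -
  have "binary (2 ^ q) = replicate q False @ [True]"
  proof (induction q)
    case 0
    show ?case by (simp add: binary.simps [of "Suc 0"] binary.simps [of 0])
  next
    case (Suc q)
    then show ?case by (subst binary.simps) simp
  qed
  then show ?thesis
    by (simp add: encode_nat_def encode_bits_def map_replicate_const)
qed

context
  fixes Y :: "nat list" and m k X
  assumes m: "length Y = m" "m = Suc k" and Y1: "\<And>j. j < m \<Longrightarrow> Y ! j = 1 \<longleftrightarrow> j = 0"
    and Y5: "\<And>j. j < m \<Longrightarrow> Y ! j = 5 \<longleftrightarrow> j = k" and X_def: "X = loop_word n Y"
begin

abbreviation R :: nat where "R \<equiv> length (tagged_kinds n)"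

lemma length_X: "length X = R + m + 1"
  by (simp add: X_def loop_word_def m)

lemma X_nth:
  "i < R \<Longrightarrow> X ! i = Row (tagged_kinds n ! i)"
  "t < m \<Longrightarrow> X ! (R + t) = Pos (Y ! t)"
  "X ! (R + m) = End"
  using m by (simp_all add: X_def loop_word_def nth_append)

lemma loop_split:
  "concat (map f [0..<length X]) =
     concat (map f [0..<R]) @ concat (map (\<lambda>t. f (R + t)) [0..<m]) @ f (R + m)"
proof -
  have "[0..<length X] = [0..<R] @ map (\<lambda>t. R + t) [0..<m] @ [R + m]"
    unfolding length_X using upt_add_eq_append [of 0 R "m + 1"] by (simp add: map_add_upt add.commute)
  then show ?thesis by (simp add: comp_def)
qed

lemma concat_Nil: "(\<And>x. x \<in> set xs \<Longrightarrow> f x = []) \<Longrightarrow> concat (map f xs) = []"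
  by simp

lemma loop_positions:
  assumes "\<And>i. i < R \<Longrightarrow> f i = []" "f (R + m) = []"
  shows "concat (map f [0..<length X]) = concat (map (\<lambda>t. f (R + t)) [0..<m])"
  unfolding loop_split using assms by simp

lemma loop_rows:
  assumes "\<And>t. t < m \<Longrightarrow> f (R + t) = []" "f (R + m) = []" "\<And>i. i < R \<Longrightarrow> f i = g (tagged_kinds n ! i)"
  shows "concat (map f [0..<length X]) = concat (map g (tagged_kinds n))"
proof -
  have "map f [0..<R] = map g (tagged_kinds n)"
    by (rule nth_equalityI) (simp_all add: assms(3))
  then show ?thesis unfolding loop_split using assms by simp
qed

definition row_code :: "nat \<Rightarrow> nat \<Rightarrow> kind \<times> bool \<Rightarrow> bool list" where
  "row_code t j \<kappa> = True # concat (map entry_code (point_vec U H V n m Y (t, j, \<kappa>))) @ [False] @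
     entry_code (sol_val \<kappa>) @ [False]"

text \<open>The opening bit and the tail of a point are moved into the first and the last pair of
  positions, which are (0, 0) and (k, k).\<close>

lemma row_loops:
  assumes t: "t < m" and j: "j < m"
  shows "concat (map (\<lambda>t'. concat (map (\<lambda>j'.
      (if Y ! t' = 1 \<and> Y ! j' = 1 then [True] else []) @
     concat (map (\<lambda>s. entry_code (weight U H V (Y ! t = 1, Y ! t = 5, Y ! j) \<kappa> (t' = t) (t' = Suc t) (j' = j) (j' = Suc j) s)) [0..<n]) @
     (if Y ! t' = 5 \<and> Y ! j' = 5 then
        entry_code (last_weight (Y ! t = 1, Y ! t = 5, Y ! j) \<kappa>) @ [False] @ entry_code (sol_val \<kappa>) @ [False]
      else [])) [0..<m])) [0..<m]) = row_code t j \<kappa>"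
proof -
  let ?P = "List.product [0..<m] [0..<m]"
  have e: "(Y ! t = 1, Y ! t = 5, Y ! j) = tile_env Y t j" using Y1 [OF t] Y5 [OF t] m by (simp add: tile_env_def)
  let ?g = "\<lambda>(t', j'). concat (map (\<lambda>s. entry_code (feat_weight U H V Y (t, j, \<kappa>) (t', j', s))) [0..<n])"
  let ?B = "entry_code (last_weight (tile_env Y t j) \<kappa>) @ [False] @ entry_code (sol_val \<kappa>) @ [False]"
  have dP: "distinct ?P" by (simp add: distinct_product)
  have "(0, 0) \<in> set ?P" using m(2) by auto
  then have neP: "?P \<noteq> []" by force
  have "row_code t j \<kappa> = [True] @ concat (map ?g ?P) @ ?B"
    by (simp add: row_code_def point_vec_def feats_def map_concat comp_def concat_product)
  also have "\<dots> = concat (map (\<lambda>x. (if x = hd ?P then [True] else []) @ ?g x @ (if x = last ?P then ?B else [])) ?P)"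
    by (rule concat_first_last [OF dP neP, symmetric])
  also have "\<dots> = concat (map (\<lambda>t'. concat (map (\<lambda>j'.
      (if (t', j') = (0, 0) then [True] else []) @ ?g (t', j') @ (if (t', j') = (k, k) then ?B else [])) [0..<m])) [0..<m])"
    unfolding concat_product unfolding m(2) hd_last_product ..
  finally have r: "row_code t j \<kappa> = \<dots>" .
  show ?thesis
    unfolding e r
  proof (intro arg_cong [where f = concat] map_cong refl)
    fix t' j' assume "t' \<in> set [0..<m]" "j' \<in> set [0..<m]"
    then have lt: "t' < m" "j' < m" by simp_all
    show "(if Y ! t' = 1 \<and> Y ! j' = 1 then [True] else []) @
       concat (map (\<lambda>s. entry_code (weight U H V (tile_env Y t j) \<kappa> (t' = t) (t' = Suc t) (j' = j) (j' = Suc j) s)) [0..<n]) @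
       (if Y ! t' = 5 \<and> Y ! j' = 5 then ?B else []) =
      (if (t', j') = (0, 0) then [True] else []) @ ?g (t', j') @ (if (t', j') = (k, k) then ?B else [])"
      unfolding Y1 [OF lt(1)] Y1 [OF lt(2)] Y5 [OF lt(1)] Y5 [OF lt(2)] by (simp add: feat_weight_def)
  qed
qed

lemma points_loops:
  "concat (map (\<lambda>t. concat (map (\<lambda>is. point_part (map ((!) X) ((R + t) # is)) (eq_at ((R + t) # is)) (succ_at ((R + t) # is)))
     (tups 4 (length X)))) [0..<m]) =
   concat (map (\<lambda>(t, j, \<kappa>). row_code t j \<kappa>) (tags n m))"
proof -
  have nil: "R + m < R \<longleftrightarrow> False" by simp
  have "concat (map (\<lambda>is. point_part (map ((!) X) ((R + t) # is)) (eq_at ((R + t) # is)) (succ_at ((R + t) # is)))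
      (tups 4 (length X))) = concat (map (\<lambda>j. concat (map (row_code t j) (tagged_kinds n))) [0..<m])"
    if t: "t < m" for t
  proof -
    define W where "W = (\<lambda>is. point_part (map ((!) X) is) (eq_at is) (succ_at is))"
    have 4: "4 = Suc (Suc (Suc (Suc 0)))" by simp
    let ?l = "\<lambda>f. concat (map f [0..<length X])"
    have "concat (map (\<lambda>is. W ((R + t) # is)) (tups 4 (length X))) =
        ?l (\<lambda>i2. ?l (\<lambda>i3. ?l (\<lambda>i4. ?l (\<lambda>i5. W [R + t, i2, i3, i4, i5]))))"
      unfolding 4 concat_tups_Suc by simp
    also have "\<dots> = concat (map (\<lambda>j. ?l (\<lambda>i3. ?l (\<lambda>i4. ?l (\<lambda>i5. W [R + t, R + j, i3, i4, i5])))) [0..<m])"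
      by (rule loop_positions) (use t in \<open>simp_all add: W_def X_nth\<close>)
    also have "\<dots> = concat (map (\<lambda>j. concat (map (row_code t j) (tagged_kinds n))) [0..<m])"
    proof (rule arg_cong [where f = concat], rule map_cong [OF refl])
      fix j assume "j \<in> set [0..<m]"
      then have j: "j < m" by simp
      show "?l (\<lambda>i3. ?l (\<lambda>i4. ?l (\<lambda>i5. W [R + t, R + j, i3, i4, i5]))) = concat (map (row_code t j) (tagged_kinds n))"
      proof (rule loop_rows)
        fix i assume i: "i < R"
        define \<kappa> where "\<kappa> = tagged_kinds n ! i"
        have "?l (\<lambda>i4. ?l (\<lambda>i5. W [R + t, R + j, i, i4, i5])) =
            concat (map (\<lambda>t'. ?l (\<lambda>i5. W [R + t, R + j, i, R + t', i5])) [0..<m])"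
          by (rule loop_positions) (use t j i in \<open>simp_all add: W_def X_nth\<close>)
        also have "\<dots> = concat (map (\<lambda>t'. concat (map (\<lambda>j'. W [R + t, R + j, i, R + t', R + j']) [0..<m])) [0..<m])"
          by (intro arg_cong [where f = concat] map_cong refl loop_positions) (use t j i in \<open>simp_all add: W_def X_nth\<close>)
        also have "\<dots> = row_code t j \<kappa>"
          unfolding row_loops [OF t j, of \<kappa>, symmetric]
        proof (intro arg_cong [where f = concat] map_cong refl)
          fix t' j' assume "t' \<in> set [0..<m]" "j' \<in> set [0..<m]"
          then have lt: "t' < m" "j' < m" by simp_all
          let ?is = "[R + t, R + j, i, R + t', R + j']"
          have rel: "eq_at ?is 0 3 \<longleftrightarrow> t' = t" "succ_at ?is 0 3 \<longleftrightarrow> t' = Suc t"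
            "eq_at ?is 1 4 \<longleftrightarrow> j' = j" "succ_at ?is 1 4 \<longleftrightarrow> j' = Suc j"
            by (auto simp: eq_at_def succ_at_def numeral_eq_Suc)
          have lab: "map ((!) X) ?is = [Pos (Y ! t), Pos (Y ! j), Row \<kappa>, Pos (Y ! t'), Pos (Y ! j')]"
            using t j i lt by (simp add: X_nth \<kappa>_def)
          show "W ?is = (if Y ! t' = 1 \<and> Y ! j' = 1 then [True] else []) @
            concat (map (\<lambda>s. entry_code (weight U H V (Y ! t = 1, Y ! t = 5, Y ! j) \<kappa>
              (t' = t) (t' = Suc t) (j' = j) (j' = Suc j) s)) [0..<n]) @
            (if Y ! t' = 5 \<and> Y ! j' = 5 then
               entry_code (last_weight (Y ! t = 1, Y ! t = 5, Y ! j) \<kappa>) @ [False] @ entry_code (sol_val \<kappa>) @ [False]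
             else [])"
            unfolding W_def lab point_part.simps rel ..
        qed
        finally show "?l (\<lambda>i4. ?l (\<lambda>i5. W [R + t, R + j, i, i4, i5])) = row_code t j (tagged_kinds n ! i)"
          by (simp add: \<kappa>_def)
      qed (use t j in \<open>simp_all add: W_def X_nth\<close>)
    qed
    finally show ?thesis by (simp add: W_def)
  qed
  then have "concat (map (\<lambda>t. concat (map (\<lambda>is. point_part (map ((!) X) ((R + t) # is)) (eq_at ((R + t) # is)) (succ_at ((R + t) # is)))
     (tups 4 (length X)))) [0..<m]) =
     concat (map (\<lambda>t. concat (map (\<lambda>j. concat (map (row_code t j) (tagged_kinds n))) [0..<m])) [0..<m])"
    by - (rule arg_cong [where f = concat], rule map_cong [OF refl], simp)
  then show ?thesis by (simp add: tags_def concat_product)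
qed

lemma X_eq_iff:
  assumes "i < length X"
  shows "X ! i = Row (Anchor, False) \<longleftrightarrow> i = 0" "X ! i = End \<longleftrightarrow> i = R + m"
proof -
  have d: "distinct (tagged_kinds n)" by (simp add: tagged_kinds_def distinct_product distinct_kinds)
  have R0: "0 < R" "tagged_kinds n ! 0 = (Anchor, False)" by (simp_all add: tagged_kinds_def kinds_def)
  consider "i < R" | t where "i = R + t" "t < m" | "i = R + m"
    using assms unfolding length_X by (metis add.commute add_less_cancel_left le_add_diff_inverse2 less_antisym not_less plus_1_eq_Suc)
  then show "X ! i = Row (Anchor, False) \<longleftrightarrow> i = 0" "X ! i = End \<longleftrightarrow> i = R + m"
    using R0 nth_eq_iff_index_eq [OF d, of i 0] by (cases; simp add: X_nth)+
qed

text \<open>\<open>Row (Anchor, False)\<close> occurs only as the first letter and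
  \<open>End\<close> only as the last one, so constant tuples identify the first and the last
  iteration. Every iteration prints one zero bit of the feature bound.\<close>

lemma trailer_loops:
  "concat (map (\<lambda>is. point_part (map ((!) X) ((R + m) # is)) (eq_at ((R + m) # is)) (succ_at ((R + m) # is)))
     (tups 4 (length X))) =
   header_code cI cX @ concat (replicate (length X ^ 4) [True, False]) @ footer_code"
proof -
  let ?T = "tups 4 (length X)"
  have lX: "length X = Suc (R + m)" by (simp add: length_X)
  have hl: "?T \<noteq> []" "hd ?T = replicate 4 0" "last ?T = replicate 4 (R + m)"
    unfolding lX by (rule tups_hd_last)+
  have "point_part (map ((!) X) ((R + m) # is)) (eq_at ((R + m) # is)) (succ_at ((R + m) # is)) =
      (if is = hd ?T then header_code cI cX else []) @ [True, False] @ (if is = last ?T then footer_code else [])"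
    if "is \<in> set ?T" for "is"
  proof -
    have l4: "length is = 4" "\<And>i. i \<in> set is \<Longrightarrow> i < length X" using that by (auto simp: tups_mem)
    have "map ((!) X) is = replicate 4 c \<longleftrightarrow> is = replicate 4 p" if "\<And>i. i < length X \<Longrightarrow> X ! i = c \<longleftrightarrow> i = p" for c p
      using l4 that by (auto simp: list_eq_iff_nth_eq)
    then show ?thesis using X_eq_iff by (simp add: hl X_nth)
  qed
  then have "concat (map (\<lambda>is. point_part (map ((!) X) ((R + m) # is)) (eq_at ((R + m) # is)) (succ_at ((R + m) # is))) ?T) =
      concat (map (\<lambda>is. (if is = hd ?T then header_code cI cX else []) @ [True, False] @ (if is = last ?T then footer_code else [])) ?T)"
    by - (rule arg_cong [where f = concat], rule map_cong [OF refl], blast)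
  also have "\<dots> = header_code cI cX @ concat (map (\<lambda>_. [True, False]) ?T) @ footer_code"
    by (rule concat_first_last [OF distinct_tups hl(1)])
  finally show ?thesis by (simp only: concat_map_const length_tups)
qed

lemma print_loops_eq:
  "print_loops X =
     encode_fsp (mk_fsp cI cX (2 ^ (length X ^ 4)) (point_vec U H V n m Y) sol_of (tags n m))"
proof -
  let ?W = "\<lambda>is. point_part (map ((!) X) is) (eq_at is) (succ_at is)"
  have 5: "5 = Suc 4" by simp
  have "print_loops X = concat (map (\<lambda>i. concat (map (\<lambda>is. ?W (i # is)) (tups 4 (length X)))) [0..<length X])"
    unfolding print_loops_def 5 concat_tups_Suc ..
  also have "\<dots> = concat (map (\<lambda>t. concat (map (\<lambda>is. ?W ((R + t) # is)) (tups 4 (length X)))) [0..<m]) @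
      concat (map (\<lambda>is. ?W ((R + m) # is)) (tups 4 (length X)))"
    unfolding loop_split by (subst concat_Nil) (auto simp: X_nth intro!: concat_Nil)
  also have "\<dots> = concat (map (\<lambda>(t, j, \<kappa>). row_code t j \<kappa>) (tags n m)) @
      header_code cI cX @ concat (replicate (length X ^ 4) [True, False]) @ footer_code"
    unfolding points_loops trailer_loops ..
  also have "\<dots> = encode_fsp (mk_fsp cI cX (2 ^ (length X ^ 4)) (point_vec U H V n m Y) sol_of (tags n m))"
  proof -
    have "row_code t j \<kappa> = True # encode_point (map of_nat (point_vec U H V n m Y (t, j, \<kappa>)), [of_nat (sol_of (t, j, \<kappa>))])" for t j \<kappa>
      by (simp add: row_code_def encode_point_def encode_list_def entry_code_def [abs_def] comp_def sol_of_def)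
    then show ?thesis
      by (simp add: encode_fsp_def mk_fsp_def encode_list_def header_code_def footer_code_def encode_nat_power
        comp_def split_def)
  qed
  finally show ?thesis .
qed

end

end

lemma encode_fsp_in_FSP_EO:
  "encode_fsp I \<in> FSP_EO_opt dI dX \<longleftrightarrow>
     valid_fsp I \<and> (\<exists>S. feasible I S \<and> value_opt dI dX I S \<le> of_rat (budget I))"
  "encode_fsp I \<in> FSP_EO_pess dI dX \<longleftrightarrow>
     valid_fsp I \<and> (\<exists>S. feasible I S \<and> value_pess dI dX I S \<le> of_rat (budget I))"
  unfolding FSP_EO_opt_def FSP_EO_pess_def mem_Collect_eq by (metis encode_fsp_inj)+

lemma NP_reduces_to_FSP_EO:
  fixes dI dX :: metric_family
  assumes dI: "admissible_metrics dI" and dX: "admissible_metrics dX" and A: "A \<in> NP"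
  shows "\<exists>f. polytime f \<and> (\<forall>x. (x \<in> A \<longleftrightarrow> f x \<in> FSP_EO_opt dI dX) \<and> (x \<in> A \<longleftrightarrow> f x \<in> FSP_EO_pess dI dX))"
proof -
  obtain n :: nat and U H V and p r :: "nat poly" where A_iff: "\<And>x. x \<in> A \<longleftrightarrow>
    (\<exists>\<tau>. tiling {..<n} U H V (cell_labels x (poly p (length x)) (poly r (length x))) \<tau>)"
    using NP_tiling [OF A] by blast
  obtain cI where "\<forall>n x y. length x = n \<and> length y = n \<longrightarrow> dI cI n x y = l1_dist n x y"
    using conjunct2 [OF dI [unfolded admissible_metrics_def]] by (rule exE)
  then have cI: "dI cI n x y = l1_dist n x y" if "length x = n" "length y = n" for n x y
    using that by blast
  obtain cX where "\<forall>n x y. length x = n \<and> length y = n \<longrightarrow> dX cX n x y = l1_dist n x y"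
    using conjunct2 [OF dX [unfolded admissible_metrics_def]] by (rule exE)
  then have cX: "dX cX n x y = l1_dist n x y" if "length x = n" "length y = n" for n x y
    using that by blast
  define Y where "Y = (\<lambda>x. cell_labels x (poly p (length x)) (poly r (length x)))"
  define f where "f = (\<lambda>x. print_loops U H V n cI cX (loop_word n (Y x)))"
  define B where "B = Row ` set (tagged_kinds n) \<union> Pos ` {..5} \<union> {End}"
  have "set (Y x) \<subseteq> {..5}" for x
    by (auto simp: Y_def cell_labels_def bit_symbol_def split: if_splits)
  then have "set (loop_word n (Y x)) \<subseteq> B" for x
    by (auto simp: loop_word_def B_def)
  moreover have "finite B" by (simp add: B_def)
  ultimately have "ptime UNIV (map bit_symbol) (map bit_symbol) f"
    unfolding f_def Y_def
    by (intro ptime_compose_word [OF loop_word_ptime print_loops_ptime]) (auto simp: Y_def)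
  then have "polytime f" by (rule ptime_imp_polytime)
  moreover have "(x \<in> A \<longleftrightarrow> f x \<in> FSP_EO_opt dI dX) \<and> (x \<in> A \<longleftrightarrow> f x \<in> FSP_EO_pess dI dX)" for x
  proof -
    define m where "m = length (Y x)"
    define X where "X = loop_word n (Y x)"
    define I where "I = mk_fsp cI cX (2 ^ (length X ^ 4)) (point_vec U H V n m (Y x)) sol_of (tags n m)"
    have m: "m = Suc (m - 1)" by (simp add: m_def Y_def length_cell_labels)
    have Y1: "Y x ! j = 1 \<longleftrightarrow> j = 0" if "j < m" for j
      using cell_labels_eq_1 that unfolding m_def Y_def by blast
    have Y5: "Y x ! j = 5 \<longleftrightarrow> j = m - 1" if "j < m" for j
      using cell_labels_eq_5 [of j x] that m unfolding m_def Y_def by (metis Suc_inject)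
    have fx: "f x = encode_fsp I"
      unfolding f_def I_def X_def
      by (rule print_loops_eq [OF m_def [symmetric] m]) (use Y1 Y5 in auto)
    have "n \<le> length (tagged_kinds n)" by (simp add: tagged_kinds_def kinds_def)
    then have le: "n \<le> length X" "m \<le> length X" "1 \<le> length X" by (simp_all add: X_def loop_word_def m_def)
    \<comment> \<open>Each of the three factors is at most the length of \<open>X\<close>, so the
      fourth power of that length, and hence the printed bound, is large enough.\<close>
    have "length (feats n m) = m * m * n" by (simp add: feats_def)
    also have "\<dots> \<le> length X * length X * length X * length X"
      using le by (metis mult_le_mono mult.right_neutral)
    also have "\<dots> = length X ^ 4" by (simp add: power4_eq_xxxx)
    also have "\<dots> < 2 ^ (length X ^ 4)" by (rule less_exp)
    finally have L: "Suc (length (feats n m)) \<le> 2 ^ (length X ^ 4)" by simp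
    have m0: "0 < m" using m by simp
    have "(\<exists>S. feasible I S \<and> value_opt dI dX I S \<le> 0) \<longleftrightarrow> x \<in> A"
      "(\<exists>S. feasible I S \<and> value_pess dI dX I S \<le> 0) \<longleftrightarrow> x \<in> A" "valid_fsp I"
      using tiling_iff_fsp [OF dI dX cI cX m_def m0 Y1 L I_def] A_iff [of x] unfolding Y_def by blast+
    moreover have "budget I = 0" by (simp add: I_def mk_fsp_def)
    ultimately show ?thesis
      unfolding fx encode_fsp_in_FSP_EO by simp
  qed
  ultimately show ?thesis by blast
qed

theorem theorem1:
  fixes dI dX :: metric_family
  assumes "admissible_metrics dI" and "admissible_metrics dX"
  shows "NP_hard (FSP_EO_opt dI dX) \<and> NP_hard (FSP_EO_pess dI dX)"
  unfolding NP_hard_def polytime_reducible_def using NP_reduces_to_FSP_EO [OF assms] by blast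

end
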